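(* Let the game, the sets $X_i$, $\Theta$, the functions $f_i$, the communication graph, the function $\hat{\mathbf F}$, and the constants $L_F$, $\xi>0$, $\gamma$, $q\in(0,1)$ be as in the context, with Assumptions 1, 2 and 3 listed there. Let $s\in[0,1)$ and $\alpha_0>0$. For each integer $K\ge1$ let $\{\theta_k\}_{k=0}^{K-1}$ be generated by the inexact zeroth-order algorithm described in the context, with constant stepsize $\alpha=\frac{\alpha_0}{\sqrt K}$ and with inner iteration numbers satisfying $t_k\ge\left\lceil\frac{-s\ln(k+1)}{\ln q}\right\rceil$ for all $k$. Then, over those $K$ for which $\alpha\le\frac{\xi}{4(nNL_F+1)}$, $$\frac1K\sum_{k=0}^{K-1}\mathrm E\big[\|\nabla\hat{\mathbf F}(\theta_k)\|^2\big]=\mathcal O\Big(\frac1{\sqrt K}+\frac1{K^s}\Big),$$ i.e. there is a constant $C>0$ independent of $K$ such that the left-hand side is at most $C(K^{-1/2}+K^{-s})$.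
   Context: **Game.** There are $N$ players. Player $i\in[N]:=\{1,\dots,N\}$ chooses $x_i\in X_i\subseteq\mathbb R^{d_i}$; $d=\sum_i d_i$, $X=X_1\times\cdots\times X_N\subseteq\mathbb R^d$, $x=(x_i)_{i\in[N]}$, $x_{-i}=(x_j)_{j\ne i}$. Given a regulator decision $\theta\in\mathbb R^n$, player $i$ has real-valued cost $f_i(x_i,x_{-i},\theta)=f_i(x,\theta)$. A point $x(\theta)\in X$ is a Nash equilibrium (NE) for $\theta$ if $f_i(x_i(\theta),x_{-i}(\theta),\theta)\le f_i(x_i,x_{-i}(\theta),\theta)$ for all $x_i\in X_i$, $i\in[N]$. The pseudo-gradient is $G(x,\theta)=(\nabla_{x_i}f_i(x_i,x_{-i},\theta))_{i\in[N]}\in\mathbb R^d$. The regulator's feasible set is $\Theta\subseteq\mathbb R^n$. Norms are Euclidean (spectral for matrices). **Assumption 1.** (i) Each $X_i$ is nonempty, compact, convex. (ii) $\Theta$ is nonempty, closed, convex. (iii) For each $i$, $f_i(x_i,x_{-i},\theta)$ is continuously differentiable and convex in $x_i$ for any $x_{-i}\in\mathbb R^{d-d_i}$, $\theta\in\mathbb R^n$. (iv) There is $L_\theta>0$ with $|f_i(x,\theta)-f_i(x,\theta')|\le L_\theta\|\theta-\theta'\|$ for all $i$, $x\in X$, $\theta,\theta'\in\mathbb R^n$. Moreover there is a constant $L_x>0$ with $|f_i(x,\theta)-f_i(x',\theta)|\le L_x\|x-x'\|$ for all $i$, $x,x'\in X$, $\theta\in\mathbb R^n$. **Assumption 2.**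 (i) There are $\mu,l>0$ such that for all $\theta\in\mathbb R^n$, $x,x'\in\mathbb R^d$: $(G(x,\theta)-G(x',\theta))^\top(x-x')\ge\mu\|x-x'\|^2$ and $\|G(x,\theta)-G(x',\theta)\|\le l\|x-x'\|$. (ii) There is $l_\theta>0$ with $\|G(x,\theta)-G(x,\theta')\|\le l_\theta\|\theta-\theta'\|$ for all $x\in X$, $\theta,\theta'\in\mathbb R^n$. Under these assumptions the NE $x(\theta)$ exists and is unique for every $\theta\in\mathbb R^n$. **Assumption 3.** The players communicate over a directed graph on $[N]$ with adjacency matrix $\mathcal A=[a_{ij}]\in\mathbb R^{N\times N}$, where $a_{ij}>0$ if $(j,i)$ is an edge or $i=j$, and $a_{ij}=0$ otherwise. The graph is strongly connected and $\mathcal A$ is doubly stochastic. $\bar\sigma\in(0,1)$ is a number bounding from above the second largest singular value of $\mathcal A$. **Objectives.** $F_i(\theta):=f_i(x(\theta),\theta)$, $F:=\sum_{i=1}^NF_i$. $L_F>0$ is a constant with $|F_i(\theta)-F_i(\theta')|\le L_F\|\theta-\theta'\|$ for all $i\in[N]$, $\theta,\theta'\in\mathbb R^n$. For a fixed smoothing parameter $\xi>0$: $\hat F(\theta):=\sum_{i=1}^N\mathrm E_\nu[F_i(\theta+\xi\nu)]$ with $\nu$ uniform on the closed unit ball of $\mathbb R^n$; $\hat\chi_\Theta(\theta):=\frac1{2\xi}\mathrm{dist}^2(\theta,\Theta)$; $\hat{\mathbf F}:=\hat F+\hat\chi_\Theta$, whose minimum $\hat{\mathbf F}^*$ over $\mathbb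 R^n$ is assumed to exist. $\Pi_C$ denotes Euclidean projection onto $C$. **Algorithm.** Start from a deterministic $\theta_0\in\Theta$ (not depending on $K$). For $k=0,1,\dots,K-1$: draw $u_k$ uniformly from the unit sphere of $\mathbb R^n$, independently of the past; for each $\tilde\theta_k\in\{\theta_k+\xi u_k,\theta_k\}$ obtain an approximate NE $x_{\varepsilon_k}(\tilde\theta_k)\in X$ from the inner routine below; set $$\hat\nabla_{\varepsilon_k}F(\theta_k)=\sum_{i=1}^N\frac n\xi\big(f_i(x_{\varepsilon_k}(\theta_k+\xi u_k),\theta_k+\xi u_k)-f_i(x_{\varepsilon_k}(\theta_k),\theta_k)\big)u_k,$$ $$\theta_{k+1}=\theta_k-\alpha\Big(\hat\nabla_{\varepsilon_k}F(\theta_k)+\frac1\xi(\theta_k-\Pi_\Theta(\theta_k))\Big).$$ *Inner routine* (stepsize $\gamma>0$, $t_k$ iterations). Each player $i$ holds $\mathbf x_{i,t}=(\mathbf x_{i,t}^j)_{j\in[N]}\in\mathbb R^d$, where $\mathbf x_{i,t}^i=x_{i,t}$ is its own strategy and $\mathbf x_{i,t}^j$ its estimate of player $j$'s strategy; the initialization, with $x_{i,0}\in X_i$ and $\mathbf x_{i,0}^{-i}\in\mathbb R^{d-d_i}$, is fixed, the same for all calls. For $t=0,\dots,t_k-1$: $\hat{\mathbf x}_{i,t}=\sum_ja_{ij}\mathbf x_{j,t}$, $x_{i,t+1}=\Pi_{X_i}[\hat{\mathbf x}_{i,t}^i-\gamma\nabla_{x_i}f_i(\hat{\mathbf x}_{i,t},\tilde\theta_k)]$,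 $\mathbf x_{i,t+1}^{-i}=\hat{\mathbf x}_{i,t}^{-i}$. Output $x_{\varepsilon_k}(\tilde\theta_k)=(x_{i,t_k})_{i\in[N]}$. **The constants $\gamma$ and $q$.** Let $l'$, $\mu\le l'\le l$, be a Lipschitz constant in $\mathbf x\in\mathbb R^{Nd}$ (uniformly in $\theta$) of the extended pseudo-gradient $\mathbf G(\mathbf x,\theta):=(\nabla_{x_i}f_i(\mathbf x_i,\theta))_{i\in[N]}$, where $\mathbf x=(\mathbf x_i)_{i\in[N]}$, $\mathbf x_i\in\mathbb R^d$. The stepsize satisfies $0<\gamma<\min\{1,\frac{\bar\sigma}{3l},\frac{2\mu}{l^2},\frac{2\mu(1-\bar\sigma^2)}{a}\}$ with $a:=\bar\sigma^2(2ll'+l'^2+4\mu l'+2l^2)+2(l^2l'^2+\mu l'^2+2l^2l'^2)\bar\sigma^2+2l^2l'^2\bar\sigma^2$, and $q:=\|Q_\gamma\|\in(0,1)$, where $$Q_\gamma=\begin{bmatrix}1-\frac{2\gamma\mu}N+\frac{\gamma^2l^2}N&\frac{\gamma(l+l')+\gamma^2ll'}{\sqrt N}\bar\sigma\\ \frac{\gamma(l+l')+\gamma^2ll'}{\sqrt N}\bar\sigma&(1+2\gamma l+\gamma^2l^2)\bar\sigma^2\end{bmatrix}.$$ *)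

theory Defs
  imports "HOL-Probability.Probability"
begin

text \<open>
  The players are the elements of a finite type \<open>'p\<close> and the coordinates of the joint strategy space
  form a finite type \<open>'d\<close>.  The map \<open>own :: 'd \<Rightarrow> 'p\<close> assigns to every coordinate the player who
  controls it, so that the strategy space of player \<open>i\<close> has dimension \<open>card {c. own c = i}\<close> (which
  may differ from player to player).  It is identified with the coordinate subspace of the \<open>v\<close> with
  \<open>block own i v = v\<close>; this identification is linear and isometric.
\<close>

definition block :: "('d \<Rightarrow> 'p) \<Rightarrow> 'p \<Rightarrow> real^'d \<Rightarrow> real^'d" where
  "block own i x = (\<chi> c. if own c = i then x $ c else 0)"

text \<open>\<open>upd_block own i v x\<close> is the profile \<open>(v\<^sub>i, x\<^sub>-\<^sub>i)\<close>; only block \<open>i\<close> of \<open>v\<close> matters.\<close>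

definition upd_block :: "('d \<Rightarrow> 'p) \<Rightarrow> 'p \<Rightarrow> real^'d \<Rightarrow> real^'d \<Rightarrow> real^'d" where
  "upd_block own i v x = (\<chi> c. if own c = i then v $ c else x $ c)"

definition profiles :: "('d \<Rightarrow> 'p) \<Rightarrow> ('p \<Rightarrow> (real^'d) set) \<Rightarrow> (real^'d) set" where
  "profiles own X = {x. \<forall>i. block own i x \<in> X i}"

definition gradient :: "('a::real_inner \<Rightarrow> real) \<Rightarrow> 'a \<Rightarrow> 'a" where
  "gradient g x = (THE D. GDERIV g x :> D)"

text \<open>
  Gradient of the cost of player \<open>i\<close> with respect to the player's own strategy.  The function
  differentiated depends on block \<open>i\<close> of its argument only, so the components of the gradient
  outside block \<open>i\<close> vanish.
\<close>

definition pgrad ::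
  "('d::finite \<Rightarrow> 'p) \<Rightarrow> ('p \<Rightarrow> real^'d \<Rightarrow> 'r \<Rightarrow> real) \<Rightarrow> 'p \<Rightarrow> real^'d \<Rightarrow> 'r \<Rightarrow> real^'d" where
  "pgrad own f i x \<theta> = gradient (\<lambda>v. f i (upd_block own i v x) \<theta>) x"

definition pseudo_gradient ::
  "('d::finite \<Rightarrow> 'p) \<Rightarrow> ('p \<Rightarrow> real^'d \<Rightarrow> 'r \<Rightarrow> real) \<Rightarrow> real^'d \<Rightarrow> 'r \<Rightarrow> real^'d" where
  "pseudo_gradient own f x \<theta> = (\<chi> c. pgrad own f (own c) x \<theta> $ c)"

definition ext_pseudo_gradient ::
  "('d::finite \<Rightarrow> 'p::finite) \<Rightarrow> ('p \<Rightarrow> real^'d \<Rightarrow> 'r \<Rightarrow> real) \<Rightarrow> real^'d^'p \<Rightarrow> 'r \<Rightarrow> real^'d" where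
  "ext_pseudo_gradient own f \<xx> \<theta> = (\<chi> c. pgrad own f (own c) (\<xx> $ own c) \<theta> $ c)"

definition is_nash ::
  "('d::finite \<Rightarrow> 'p) \<Rightarrow> ('p \<Rightarrow> (real^'d) set) \<Rightarrow> ('p \<Rightarrow> real^'d \<Rightarrow> 'r \<Rightarrow> real) \<Rightarrow> 'r \<Rightarrow> real^'d \<Rightarrow> bool" where
  "is_nash own X f \<theta> x \<longleftrightarrow>
     x \<in> profiles own X \<and> (\<forall>i. \<forall>v\<in>X i. f i x \<theta> \<le> f i (upd_block own i v x) \<theta>)"

definition nash ::
  "('d::finite \<Rightarrow> 'p) \<Rightarrow> ('p \<Rightarrow> (real^'d) set) \<Rightarrow> ('p \<Rightarrow> real^'d \<Rightarrow> 'r \<Rightarrow> real) \<Rightarrow> 'r \<Rightarrow> real^'d" where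
  "nash own X f \<theta> = (THE x. is_nash own X f \<theta> x)"

definition regular_game ::
  "('d::finite \<Rightarrow> 'p) \<Rightarrow> ('p \<Rightarrow> (real^'d) set) \<Rightarrow> ('p \<Rightarrow> real^'d \<Rightarrow> real^'n \<Rightarrow> real)
    \<Rightarrow> (real^'n) set \<Rightarrow> bool" where
  "regular_game own X f \<Theta> \<longleftrightarrow>
     (\<forall>i. X i \<subseteq> {v. block own i v = v} \<and> X i \<noteq> {} \<and> compact (X i) \<and> convex (X i)) \<and>
     \<Theta> \<noteq> {} \<and> closed \<Theta> \<and> convex \<Theta> \<and>
     (\<forall>i x \<theta>.
        (\<forall>v. (\<lambda>v. f i (upd_block own i v x) \<theta>) differentiable (at v)) \<and>
        continuous_on UNIV (gradient (\<lambda>v. f i (upd_block own i v x) \<theta>)) \<and>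
        convex_on UNIV (\<lambda>v. f i (upd_block own i v x) \<theta>)) \<and>
     (\<exists>L\<^sub>\<theta>>0. \<forall>i. \<forall>x\<in>profiles own X. \<forall>\<theta> \<theta>'. \<bar>f i x \<theta> - f i x \<theta>'\<bar> \<le> L\<^sub>\<theta> * norm (\<theta> - \<theta>')) \<and>
     (\<exists>L\<^sub>x>0. \<forall>i. \<forall>x\<in>profiles own X. \<forall>x'\<in>profiles own X. \<forall>\<theta>.
        \<bar>f i x \<theta> - f i x' \<theta>\<bar> \<le> L\<^sub>x * norm (x - x'))"

definition monotone_game ::
  "('d::finite \<Rightarrow> 'p) \<Rightarrow> ('p \<Rightarrow> (real^'d) set) \<Rightarrow> ('p \<Rightarrow> real^'d \<Rightarrow> real^'n \<Rightarrow> real)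
    \<Rightarrow> real \<Rightarrow> real \<Rightarrow> bool" where
  "monotone_game own X f \<mu> l \<longleftrightarrow>
     0 < \<mu> \<and> 0 < l \<and>
     (\<forall>\<theta> x x'. (pseudo_gradient own f x \<theta> - pseudo_gradient own f x' \<theta>) \<bullet> (x - x')
                \<ge> \<mu> * (norm (x - x'))\<^sup>2) \<and>
     (\<forall>\<theta> x x'. norm (pseudo_gradient own f x \<theta> - pseudo_gradient own f x' \<theta>) \<le> l * norm (x - x')) \<and>
     (\<exists>l\<^sub>\<theta>>0. \<forall>x\<in>profiles own X. \<forall>\<theta> \<theta>'.
        norm (pseudo_gradient own f x \<theta> - pseudo_gradient own f x \<theta>') \<le> l\<^sub>\<theta> * norm (\<theta> - \<theta>'))"

definition sv_space :: "real^'p^'p \<Rightarrow> real \<Rightarrow> (real^'p) set" where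
  "sv_space A \<sigma> = {v. (transpose A ** A) *v v = \<sigma>\<^sup>2 *\<^sub>R v}"

text \<open>
  Square roots of the eigenvalues of \<open>A\<^sup>T A\<close>, with multiplicity.  Since \<open>A\<^sup>T A\<close> is symmetric, the
  multiplicity of an eigenvalue is the dimension of its eigenspace.
\<close>

definition singular_values :: "real^'p^'p \<Rightarrow> real multiset" where
  "singular_values A =
     (\<Sum>\<sigma> \<in> {\<sigma>. 0 \<le> \<sigma> \<and> sv_space A \<sigma> \<noteq> {0}}. replicate_mset (dim (sv_space A \<sigma>)) \<sigma>)"

text \<open>Meaningful only for matrices with at least two rows.\<close>

definition second_singular_value :: "real^'p^'p \<Rightarrow> real" where
  "second_singular_value A = rev (sorted_list_of_multiset (singular_values A)) ! 1"

text \<open>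
  \<open>\<sigma>'\<close> is the upper bound on the second largest singular value; it is unconstrained from below for a
  single player.
\<close>

definition comm_graph :: "('p \<times> 'p) set \<Rightarrow> real^'p^'p \<Rightarrow> real \<Rightarrow> bool" where
  "comm_graph E A \<sigma>' \<longleftrightarrow>
     (\<forall>i j. if (j, i) \<in> E \<or> i = j then A $ i $ j > 0 else A $ i $ j = 0) \<and>
     (\<forall>i j. (i, j) \<in> E\<^sup>*) \<and>
     (\<forall>i. (\<Sum>j\<in>UNIV. A $ i $ j) = 1) \<and> (\<forall>j. (\<Sum>i\<in>UNIV. A $ i $ j) = 1) \<and>
     0 < \<sigma>' \<and> \<sigma>' < 1 \<and>
     (CARD('p) \<ge> 2 \<longrightarrow> second_singular_value A \<le> \<sigma>')"

definition reg_cost ::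
  "('d::finite \<Rightarrow> 'p) \<Rightarrow> ('p \<Rightarrow> (real^'d) set) \<Rightarrow> ('p \<Rightarrow> real^'d \<Rightarrow> 'r \<Rightarrow> real) \<Rightarrow> 'p \<Rightarrow> 'r \<Rightarrow> real" where
  "reg_cost own X f i \<theta> = f i (nash own X f \<theta>) \<theta>"

definition smooth_objective ::
  "('d::finite \<Rightarrow> 'p::finite) \<Rightarrow> ('p \<Rightarrow> (real^'d) set) \<Rightarrow> ('p \<Rightarrow> real^'d \<Rightarrow> real^'n \<Rightarrow> real)
    \<Rightarrow> (real^'n) set \<Rightarrow> real \<Rightarrow> real^'n \<Rightarrow> real" where
  "smooth_objective own X f \<Theta> \<xi> \<theta> =
     (\<Sum>i\<in>UNIV. \<integral>\<nu>. reg_cost own X f i (\<theta> + \<xi> *\<^sub>R \<nu>) \<partial>uniform_measure lborel (cball 0 1))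
     + (infdist \<theta> \<Theta>)\<^sup>2 / (2 * \<xi>)"

primrec inner_state ::
  "('d::finite \<Rightarrow> 'p::finite) \<Rightarrow> ('p \<Rightarrow> (real^'d) set) \<Rightarrow> ('p \<Rightarrow> real^'d \<Rightarrow> 'r \<Rightarrow> real) \<Rightarrow> real^'p^'p
    \<Rightarrow> real \<Rightarrow> real^'d^'p \<Rightarrow> 'r \<Rightarrow> nat \<Rightarrow> real^'d^'p" where
  "inner_state own X f A \<gamma> \<xx>\<^sub>0 \<theta> 0 = \<xx>\<^sub>0"
| "inner_state own X f A \<gamma> \<xx>\<^sub>0 \<theta> (Suc t) =
     (\<chi> i. let y = (\<Sum>j\<in>UNIV. A $ i $ j *\<^sub>R inner_state own X f A \<gamma> \<xx>\<^sub>0 \<theta> t $ j)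
           in upd_block own i
                (closest_point (X i) (block own i y - \<gamma> *\<^sub>R pgrad own f i y \<theta>)) y)"

definition approx_nash ::
  "('d::finite \<Rightarrow> 'p::finite) \<Rightarrow> ('p \<Rightarrow> (real^'d) set) \<Rightarrow> ('p \<Rightarrow> real^'d \<Rightarrow> 'r \<Rightarrow> real) \<Rightarrow> real^'p^'p
    \<Rightarrow> real \<Rightarrow> real^'d^'p \<Rightarrow> nat \<Rightarrow> 'r \<Rightarrow> real^'d" where
  "approx_nash own X f A \<gamma> \<xx>\<^sub>0 t \<theta> = (\<chi> c. inner_state own X f A \<gamma> \<xx>\<^sub>0 \<theta> t $ own c $ c)"

definition zo_gradient ::
  "('d::finite \<Rightarrow> 'p::finite) \<Rightarrow> ('p \<Rightarrow> (real^'d) set) \<Rightarrow> ('p \<Rightarrow> real^'d \<Rightarrow> real^'n \<Rightarrow> real) \<Rightarrow> real^'p^'p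
    \<Rightarrow> real \<Rightarrow> real^'d^'p \<Rightarrow> real \<Rightarrow> nat \<Rightarrow> real^'n \<Rightarrow> real^'n \<Rightarrow> real^'n" where
  "zo_gradient own X f A \<gamma> \<xx>\<^sub>0 \<xi> t \<theta> u =
     (\<Sum>i\<in>UNIV. (real CARD('n) / \<xi> *
        (f i (approx_nash own X f A \<gamma> \<xx>\<^sub>0 t (\<theta> + \<xi> *\<^sub>R u)) (\<theta> + \<xi> *\<^sub>R u)
         - f i (approx_nash own X f A \<gamma> \<xx>\<^sub>0 t \<theta>) \<theta>)) *\<^sub>R u)"

text \<open>
  Normalised surface measure of the unit sphere: the measure of a set of directions is the
  proportion of the unit ball taken up by the cone over that set.
\<close>

definition uniform_sphere :: "'a::euclidean_space measure" where
  "uniform_sphere = distr (uniform_measure lborel (cball 0 1)) borel sgn"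

definition past_events ::
  "'w measure \<Rightarrow> (nat \<Rightarrow> 'w \<Rightarrow> 'a::topological_space) \<Rightarrow> (nat \<Rightarrow> 'w \<Rightarrow> 'a) \<Rightarrow> nat \<Rightarrow> 'w set set" where
  "past_events M u \<theta> k = sigma_sets (space M)
     ({\<theta> j -` B \<inter> space M | j B. j \<le> k \<and> B \<in> sets borel} \<union>
      {u j -` B \<inter> space M | j B. j < k \<and> B \<in> sets borel})"

text \<open>
  A run of \<open>K\<close> outer iterations.  That the iterates are random vectors is stated explicitly, because
  the routine evaluates the costs also at estimates outside the feasible set, where no regularity
  in \<open>\<theta>\<close> is assumed.
\<close>

definition zo_run ::
  "('d::finite \<Rightarrow> 'p::finite) \<Rightarrow> ('p \<Rightarrow> (real^'d) set) \<Rightarrow> ('p \<Rightarrow> real^'d \<Rightarrow> real^'n \<Rightarrow> real)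
    \<Rightarrow> (real^'n) set \<Rightarrow> real^'p^'p \<Rightarrow> real \<Rightarrow> real^'d^'p \<Rightarrow> real \<Rightarrow> real^'n
    \<Rightarrow> real \<Rightarrow> nat \<Rightarrow> (nat \<Rightarrow> nat) \<Rightarrow> 'w measure
    \<Rightarrow> (nat \<Rightarrow> 'w \<Rightarrow> real^'n) \<Rightarrow> (nat \<Rightarrow> 'w \<Rightarrow> real^'n) \<Rightarrow> bool" where
  "zo_run own X f \<Theta> A \<gamma> \<xx>\<^sub>0 \<xi> \<theta>\<^sub>0 \<alpha> K t M u \<theta> \<longleftrightarrow>
     prob_space M \<and>
     (\<forall>k\<le>K. \<theta> k \<in> borel_measurable M) \<and>
     (\<forall>k<K. u k \<in> borel_measurable M \<and> distr M borel (u k) = uniform_sphere \<and>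
        prob_space.indep_set M {u k -` B \<inter> space M | B. B \<in> sets borel} (past_events M u \<theta> k)) \<and>
     (\<forall>\<omega>\<in>space M. \<theta> 0 \<omega> = \<theta>\<^sub>0) \<and>
     (\<forall>k<K. \<forall>\<omega>\<in>space M. \<theta> (Suc k) \<omega> =
        \<theta> k \<omega> - \<alpha> *\<^sub>R (zo_gradient own X f A \<gamma> \<xx>\<^sub>0 \<xi> (t k) (\<theta> k \<omega>) (u k \<omega>)
                       + (1 / \<xi>) *\<^sub>R (\<theta> k \<omega> - closest_point \<Theta> (\<theta> k \<omega>))))"

definition step_const :: "real \<Rightarrow> real \<Rightarrow> real \<Rightarrow> real \<Rightarrow> real" where
  "step_const \<mu> l l' \<sigma>' =
     \<sigma>'\<^sup>2 * (2 * l * l' + l'\<^sup>2 + 4 * \<mu> * l' + 2 * l\<^sup>2)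
     + 2 * (l\<^sup>2 * l'\<^sup>2 + \<mu> * l'\<^sup>2 + 2 * l\<^sup>2 * l'\<^sup>2) * \<sigma>'\<^sup>2
     + 2 * l\<^sup>2 * l'\<^sup>2 * \<sigma>'\<^sup>2"

text \<open>
  \<open>N\<close> is the number of players.  One inner iteration multiplies the squared distance to the
  equilibrium by at most the spectral norm of this matrix.
\<close>

definition Q_matrix :: "real \<Rightarrow> real \<Rightarrow> real \<Rightarrow> real \<Rightarrow> real \<Rightarrow> real \<Rightarrow> real^2^2" where
  "Q_matrix N \<mu> l l' \<sigma>' \<gamma> =
     (let b = (\<gamma> * (l + l') + \<gamma>\<^sup>2 * l * l') / sqrt N * \<sigma>' in
      vector [vector [1 - 2 * \<gamma> * \<mu> / N + \<gamma>\<^sup>2 * l\<^sup>2 / N, b],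
              vector [b, (1 + 2 * \<gamma> * l + \<gamma>\<^sup>2 * l\<^sup>2) * \<sigma>'\<^sup>2]])"

end

theory Submission
  imports Defs
begin

text \<open>
  Proof idea.  \<^emph>\<open>Smoothing:\<close> for a Lipschitz function \<open>F\<close>, the gradient at \<open>\<theta>\<close> of the average of \<open>F\<close> over
  the ball of radius \<open>\<xi>\<close> about \<open>\<theta>\<close> is \<open>n/\<xi>\<close> times the average of \<open>F (\<theta> + \<xi> u) u\<close> over unit vectors \<open>u\<close>, so
  that the two-point estimate with exact equilibria is unbiased and the smoothed objective has a Lipschitz
  gradient with constant \<open>L = (n N L\<^sub>F + 1)/\<xi>\<close>.  \<^emph>\<open>Inner routine:\<close> the equilibrium is a fixed point of
  the blockwise projected gradient step; splitting the stacked estimates into their mean and the deviation from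
  it, one iteration contracts the squared distance to the equilibrium by the factor \<open>q\<close>, so the squared
  error of the estimate at step \<open>k\<close> is \<open>O((k+1) powr -s)\<close>.  \<^emph>\<open>Outer iteration:\<close> the descent lemma with
  \<open>\<alpha> L \<le> 1/4\<close>, where the noise is uncorrelated with the iterate by independence, telescopes to
  \<open>\<alpha>/4\<close> times the sum of the expected squared gradients, bounded by a constant plus
  \<open>O(\<alpha> K powr (1-s) + K \<alpha>\<^sup>2)\<close>; division by \<open>\<alpha> K\<close> gives the two rates.
\<close>

section \<open>Polar decomposition of the uniform distribution on a ball\<close>

text \<open>The costs at equilibrium are only Lipschitz in \<open>\<theta>\<close>, so the
  derivative of their ball average is found by moving the ball rather than by differentiating the
  integrand. Sphere averages enter through the law of the direction of a uniform point of the ball.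
  The constant \<open>L\<close> has two sources: \<open>n N L\<^sub>F / \<xi>\<close> from the
  sphere formula and \<open>1 / \<xi>\<close> from the residual of the projection onto
  \<open>\<Theta>\<close>, which is nonexpansive. The step size condition is \<alpha> L \<le> 1/4.
  Inexact equilibria produce an error that is not centred; it is bounded pointwise and enters at
  first order in \<alpha>, whereas the centred noise contributes only at second order. Costs are
  Lipschitz on feasible profiles only, so the outputs of the inner routine are shown to be feasible
  before an equilibrium error is turned into a cost error. Expectations exist because each iterate
  is almost surely bounded.\<close>

lemma cball_uniform_prob:
  "0 < r \<Longrightarrow> prob_space (uniform_measure lborel (cball (0::'a::euclidean_space) r))"
  by (intro prob_space_uniform_measure)
    (auto simp: emeasure_cball unit_ball_vol_pos less_imp_neq[symmetric] ennreal_eq_0_iff not_le)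

lemma sgn_measurable [measurable]: "(sgn :: 'a::euclidean_space \<Rightarrow> 'a) \<in> borel_measurable borel"
  unfolding sgn_div_norm[abs_def] by measurable

lemma sets_uniform_sphere [simp, measurable_cong]: "sets uniform_sphere = sets borel"
  by (simp add: uniform_sphere_def)

lemma space_uniform_sphere [simp]: "space uniform_sphere = UNIV"
  by (simp add: uniform_sphere_def)

lemma prob_space_uniform_sphere: "prob_space (uniform_sphere :: 'a::euclidean_space measure)"
  unfolding uniform_sphere_def
  by (intro prob_space.prob_space_distr cball_uniform_prob) simp_all

lemma AE_uniform_cball_nonzero:
  "0 < r \<Longrightarrow> AE y in uniform_measure lborel (cball (0::'a::euclidean_space) r). y \<noteq> 0 \<and> norm y \<le> r"
  by (rule AE_uniform_measureI) (use AE_lborel_singleton[of "0::'a"] in \<open>auto elim!: eventually_mono\<close>)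

lemma AE_uniform_cballI:
  assumes "0 < r" "\<And>y::'a::euclidean_space. y \<noteq> 0 \<Longrightarrow> norm y \<le> r \<Longrightarrow> P y"
  shows "AE y in uniform_measure lborel (cball 0 r). P y"
  using AE_uniform_cball_nonzero[OF assms(1)] by eventually_elim (use assms(2) in blast)

lemma AE_uniform_sphere: "AE u in (uniform_sphere :: 'a::euclidean_space measure). norm u = 1"
  unfolding uniform_sphere_def
  by (subst AE_distr_iff)
     (use AE_uniform_cball_nonzero[of 1] in \<open>auto elim!: eventually_mono simp: norm_sgn\<close>)

lemma AE_uniform_sphereI:
  "(\<And>u::'a::euclidean_space. norm u = 1 \<Longrightarrow> P u) \<Longrightarrow> AE u in uniform_sphere. P u"
  using AE_uniform_sphere by eventually_elim blast

text \<open>\<open>sgn\<close> is invariant under positive scaling, so multiplication by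
  \<open>r\<close> carries the unit cone over \<open>S\<close> onto the cone of radius
  \<open>r\<close>, and it multiplies Lebesgue measure by \<open>r ^ DIM('a)\<close>.\<close>

lemma emeasure_cone:
  fixes S :: "'a::euclidean_space set"
  assumes [measurable]: "S \<in> sets borel" and r: "0 < r"
  shows "emeasure lborel {y. norm y \<le> r \<and> sgn y \<in> S}
       = ennreal (r ^ DIM('a)) * emeasure lborel {y. norm y \<le> 1 \<and> sgn y \<in> S}"
proof -
  have eq: "{y. norm y \<le> r \<and> sgn y \<in> S} = (\<lambda>x. r *\<^sub>R x + 0) ` {y. norm y \<le> 1 \<and> sgn y \<in> S}"
  proof (intro set_eqI iffI)
    fix y assume "y \<in> {y. norm y \<le> r \<and> sgn y \<in> S}"
    then have "y = r *\<^sub>R (y /\<^sub>R r)" "norm (y /\<^sub>R r) \<le> 1" "sgn (y /\<^sub>R r) \<in> S"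
      using r by (auto simp: field_simps sgn_scaleR)
    then show "y \<in> (\<lambda>x. r *\<^sub>R x + 0) ` {y. norm y \<le> 1 \<and> sgn y \<in> S}"
      by (intro image_eqI[of _ _ "y /\<^sub>R r"]) auto
  qed (use r in \<open>auto simp: sgn_scaleR mult_left_le\<close>)
  have m: "{y. norm y \<le> a \<and> sgn y \<in> S} \<in> sets borel" for a by measurable
  show ?thesis
    using emeasure_lebesgue_affine[of r 0 "{y. norm y \<le> 1 \<and> sgn y \<in> S}"] m r
    unfolding eq[symmetric] by simp
qed

text \<open>Scaling makes the probability a product of a factor in \<open>r\<close> and a factor in
  \<open>S\<close>; this factorisation is the source of the independence of norm and
  direction.\<close>

lemma measure_uniform_cball_cone:
  fixes S :: "'a::euclidean_space set"
  assumes [measurable]: "S \<in> sets borel" and r: "0 \<le> r" "r \<le> R" "0 < R"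
  shows "measure (uniform_measure lborel (cball 0 R)) {y. norm y \<le> r \<and> sgn y \<in> S}
       = (r / R) ^ DIM('a) * measure uniform_sphere S"
proof (cases "r = 0")
  \<comment> \<open>The scaling argument needs a positive radius. Here the cone is contained in the
    origin, a null set, and the power of 0 vanishes because the dimension is positive.\<close>
  case True
  have "measure (uniform_measure lborel (cball 0 R)) {y. norm y \<le> r \<and> sgn y \<in> S} = 0"
proof -
    have "measure (uniform_measure lborel (cball 0 R)) {y. norm y \<le> r \<and> sgn y \<in> S}
      = measure (uniform_measure lborel (cball (0::'a) R)) {}"
      by (intro measure_eq_AE AE_uniform_cballI) (use r True in auto)
    then show ?thesis by simp
  qed
  then show ?thesis using True by simp
next
  case False
  define V where "V = unit_ball_vol (real DIM('a))"
  have V: "V > 0" by (simp add: V_def unit_ball_vol_pos)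
  let ?C = "\<lambda>r. {y. norm y \<le> r \<and> sgn y \<in> S}"
  have C [measurable]: "?C a \<in> sets borel" for a by measurable
  have fin: "emeasure lborel (?C a) < \<infinity>" for a
    by (rule le_less_trans[OF emeasure_mono emeasure_lborel_cball_finite[of 0 a]]) auto
  have meas: "measure (uniform_measure lborel (cball 0 b)) (?C a) = measure lborel (?C a) / (V * b ^ DIM('a))"
    if "a \<le> b" "0 < b" for a b
  proof -
    have "cball 0 b \<inter> ?C a = ?C a" using that by auto
    moreover have "emeasure lborel (?C a) = ennreal (measure lborel (?C a))"
      using fin[of a] by (intro emeasure_eq_ennreal_measure) (auto simp: less_top)
    ultimately have "emeasure (uniform_measure lborel (cball 0 b)) (?C a)
      = ennreal (measure lborel (?C a) / (V * b ^ DIM('a)))"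
      using that V by (simp add: emeasure_cball V_def[symmetric] divide_ennreal)
    then show ?thesis
      using that V by (simp add: measure_def)
  qed
  have sph: "measure uniform_sphere S = measure lborel (?C 1) / V"
  proof -
    have "measure (uniform_sphere :: 'a measure) S
      = measure (uniform_measure lborel (cball 0 1)) (sgn -` S)"
      unfolding uniform_sphere_def by (subst measure_distr) auto
    also have "\<dots> = measure (uniform_measure lborel (cball 0 1)) (?C 1)"
      by (intro measure_eq_AE AE_uniform_cballI) (auto intro: measurable_sets_borel[OF sgn_measurable])
    finally show ?thesis using meas[of 1 1] by simp
  qed
  have "measure lborel (?C r) = r ^ DIM('a) * measure lborel (?C 1)"
    using emeasure_cone[of S r] False r by (simp add: measure_def enn2real_mult)
  then show ?thesis
    using meas[of r R] sph r V by (simp add: power_divide)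
qed

text \<open>Rectangles determine the joint law. Independence is taken for families of preimages, the
  shape in which it is available for the sampled directions.\<close>

lemma distr_pair_indep:
  assumes "prob_space M" and [measurable]: "X \<in> measurable M S" "Y \<in> measurable M T"
    and indep: "prob_space.indep_set M {X -` A \<inter> space M |A. A \<in> sets S} {Y -` B \<inter> space M |B. B \<in> sets T}"
  shows "distr M (S \<Otimes>\<^sub>M T) (\<lambda>\<omega>. (X \<omega>, Y \<omega>)) = distr M S X \<Otimes>\<^sub>M distr M T Y"
proof -
  interpret prob_space M by fact
  interpret X: prob_space "distr M S X" by (rule prob_space_distr) simp
  interpret Y: prob_space "distr M T Y" by (rule prob_space_distr) simp
  show ?thesis
  proof (rule pair_measure_eqI[symmetric])
    fix A B assume "A \<in> sets (distr M S X)" "B \<in> sets (distr M T Y)"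
    then have [measurable]: "A \<in> sets S" "B \<in> sets T" by auto
    have "prob ((X -` A \<inter> space M) \<inter> (Y -` B \<inter> space M))
        = prob (X -` A \<inter> space M) * prob (Y -` B \<inter> space M)"
      by (rule indep_setD[OF indep]) (use \<open>A \<in> sets S\<close> \<open>B \<in> sets T\<close> in auto)
    moreover have "(\<lambda>\<omega>. (X \<omega>, Y \<omega>)) -` (A \<times> B) \<inter> space M = (X -` A \<inter> space M) \<inter> (Y -` B \<inter> space M)"
      by auto
    ultimately show "emeasure (distr M S X) A * emeasure (distr M T Y) B
        = emeasure (distr M (S \<Otimes>\<^sub>M T) (\<lambda>\<omega>. (X \<omega>, Y \<omega>))) (A \<times> B)"
      by (simp add: emeasure_distr emeasure_eq_measure ennreal_mult)
  qed (auto intro: X.sigma_finite_measure_axioms Y.sigma_finite_measure_axioms cong: sets_pair_measure_cong)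
qed

text \<open>Half-lines are stable under intersection and generate the Borel sets of the line, so
  independence has to be checked only on their preimages under the norm, where it is the cone
  formula.\<close>

lemma distr_norm_sgn:
  assumes R: "0 < R"
  shows "distr (uniform_measure lborel (cball (0::'a::euclidean_space) R)) (borel \<Otimes>\<^sub>M borel) (\<lambda>y. (norm y, sgn y))
    = distr (uniform_measure lborel (cball (0::'a) R)) borel norm \<Otimes>\<^sub>M distr (uniform_measure lborel (cball (0::'a) R)) borel sgn"
    (is "distr ?P _ _ = _")
proof -
  interpret prob_space ?P using R by (rule cball_uniform_prob)
  interpret S: prob_space "uniform_sphere :: 'a measure" by (rule prob_space_uniform_sphere)
  have nv: "{norm -` A \<inter> space ?P |A. A \<in> sets borel} = sigma_sets (space ?P) {norm -` A \<inter> space ?P |A. A \<in> range atMost}"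
    by (subst borel_eq_atMost, simp, rule sigma_sets_vimage_commute[of norm UNIV UNIV, simplified])
  let ?G = "{norm -` A \<inter> space ?P |A. A \<in> range (atMost :: real \<Rightarrow> _)}"
  let ?H = "{sgn -` A \<inter> space ?P |A. A \<in> sets borel}"
  have H: "sgn -` A \<in> sets borel" if "A \<in> sets borel" for A :: "'a set"
    using that by (rule measurable_sets_borel[OF sgn_measurable])
  have G: "(norm :: 'a \<Rightarrow> real) -` A \<in> sets borel" if "A \<in> sets borel" for A :: "real set"
    using measurable_sets[of "norm :: 'a \<Rightarrow> real" borel borel A] that by simp
  have "indep_set (sigma_sets (space ?P) ?G) (sigma_sets (space ?P) ?H)"
  proof (rule indep_set_sigma_sets)
    show "Int_stable ?G"
    proof (rule Int_stableI)
      fix a b assume "a \<in> ?G" "b \<in> ?G"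
      then obtain x y where "a = norm -` {..x}" "b = norm -` {..y}" by auto
      then have "a \<inter> b = norm -` {..min x y} \<inter> space ?P" by auto
      then show "a \<inter> b \<in> ?G" by blast
    qed
    show "Int_stable ?H"
    proof (rule Int_stableI)
      fix a b assume "a \<in> ?H" "b \<in> ?H"
      then obtain x y where "x \<in> sets borel" "y \<in> sets borel" "a = sgn -` x" "b = sgn -` y" by auto
      then have "a \<inter> b = sgn -` (x \<inter> y) \<inter> space ?P" "x \<inter> y \<in> sets borel" by auto
      then show "a \<inter> b \<in> ?H" by blast
    qed
    show "indep_set ?G ?H"
    proof (rule indep_setI)
      show "?G \<subseteq> events" using G by auto
      show "?H \<subseteq> events" using H by auto
      fix a b assume "a \<in> ?G" "b \<in> ?H"
      then obtain x S where a: "a = norm -` {..x}" and b: "b = sgn -` S" and S: "S \<in> sets borel" by auto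
      show "prob (a \<inter> b) = prob a * prob b"
      proof (cases "x < 0")
        case True
        then have "a = {}" using a by (auto dest: order_trans[OF norm_ge_zero])
        then show ?thesis by simp
      next
        case False
        \<comment> \<open>The cone formula covers radii up to \<open>R\<close>; beyond
          \<open>R\<close> the condition on the norm holds almost surely.\<close>
        define r where "r = min x R"
        have r: "0 \<le> r" "r \<le> R" using False R by (auto simp: r_def)
        have ev: "{y. norm y \<le> r \<and> sgn y \<in> T} \<in> events" if [measurable]: "T \<in> sets borel" for T :: "'a set"
          by simp
        have "prob (a \<inter> b) = prob {y. norm y \<le> r \<and> sgn y \<in> S}"
          using R H[OF S] G[of "{..x}"] ev[OF S]
          by (intro measure_eq_AE AE_uniform_cballI) (auto simp: a b r_def)
        moreover have "prob a = prob {y. norm y \<le> r \<and> sgn y \<in> (UNIV::'a set)}"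
          using R G[of "{..x}"]
          by (intro measure_eq_AE AE_uniform_cballI) (auto simp: a r_def)
        moreover have "prob b = prob {y. norm y \<le> R \<and> sgn y \<in> S}"
          using R H[OF S]  S
          by (intro measure_eq_AE AE_uniform_cballI) (auto simp: b)
        ultimately show ?thesis
          using measure_uniform_cball_cone[OF S r R] measure_uniform_cball_cone[OF S _ _ R, of R] R
            measure_uniform_cball_cone[OF _ r R, of "UNIV :: 'a set"] S.prob_space
          by simp
      qed
    qed
  qed
  moreover have "sigma_sets (space ?P) ?H = ?H"
    using sigma_sets_vimage_commute[of "sgn :: 'a \<Rightarrow> 'a" UNIV UNIV "sets borel"] sets.sigma_sets_eq[of "borel :: 'a measure"] by simp
  ultimately have "indep_set {norm -` A \<inter> space ?P |A. A \<in> sets borel} ?H"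
    unfolding nv by simp
  then show ?thesis
    by (intro distr_pair_indep prob_space_axioms) simp_all
qed


text \<open>The sphere measure is defined through the unit ball, but a ball of radius 2 is needed
  later; the cone formula at full radius shows that the law of the direction is the same for every
  radius.\<close>

lemma distr_sgn_uniform_cball:
  assumes R: "0 < R"
  shows "distr (uniform_measure lborel (cball (0::'a::euclidean_space) R)) borel sgn = uniform_sphere"
proof (rule measure_eqI)
  let ?P = "uniform_measure lborel (cball (0::'a) R)"
  interpret prob_space ?P by (rule cball_uniform_prob[OF R])
  interpret S: prob_space "uniform_sphere :: 'a measure" by (rule prob_space_uniform_sphere)
  fix A assume "A \<in> sets (distr ?P borel sgn)"
  then have [measurable]: "A \<in> sets borel" by simp
  have "prob (sgn -` A) = prob {y. norm y \<le> R \<and> sgn y \<in> A}"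
    using R measurable_sets[OF sgn_measurable \<open>A \<in> sets borel\<close>]
    by (intro measure_eq_AE AE_uniform_cballI) auto
  also have "\<dots> = S.prob A"
    using measure_uniform_cball_cone[of A R R] R by simp
  finally show "emeasure (distr ?P borel sgn) A = emeasure uniform_sphere A"
    by (simp add: emeasure_distr emeasure_eq_measure S.emeasure_eq_measure)
qed simp

text \<open>Integration in polar coordinates: for a fixed direction \<open>u\<close> the event
  \<open>norm y \<le> R u\<close> has probability \<open>(R u / b) ^ DIM('a)\<close>, and
  independence allows this to be integrated over \<open>u\<close>. A threshold depending on the
  direction is what describes a shifted ball.\<close>

lemma integral_radial_threshold:
  fixes g R :: "'a::euclidean_space \<Rightarrow> real"
  assumes [measurable]: "g \<in> borel_measurable borel" "R \<in> borel_measurable borel"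
    and g: "\<And>u. \<bar>g u\<bar> \<le> B" and R: "\<And>u. 0 \<le> R u" "\<And>u. R u \<le> b" and b: "0 < b"
  shows "(\<integral>y. g (sgn y) * indicat_real {y. norm y \<le> R (sgn y)} y \<partial>uniform_measure lborel (cball 0 b))
       = (\<integral>u. g u * (R u / b) ^ DIM('a) \<partial>uniform_sphere)"
proof -
  let ?P = "uniform_measure lborel (cball (0::'a) b)"
  interpret prob_space ?P by (rule cball_uniform_prob[OF b])
  interpret N: prob_space "distr ?P borel norm" by (rule prob_space_distr) simp
  interpret S: prob_space "uniform_sphere :: 'a measure" by (rule prob_space_uniform_sphere)
  interpret NS: pair_prob_space "distr ?P borel norm" "uniform_sphere :: 'a measure" ..
  let ?f = "\<lambda>(r, u). g u * indicat_real {..R u} r"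
  have m [measurable]: "?f \<in> borel_measurable (borel \<Otimes>\<^sub>M borel)"
    unfolding indicator_def atMost_iff by measurable
  have m': "?f \<in> borel_measurable (distr ?P borel norm \<Otimes>\<^sub>M uniform_sphere)"
    using m by (simp cong: measurable_cong_sets sets_pair_measure_cong)
  have "(\<integral>y. g (sgn y) * indicat_real {y. norm y \<le> R (sgn y)} y \<partial>?P)
     = (\<integral>y. ?f (norm y, sgn y) \<partial>?P)" by (simp add: indicator_def)
  also have "\<dots> = (\<integral>z. ?f z \<partial>distr ?P (borel \<Otimes>\<^sub>M borel) (\<lambda>y. (norm y, sgn y)))"
    by (subst integral_distr) auto
  also have "\<dots> = (\<integral>z. ?f z \<partial>(distr ?P borel norm \<Otimes>\<^sub>M uniform_sphere))"
    using b by (simp add: distr_norm_sgn distr_sgn_uniform_cball)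
  also have "\<dots> = (\<integral>u. \<integral>r. ?f (r, u) \<partial>distr ?P borel norm \<partial>uniform_sphere)"
  proof (subst NS.integral_snd[symmetric])
    show "integrable (distr ?P borel norm \<Otimes>\<^sub>M uniform_sphere) ?f"
      using g order_trans[OF abs_ge_zero g]
      by (intro NS.integrable_const_bound[where B = B] m') (auto simp: indicator_def)
  qed simp
  also have "\<dots> = (\<integral>u. g u * (R u / b) ^ DIM('a) \<partial>uniform_sphere)"
  proof (intro Bochner_Integration.integral_cong refl)
    fix u
    have "measure (distr ?P borel norm) {..R u} = prob {y. norm y \<le> R u}"
      by (subst measure_distr) (auto intro!: arg_cong[where f = prob])
    also have "\<dots> = (R u / b) ^ DIM('a)"
      using measure_uniform_cball_cone[of "UNIV :: 'a set" "R u" b] R[of u] b S.prob_space by simp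
    finally show "(\<integral>r. ?f (r, u) \<partial>distr ?P borel norm) = g u * (R u / b) ^ DIM('a)"
      by simp
  qed
  finally show ?thesis .
qed

section \<open>The gradient of a ball average\<close>

lemma gradient_eqI: "GDERIV g x :> D \<Longrightarrow> gradient g x = D"
  unfolding gradient_def
proof (rule the_equality)
  fix D' assume "GDERIV g x :> D" "GDERIV g x :> D'"
  then have "(\<lambda>h. h \<bullet> D) = (\<lambda>h. h \<bullet> D')"
    unfolding gderiv_def by (rule has_derivative_unique)
  then show "D' = D" by (metis inner_commute vector_eq_rdot)
qed

text \<open>Both the ball average and the squared distance to a convex set are differentiated by
  means of an explicit quadratic remainder, hence this criterion.\<close>

lemma GDERIV_quadraticI:
  assumes "0 < \<delta>" and b: "\<And>h. norm h \<le> \<delta> \<Longrightarrow> \<bar>g (x + h) - g x - h \<bullet> D\<bar> \<le> C * (norm h)\<^sup>2"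
  shows "GDERIV g x :> D"
  unfolding gderiv_def has_derivative_at
proof (rule conjI[OF bounded_linear_inner_left], rule tendsto_sandwich)
  show "\<forall>\<^sub>F h in at 0. 0 \<le> norm (g (x + h) - g x - h \<bullet> D) / norm h" by simp
  show "\<forall>\<^sub>F h in at 0. norm (g (x + h) - g x - h \<bullet> D) / norm h \<le> C * norm h"
    unfolding eventually_at
  proof (intro exI[of _ \<delta>] conjI ballI impI \<open>0 < \<delta>\<close>)
    fix h :: 'a assume "h \<noteq> 0 \<and> dist h 0 < \<delta>"
    then have "\<bar>g (x + h) - g x - h \<bullet> D\<bar> \<le> C * norm h * norm h" "0 < norm h"
      using b[of h] by (auto simp: power2_eq_square mult.assoc)
    then show "norm (g (x + h) - g x - h \<bullet> D) / norm h \<le> C * norm h"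
      by (simp add: pos_divide_le_eq)
  qed
  have "((\<lambda>h::'a. C * norm h) \<longlongrightarrow> C * norm (0::'a)) (at 0)" by (intro tendsto_intros)
  then show "((\<lambda>h::'a. C * norm h) \<longlongrightarrow> 0) (at 0)" by simp
qed simp

text \<open>Passing from \<open>n\<close> to \<open>Suc n\<close> multiplies the remainder by
  \<open>1 + z\<close>, at most a factor 2, and adds \<open>n z^2\<close>; with
  \<open>n \<le> 3 ^ n\<close> the total is \<open>2 * 3 ^ n + 3 ^ n\<close>.\<close>

lemma abs_power_first_order:
  fixes z :: real assumes "\<bar>z\<bar> \<le> 1"
  shows "\<bar>(1 + z) ^ n - 1 - real n * z\<bar> \<le> 3 ^ n * z\<^sup>2"
proof (induction n)
  case (Suc n)
  have n: "real n \<le> 3 ^ n" using of_nat_less_two_power[of n] power_mono[of "2::real" 3 n] by (smt (verit))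
  have "(1 + z) ^ Suc n - 1 - real (Suc n) * z = (1 + z) * ((1 + z) ^ n - 1 - real n * z) + real n * z\<^sup>2"
    by (simp add: algebra_simps power2_eq_square)
  also have "\<bar>\<dots>\<bar> \<le> 2 * (3 ^ n * z\<^sup>2) + 3 ^ n * z\<^sup>2"
  proof (rule order_trans[OF abs_triangle_ineq add_mono])
    show "\<bar>(1 + z) * ((1 + z) ^ n - 1 - real n * z)\<bar> \<le> 2 * (3 ^ n * z\<^sup>2)"
      unfolding abs_mult using assms Suc by (intro mult_mono) auto
    show "\<bar>real n * z\<^sup>2\<bar> \<le> 3 ^ n * z\<^sup>2" using n by (auto simp: abs_mult intro!: mult_right_mono)
  qed
  finally show ?case by (simp add: mult_ac)
qed simp

lemma integral_uniform_cball:
  fixes k :: "'a::euclidean_space \<Rightarrow> real"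
  assumes [measurable]: "k \<in> borel_measurable borel" and b: "0 < b"
  shows "(\<integral>x. k x \<partial>uniform_measure lborel (cball 0 b))
    = (\<integral>x. indicat_real (cball 0 b) x * k x \<partial>lborel) / (unit_ball_vol (real DIM('a)) * b ^ DIM('a))"
proof -
  define V where "V = unit_ball_vol (real DIM('a)) * b ^ DIM('a)"
  have V: "V > 0" using b by (simp add: V_def)
  have [measurable]: "cball (0::'a) b \<in> sets borel" by simp
  have "uniform_measure lborel (cball (0::'a) b) = density lborel (\<lambda>x. ennreal (indicator (cball 0 b) x / V))"
    unfolding uniform_measure_def using b V
    by (intro density_cong)
      (auto simp: emeasure_cball V_def[symmetric] indicator_def inverse_ennreal divide_ennreal_def inverse_eq_divide)
  also have "(\<integral>x. k x \<partial>\<dots>) = (\<integral>x. (indicator (cball 0 b) x / V) *\<^sub>R k x \<partial>lborel)"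
    using V by (intro integral_density) auto
  finally show ?thesis by (simp add: V_def[symmetric] )
qed

text \<open>For \<open>norm h \<le> 1\<close> the unit ball about \<open>h\<close> lies in the ball
  of radius 2 about 0. Averages over moving balls thus become integrals against one fixed
  probability measure, with the volume ratio \<open>2 ^ DIM('a)\<close> in front.\<close>

lemma integral_uniform_cball_translate:
  fixes k :: "'a::euclidean_space \<Rightarrow> real"
  assumes [measurable]: "k \<in> borel_measurable borel" and h: "norm h \<le> 1"
  shows "(\<integral>\<nu>. k (h + \<nu>) \<partial>uniform_measure lborel (cball 0 1))
    = 2 ^ DIM('a) * (\<integral>y. k y * indicat_real (cball h 1) y \<partial>uniform_measure lborel (cball 0 2))"
proof -
  have [measurable]: "cball h 1 \<in> sets borel" by simp
  have "(\<integral>x. indicat_real (cball 0 1) x * k (h + x) \<partial>lborel)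
      = (\<integral>x. (\<lambda>y. indicat_real (cball h 1) y * k y) (h + x) \<partial>lborel)"
    by (intro Bochner_Integration.integral_cong) (auto simp: indicator_def dist_norm norm_minus_commute)
  also have "\<dots> = (\<integral>y. indicat_real (cball h 1) y * k y \<partial>distr lborel borel ((+) h))"
    by (subst integral_distr) auto
  also have "\<dots> = (\<integral>y. indicat_real (cball 0 2) y * (k y * indicat_real (cball h 1) y) \<partial>lborel)"
  proof (unfold lborel_distr_plus, intro Bochner_Integration.integral_cong refl)
    fix y
    have "dist 0 y \<le> 2" if "dist h y \<le> 1"
      using dist_triangle[of 0 y h] h that by simp
    then show "indicat_real (cball h 1) y * k y = indicat_real (cball 0 2) y * (k y * indicat_real (cball h 1) y)"
      by (auto simp: indicator_def)
  qed
  finally show ?thesis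
    by (simp add: integral_uniform_cball)
qed

text \<open>On the ray \<open>y = r u\<close> the condition is the quadratic inequality
  \<open>(r - h \<bullet> u)^2 \<le> 1 - |h|^2 + (h \<bullet> u)^2\<close>. Since
  \<open>norm h \<le> 1\<close>, its smaller root is not positive, so for \<open>r \<ge> 0\<close>
  only the larger root matters.\<close>

lemma mem_cball_radial:
  fixes y h :: "'a::euclidean_space"
  assumes h: "norm h \<le> 1" and y: "y \<noteq> 0"
  shows "dist h y \<le> 1 \<longleftrightarrow> norm y \<le> h \<bullet> sgn y + sqrt (1 - (norm h)\<^sup>2 + (h \<bullet> sgn y)\<^sup>2)"
proof -
  define u r where "u = sgn y" and "r = norm y"
  have yu: "y = r *\<^sub>R u" and u: "u \<bullet> u = 1" and r: "r \<ge> 0"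
    using y by (auto simp: u_def r_def sgn_div_norm dot_square_norm norm_eq_1)
  define D where "D = 1 - (norm h)\<^sup>2 + (h \<bullet> u)\<^sup>2"
  have D: "(h \<bullet> u)\<^sup>2 \<le> D" using h by (simp add: D_def power_le_one)
  have "(dist h y)\<^sup>2 \<le> 1 \<longleftrightarrow> (r - h \<bullet> u)\<^sup>2 \<le> D"
    unfolding dist_norm power2_norm_eq_inner yu D_def
    by (simp add: algebra_simps u power2_eq_square inner_commute dot_square_norm[symmetric])
  also have "\<dots> \<longleftrightarrow> \<bar>r - h \<bullet> u\<bar> \<le> sqrt D"
    by (metis real_sqrt_abs real_sqrt_le_iff)
  also have "\<dots> \<longleftrightarrow> r \<le> h \<bullet> u + sqrt D"
    using real_le_rsqrt[OF D] r by linarith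
  finally show ?thesis
    unfolding D_def u_def r_def by (simp add: abs_square_le_1)
qed

text \<open>The quantity \<open>a = |h|^2 - (h \<bullet> u)^2\<close> is the squared length of the
  part of \<open>h\<close> orthogonal to \<open>u\<close>. The square root differs from 1 by at most
  \<open>a\<close>, because \<open>1 - a \<le> sqrt (1 - a) \<le> 1\<close> for
  \<open>0 \<le> a \<le> 1\<close>.\<close>

lemma radial_first_order:
  fixes u h :: "'a::euclidean_space"
  assumes u: "norm u = 1" and h: "norm h \<le> 1"
  shows "\<bar>h \<bullet> u + sqrt (1 - (norm h)\<^sup>2 + (h \<bullet> u)\<^sup>2) - (1 + h \<bullet> u)\<bar> \<le> (norm h)\<^sup>2"
proof -
  define a where "a = (norm h)\<^sup>2 - (h \<bullet> u)\<^sup>2"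
  have "(h \<bullet> u)\<^sup>2 \<le> (norm h)\<^sup>2"
    using Cauchy_Schwarz_ineq2[of h u] u by (simp add: abs_le_square_iff[symmetric])
  moreover have "(norm h)\<^sup>2 \<le> 1" using h by (simp add: power_le_one)
  ultimately have a: "0 \<le> a" "a \<le> (norm h)\<^sup>2" "a \<le> 1" unfolding a_def using zero_le_power2[of "h \<bullet> u"] by linarith+
  have "1 - a \<le> sqrt (1 - a)"
    using a by (intro real_le_rsqrt) (auto simp: power2_eq_square intro!: mult_left_le_one_le)
  moreover have "sqrt (1 - a) \<le> 1" using a by simp
  moreover have "1 - (norm h)\<^sup>2 + (h \<bullet> u)\<^sup>2 = 1 - a" by (simp add: a_def)
  ultimately have "\<bar>sqrt (1 - (norm h)\<^sup>2 + (h \<bullet> u)\<^sup>2) - 1\<bar> \<le> a" by (simp only:)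
  then show ?thesis using a by linarith
qed

lemma lipschitz_measurable:
  fixes F :: "'a::euclidean_space \<Rightarrow> real"
  assumes "\<And>x y. \<bar>F x - F y\<bar> \<le> L * norm (x - y)"
  shows "F \<in> borel_measurable borel"
proof -
  have "\<bar>F x - F y\<bar> \<le> \<bar>L\<bar> * norm (x - y)" for x y
    by (rule order_trans[OF assms mult_right_mono]) auto
  then have "continuous_on UNIV F"
    by (intro lipschitz_on_continuous_on[of "\<bar>L\<bar>"] lipschitz_onI) (auto simp: dist_norm)
  then show "F \<in> borel_measurable borel" by (rule borel_measurable_continuous_onI)
qed

text \<open>
  The ball about \<open>h\<close> and the ball about \<open>0\<close> differ only within a shell of width \<open>O(\<bar>h\<bar>)\<close> around the unit
  sphere.  Replacing \<open>F y\<close> by \<open>F (sgn y)\<close> there costs \<open>O(\<bar>h\<bar>\<^sup>2)\<close>, and for a function of \<open>sgn y\<close> the integral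
  over \<open>{y. norm y \<le> \<rho> (sgn y)}\<close> is explicit, because norm and direction are independent.
\<close>

lemma ball_smoothing_first_order:
  fixes F :: "'a::euclidean_space \<Rightarrow> real"
  assumes F: "\<And>x y. \<bar>F x - F y\<bar> \<le> L * norm (x - y)"
  obtains C where "\<And>h. norm h \<le> 1/2 \<Longrightarrow>
    \<bar>(\<integral>\<nu>. F (h + \<nu>) \<partial>uniform_measure lborel (cball 0 1)) - (\<integral>\<nu>. F \<nu> \<partial>uniform_measure lborel (cball 0 1))
      - real DIM('a) * (\<integral>u. F u * (h \<bullet> u) \<partial>uniform_sphere)\<bar> \<le> C * (norm h)\<^sup>2"
proof
  fix h :: 'a assume h: "norm h \<le> 1/2"
  define n where "n = DIM('a)"
  define P where "P = uniform_measure lborel (cball (0::'a) 2)"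
  define J where "J k y = indicat_real (cball k 1) y" for k y :: 'a
  \<comment> \<open>The clamping gives the bounds 0 and 2 for arbitrary arguments. For unit
    \<open>u\<close> it has no effect: as \<open>norm h \<le> 1/2\<close>, the unclamped value
    differs from 1 by at most \<open>1/2 + 1/4\<close>.\<close>
  define \<rho> where "\<rho> u = max 0 (min 2 (h \<bullet> u + sqrt (1 - (norm h)\<^sup>2 + (h \<bullet> u)\<^sup>2)))" for u
  define B where "B = \<bar>F 0\<bar> + L"
  \<comment> \<open>Comparing \<open>F\<close> at the origin and at a unit vector shows that the
    Lipschitz constant is nonnegative.\<close>
  have "\<bar>F (SOME b. b \<in> Basis) - F 0\<bar> \<le> L" using F[of "SOME b. b \<in> Basis" 0] by (simp add: SOME_Basis)
  then have L: "0 \<le> L" by linarith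
  then have B: "0 \<le> B" by (simp add: B_def)
  have [measurable]: "F \<in> borel_measurable borel" by (rule lipschitz_measurable[OF F])
  have [measurable]: "J k \<in> borel_measurable borel" for k unfolding J_def[abs_def] by (intro borel_measurable_indicator) simp
  have [measurable]: "\<rho> \<in> borel_measurable borel" unfolding \<rho>_def[abs_def] by measurable
  have setsP [simp, measurable_cong]: "sets P = sets borel" by (simp add: P_def)
  interpret P: prob_space P unfolding P_def by (rule cball_uniform_prob) simp
  interpret S: prob_space "uniform_sphere :: 'a measure" by (rule prob_space_uniform_sphere)
  have sF: "\<bar>F (sgn u)\<bar> \<le> B" for u
  proof -
    have "\<bar>F (sgn u) - F 0\<bar> \<le> L" using F[of "sgn u" 0] L by (cases "u = 0") (simp_all add: norm_sgn)
    then show ?thesis by (simp add: B_def)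
  qed
  have Jrad: "J h y = indicat_real {y. norm y \<le> \<rho> (sgn y)} y" if y: "y \<noteq> 0" "norm y \<le> 2" for y
  proof -
    have "dist h y \<le> 1 \<longleftrightarrow> norm y \<le> \<rho> (sgn y)"
      using mem_cball_radial[of h y] h y by (simp add: \<rho>_def le_max_iff_disj)
    then show ?thesis by (simp add: J_def indicator_def)
  qed
  have \<rho>_eq: "\<bar>\<rho> u - (1 + h \<bullet> u)\<bar> \<le> (norm h)\<^sup>2" if "norm u = 1" for u
  proof -
    have "\<bar>h \<bullet> u\<bar> \<le> 1/2" using Cauchy_Schwarz_ineq2[of h u] that h by simp
    moreover have "(norm h)\<^sup>2 \<le> (1/2)\<^sup>2" using h by (intro power_mono) auto
    ultimately show ?thesis
      using radial_first_order[OF that, of h] h by (auto simp: \<rho>_def power2_eq_square)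
  qed
  have intP: "integrable P k" if [measurable]: "k \<in> borel_measurable borel" and "\<And>y. norm y \<le> 2 \<Longrightarrow> \<bar>k y\<bar> \<le> bd" for k :: "'a \<Rightarrow> real" and bd :: real
  proof (rule P.integrable_const_bound[where B = bd])
    show "AE y in P. norm (k y) \<le> bd"
      unfolding P_def by (rule AE_uniform_cballI) (use that(2) in auto)
  qed simp
  have intS: "integrable uniform_sphere k" if [measurable]: "k \<in> borel_measurable borel" and "\<And>y. norm y = 1 \<Longrightarrow> \<bar>k y\<bar> \<le> bd" for k :: "'a \<Rightarrow> real" and bd :: real
    using that AE_uniform_sphere by (intro S.integrable_const_bound[where B = bd]) (auto elim!: eventually_mono)
  have ss: "sgn (sgn y) = sgn y" for y :: 'a by (cases "y = 0") (simp_all add: sgn_div_norm)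
  have F2: "\<bar>F y\<bar> \<le> \<bar>F 0\<bar> + L * 2" if "norm y \<le> 2" for y
    using F[of y 0] mult_left_mono[OF that L] by simp
  have J1: "0 \<le> J k y" "J k y \<le> 1" for k y by (auto simp: J_def indicator_def)
  let ?U = "uniform_measure lborel (cball (0::'a) 1)"
  have trans: "(\<integral>\<nu>. F (k + \<nu>) \<partial>?U) = 2 ^ n * (\<integral>y. F y * J k y \<partial>P)" if "norm k \<le> 1" for k
    unfolding n_def P_def J_def using that by (intro integral_uniform_cball_translate) auto
  have bJ: "\<bar>c * J k y\<bar> \<le> \<bar>c\<bar>" for c k y using J1[of k y] by (auto simp: abs_mult intro!: mult_left_le)
  have i1: "integrable P (\<lambda>y. F y * J k y)" for k
    by (rule intP[of _ "\<bar>F 0\<bar> + L * 2"]) (auto intro: order_trans[OF bJ F2])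
  have i2: "integrable P (\<lambda>y. F (sgn y) * J k y)" for k
    by (rule intP[of _ B]) (auto intro: order_trans[OF bJ sF])
  have main: "2 ^ n * (\<integral>y. F (sgn y) * J h y \<partial>P) = (\<integral>u. F u * \<rho> u ^ n \<partial>uniform_sphere)"
    "2 ^ n * (\<integral>y. F (sgn y) * J 0 y \<partial>P) = (\<integral>u. F u \<partial>uniform_sphere)"
  proof -
    \<comment> \<open>The doubled \<open>sgn\<close> presents the integrand as a function
      \<open>F (sgn u)\<close> evaluated at \<open>u = sgn y\<close>. This function is bounded for
      all arguments, as the radial formula requires; on unit vectors it agrees with
      \<open>F\<close>.\<close>
    have "(\<integral>y. F (sgn y) * J h y \<partial>P)
       = (\<integral>y. F (sgn (sgn y)) * indicat_real {y. norm y \<le> \<rho> (sgn y)} y \<partial>P)"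
      unfolding P_def by (intro integral_cong_AE AE_uniform_cballI) (auto simp: Jrad ss)
    also have "\<dots> = (\<integral>u. F (sgn u) * (\<rho> u / 2) ^ n \<partial>uniform_sphere)"
      unfolding P_def n_def by (rule integral_radial_threshold[where B = B and g = "\<lambda>u. F (sgn u)"]) (auto simp: sF \<rho>_def)
    also have "\<dots> = (\<integral>u. F u * \<rho> u ^ n / 2 ^ n \<partial>uniform_sphere)"
      using AE_uniform_sphere by (intro integral_cong_AE) (auto elim!: eventually_mono simp: power_divide sgn_div_norm)
    finally show "2 ^ n * (\<integral>y. F (sgn y) * J h y \<partial>P) = (\<integral>u. F u * \<rho> u ^ n \<partial>uniform_sphere)" by simp
    have "(\<integral>y. F (sgn y) * J 0 y \<partial>P)
       = (\<integral>y. F (sgn (sgn y)) * indicat_real {y. norm y \<le> 1} y \<partial>P)"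
      by (intro Bochner_Integration.integral_cong) (auto simp: J_def indicator_def ss)
    also have "\<dots> = (\<integral>u. F (sgn u) * (1 / 2) ^ n \<partial>uniform_sphere)"
      unfolding P_def n_def by (rule integral_radial_threshold[where B = B and g = "\<lambda>u. F (sgn u)" and R = "\<lambda>u. 1"]) (auto simp: sF)
    also have "\<dots> = (\<integral>u. F u / 2 ^ n \<partial>uniform_sphere)"
      using AE_uniform_sphere by (intro integral_cong_AE) (auto elim!: eventually_mono simp: power_divide sgn_div_norm)
    finally show "2 ^ n * (\<integral>y. F (sgn y) * J 0 y \<partial>P) = (\<integral>u. F u \<partial>uniform_sphere)" by simp
  qed
  \<comment> \<open>\<open>e1\<close> is the price of replacing \<open>F y\<close> by
    \<open>F (sgn y)\<close> where the two balls differ, \<open>e2\<close> the price of linearising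
    \<open>\<rho> u ^ n\<close>.\<close>
  define e1 where "e1 = (\<integral>y. (F y - F (sgn y)) * (J h y - J 0 y) \<partial>P)"
  define e2 where "e2 = (\<integral>u. F u * (\<rho> u ^ n - 1 - n * (h \<bullet> u)) \<partial>uniform_sphere)"
  have small: "2 * norm h \<le> 1" using h by simp
  have hS: "\<bar>h \<bullet> u\<bar> \<le> norm h" if "norm u = 1" for u
    using Cauchy_Schwarz_ineq2[of h u] that by simp
  have FS: "\<bar>F u\<bar> \<le> B" if "norm u = 1" for u using sF[of u] that by (simp add: sgn_div_norm)
  \<comment> \<open>With \<open>z = \<rho> u - 1\<close> one has
    \<open>\<bar>z\<bar> \<le> 2 * norm h \<le> 1\<close>. The remainder of the power contributes
    \<open>4 * 3 ^ n\<close>; the quadratic error in \<open>z \<approx> h \<bullet> u\<close>,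
    multiplied by \<open>n\<close>, contributes \<open>n\<close>.\<close>
  have \<rho>n: "\<bar>\<rho> u ^ n - 1 - n * (h \<bullet> u)\<bar> \<le> (4 * 3 ^ n + n) * (norm h)\<^sup>2" if u: "norm u = 1" for u
  proof -
    define z where "z = \<rho> u - 1"
    have hh: "(norm h)\<^sup>2 \<le> norm h" using h by (auto simp: power2_eq_square intro!: mult_left_le_one_le)
    have z: "\<bar>z - h \<bullet> u\<bar> \<le> (norm h)\<^sup>2" using \<rho>_eq[OF u] by (simp add: z_def)
    then have z2: "\<bar>z\<bar> \<le> 2 * norm h" using hS[OF u] hh by linarith
    then have "z\<^sup>2 \<le> (2 * norm h)\<^sup>2" using abs_le_square_iff[of z "2 * norm h"] by simp
    then have a: "3 ^ n * z\<^sup>2 \<le> 3 ^ n * (4 * (norm h)\<^sup>2)" by (intro mult_left_mono) (auto simp: power_mult_distrib)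
    have "\<bar>\<rho> u ^ n - 1 - n * z\<bar> \<le> 3 ^ n * z\<^sup>2"
      using abs_power_first_order[of z n] z2 small by (simp add: z_def)
    moreover have "\<bar>n * z - n * (h \<bullet> u)\<bar> \<le> n * (norm h)\<^sup>2"
      using mult_left_mono[OF z, of "real n"] by (simp add: abs_mult right_diff_distrib[symmetric])
    ultimately have "\<bar>\<rho> u ^ n - 1 - n * (h \<bullet> u)\<bar> \<le> 3 ^ n * (4 * (norm h)\<^sup>2) + n * (norm h)\<^sup>2"
      using a by linarith
    then show ?thesis by (simp add: algebra_simps)
  qed
  have \<rho>2: "0 \<le> \<rho> u" "\<rho> u \<le> 2" for u by (auto simp: \<rho>_def)
  have i3: "integrable uniform_sphere (\<lambda>u. F u * \<rho> u ^ n)"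
    by (rule intS[of _ "B * 2 ^ n"]) (auto simp: abs_mult \<rho>2 power_abs[symmetric] intro!: mult_mono power_mono FS B)
  have i4: "integrable uniform_sphere F" by (rule intS[of _ B]) (auto simp: FS)
  have i5: "integrable uniform_sphere (\<lambda>u. F u * (h \<bullet> u))"
    by (rule intS[of _ "B * norm h"]) (auto simp: abs_mult intro!: mult_mono FS B hS)
  have e2eq: "e2 = (\<integral>u. F u * \<rho> u ^ n \<partial>uniform_sphere) - (\<integral>u. F u \<partial>uniform_sphere) - n * (\<integral>u. F u * (h \<bullet> u) \<partial>uniform_sphere)"
  proof -
    have "e2 = (\<integral>u. F u * \<rho> u ^ n - F u - n * (F u * (h \<bullet> u)) \<partial>uniform_sphere)"
      unfolding e2_def by (intro Bochner_Integration.integral_cong) (auto simp: algebra_simps)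
    then show ?thesis using i3 i4 i5 by simp
  qed
  have e1eq: "e1 = (\<integral>y. F y * J h y \<partial>P) - (\<integral>y. F y * J 0 y \<partial>P) - ((\<integral>y. F (sgn y) * J h y \<partial>P) - (\<integral>y. F (sgn y) * J 0 y \<partial>P))"
  proof -
    have "e1 = (\<integral>y. F y * J h y - F y * J 0 y - (F (sgn y) * J h y - F (sgn y) * J 0 y) \<partial>P)"
      unfolding e1_def by (intro Bochner_Integration.integral_cong) (auto simp: algebra_simps)
    then show ?thesis using i1 i2 by simp
  qed
  have "(\<integral>\<nu>. F (h + \<nu>) \<partial>?U) - (\<integral>\<nu>. F \<nu> \<partial>?U) - n * (\<integral>u. F u * (h \<bullet> u) \<partial>uniform_sphere) = 2 ^ n * e1 + e2"
    using trans[of h] trans[of 0] h main by (simp add: e1eq e2eq algebra_simps)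
  moreover have "\<bar>e2\<bar> \<le> B * ((4 * 3 ^ n + n) * (norm h)\<^sup>2)"
  proof -
    have b: "\<bar>F u * (\<rho> u ^ n - 1 - n * (h \<bullet> u))\<bar> \<le> B * ((4 * 3 ^ n + n) * (norm h)\<^sup>2)" if "norm u = 1" for u
      unfolding abs_mult using that by (intro mult_mono FS \<rho>n B) auto
    have i: "integrable uniform_sphere (\<lambda>u. F u * (\<rho> u ^ n - 1 - n * (h \<bullet> u)))"
      by (rule intS[OF _ b]) auto
    have "\<bar>e2\<bar> \<le> (\<integral>u. \<bar>F u * (\<rho> u ^ n - 1 - n * (h \<bullet> u))\<bar> \<partial>uniform_sphere)"
      unfolding e2_def by (rule integral_abs_bound)
    also have "\<dots> \<le> (\<integral>u. B * ((4 * 3 ^ n + n) * (norm h)\<^sup>2) \<partial>(uniform_sphere :: 'a measure))"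
      using i by (intro integral_mono_AE AE_uniform_sphereI b) simp_all
    finally show ?thesis by (simp add: S.prob_space[simplified])
  qed
  moreover have "\<bar>2 ^ n * e1\<bar> \<le> L * (2 * n + 2 * 3 ^ n) * (norm h)\<^sup>2"
  proof -
    let ?I = "\<lambda>a y. indicat_real {y. norm y \<le> a} y"
    have shell: "(\<integral>y. ?I a y \<partial>P) = (a / 2) ^ n" if "0 \<le> a" "a \<le> 2" for a
      using integral_radial_threshold[of "\<lambda>_::'a. 1" "\<lambda>_. a" 1 2] that by (simp add: P_def n_def S.prob_space[simplified])
    \<comment> \<open>Two factors \<open>norm h\<close> arise: points of the shell are within
      \<open>norm h\<close> of the unit sphere, and the probability of the shell is itself of order
      \<open>norm h\<close>.\<close>
    have b: "\<bar>(F y - F (sgn y)) * (J h y - J 0 y)\<bar> \<le> L * norm h * (?I (1 + norm h) y - ?I (1 - norm h) y)"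
      if "y \<noteq> 0" for y
    proof (cases "1 - norm h < norm y \<and> norm y \<le> 1 + norm h")
      case True
      have "\<bar>F y - F (sgn y)\<bar> \<le> L * norm (y - sgn y)" by (rule F)
      also have "y - sgn y = (norm y - 1) *\<^sub>R sgn y"
        using that by (simp add: sgn_div_norm algebra_simps)
      also have "norm \<dots> = \<bar>norm y - 1\<bar>" using that by (simp add: norm_sgn)
      also have "L * \<dots> \<le> L * norm h" using True L by (intro mult_left_mono) auto
      finally have "\<bar>F y - F (sgn y)\<bar> * \<bar>J h y - J 0 y\<bar> \<le> L * norm h * 1"
        using L by (intro mult_mono) (auto simp: J_def indicator_def)
      then show ?thesis using True by (simp add: abs_mult indicator_def)
    next
      case False
      have "dist h y \<le> norm h + norm y" "norm y \<le> norm h + dist h y"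
        using norm_triangle_ineq4[of h y] norm_triangle_sub[of y h] by (auto simp: dist_norm norm_minus_commute)
      then have "J h y = J 0 y" using False by (auto simp: J_def indicator_def)
      moreover have "0 \<le> ?I (1 + norm h) y - ?I (1 - norm h) y" using norm_ge_zero[of h] by (auto simp: indicator_def simp del: norm_ge_zero)
      ultimately show ?thesis using L by simp
    qed
    have iI: "integrable P (?I a)" for a by (rule intP[of _ 1]) (auto simp: indicator_def)
    have ie: "integrable P (\<lambda>y. (F y - F (sgn y)) * (J h y - J 0 y))"
    proof -
      have "integrable P (\<lambda>y. F y * J h y - F y * J 0 y - (F (sgn y) * J h y - F (sgn y) * J 0 y))"
        using i1 i2 by simp
      then show ?thesis by (simp add: algebra_simps)
    qed
    have "\<bar>e1\<bar> \<le> (\<integral>y. \<bar>(F y - F (sgn y)) * (J h y - J 0 y)\<bar> \<partial>P)"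
      unfolding e1_def by (rule integral_abs_bound)
    also have "\<dots> \<le> (\<integral>y. L * norm h * (?I (1 + norm h) y - ?I (1 - norm h) y) \<partial>P)"
    proof (rule integral_mono_AE)
      show "AE y in P. \<bar>(F y - F (sgn y)) * (J h y - J 0 y)\<bar> \<le> L * norm h * (?I (1 + norm h) y - ?I (1 - norm h) y)"
        unfolding P_def by (rule AE_uniform_cballI) (use b in auto)
    qed (use ie iI in auto)
    also have "\<dots> = L * norm h * (((1 + norm h) / 2) ^ n - ((1 - norm h) / 2) ^ n)"
    proof -
      have a: "0 \<le> 1 - norm h" "1 - norm h \<le> 2" "0 \<le> 1 + norm h" "1 + norm h \<le> 2"
        using h norm_ge_zero[of h] by linarith+
      show ?thesis using shell[OF a(1,2)] shell[OF a(3,4)] iI by simp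
    qed
    finally have "2 ^ n * \<bar>e1\<bar> \<le> 2 ^ n * (L * norm h * (((1 + norm h) / 2) ^ n - ((1 - norm h) / 2) ^ n))"
      by (intro mult_left_mono) auto
    also have "\<dots> = L * norm h * ((1 + norm h) ^ n - (1 + (- norm h)) ^ n)"
      by (simp add: power_divide algebra_simps)
    also have "\<dots> \<le> L * norm h * ((2 * n + 2 * 3 ^ n) * norm h)"
    proof (intro mult_left_mono)
      have "3 ^ n * (norm h)\<^sup>2 \<le> 3 ^ n * norm h"
        using h by (intro mult_left_mono) (auto simp: power2_eq_square intro!: mult_left_le_one_le)
      moreover have "(1 + norm h) ^ n \<le> 1 + n * norm h + 3 ^ n * (norm h)\<^sup>2"
        using abs_power_first_order[of "norm h" n] h by (simp only: abs_le_iff abs_norm_cancel) linarith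
      moreover have "1 - n * norm h - 3 ^ n * (norm h)\<^sup>2 \<le> (1 + (- norm h)) ^ n"
        using abs_power_first_order[of "- norm h" n] h
        by (simp only: abs_le_iff abs_norm_cancel abs_minus_cancel power2_minus) linarith
      ultimately have "(1 + norm h) ^ n - (1 + (- norm h)) ^ n \<le> 2 * (n * norm h) + 2 * (3 ^ n * norm h)" by linarith
      then show "(1 + norm h) ^ n - (1 + (- norm h)) ^ n \<le> (2 * n + 2 * 3 ^ n) * norm h"
        by (simp add: algebra_simps)
    qed (use L in auto)
    finally show ?thesis by (simp add: abs_mult power2_eq_square algebra_simps)
  qed
  ultimately show "\<bar>(\<integral>\<nu>. F (h + \<nu>) \<partial>?U) - (\<integral>\<nu>. F \<nu> \<partial>?U) - real DIM('a) * (\<integral>u. F u * (h \<bullet> u) \<partial>uniform_sphere)\<bar>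
    \<le> ((\<bar>F 0\<bar> + L) * (4 * 3 ^ DIM('a) + DIM('a)) + L * (2 * DIM('a) + 2 * 3 ^ DIM('a))) * (norm h)\<^sup>2"
    unfolding n_def B_def by (simp add: algebra_simps)
qed

section \<open>Strongly monotone games\<close>

text \<open>The vector with basis components \<open>D b\<close> represents the derivative
  \<open>D\<close>; its existence is what makes the definite description in \<open>gradient\<close>
  denote.\<close>

lemma differentiable_imp_GDERIV:
  fixes g :: "'a::euclidean_space \<Rightarrow> real"
  assumes "g differentiable (at x)"
  shows "GDERIV g x :> gradient g x"
proof -
  obtain D where D: "(g has_derivative D) (at x)" using assms by (auto simp: differentiable_def)
  have "D = (\<lambda>h. h \<bullet> (\<Sum>b\<in>Basis. D b *\<^sub>R b))"
  proof
    fix h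
    have "D h = D (\<Sum>b\<in>Basis. (h \<bullet> b) *\<^sub>R b)" by (simp add: euclidean_representation)
    also have "\<dots> = h \<bullet> (\<Sum>b\<in>Basis. D b *\<^sub>R b)"
      using has_derivative_linear[OF D]
      by (simp add: linear_sum linear_cmul inner_sum_right mult.commute)
    finally show "D h = h \<bullet> (\<Sum>b\<in>Basis. D b *\<^sub>R b)" .
  qed
  then have "GDERIV g x :> (\<Sum>b\<in>Basis. D b *\<^sub>R b)" using D by (simp add: gderiv_def)
  then show ?thesis using gradient_eqI by metis
qed

lemma GDERIV_line:
  assumes "GDERIV g x :> D"
  shows "((\<lambda>s. g (x + s *\<^sub>R d)) has_real_derivative d \<bullet> D) (at 0)"
proof -
  have "(g has_derivative (\<lambda>h. h \<bullet> D)) (at (x + 0 *\<^sub>R d))" using assms by (simp add: gderiv_def)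
  then have "((\<lambda>s. g (x + s *\<^sub>R d)) has_derivative (\<lambda>s. (s *\<^sub>R d) \<bullet> D)) (at 0)"
    by (rule has_derivative_compose[rotated]) (auto intro!: derivative_eq_intros)
  then show ?thesis by (simp add: has_field_derivative_def mult_commute_abs)
qed

text \<open>A negative directional derivative would make \<open>g\<close> drop strictly just after
  \<open>x\<close>. Only one side is tested, as is appropriate when \<open>x\<close> may lie on the
  boundary of a constraint set.\<close>

lemma GDERIV_inner_nonneg:
  assumes g: "GDERIV g x :> D" and min: "\<And>s. 0 < s \<Longrightarrow> s \<le> 1 \<Longrightarrow> g x \<le> g (x + s *\<^sub>R d)"
  shows "0 \<le> d \<bullet> D"
proof (rule ccontr)
  assume "\<not> 0 \<le> d \<bullet> D"
  then obtain \<delta> where \<delta>: "0 < \<delta>" "\<And>h. 0 < h \<Longrightarrow> h < \<delta> \<Longrightarrow> g (x + h *\<^sub>R d) < g x"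
    using DERIV_neg_dec_right[OF GDERIV_line[OF g, of d]] by auto
  define h where "h = min 1 (\<delta> / 2)"
  have "0 < h" "h \<le> 1" "h < \<delta>" using \<open>0 < \<delta>\<close> by (auto simp: h_def)
  then show False using min[of h] \<delta>(2)[of h] by simp
qed

lemma convex_GDERIV_above_tangent:
  assumes g: "GDERIV g x :> D" and conv: "convex_on UNIV g"
  shows "g x + (y - x) \<bullet> D \<le> g y"
proof -
  have "convex_on UNIV (\<lambda>s::real. g (x + s *\<^sub>R (y - x)))"
  proof (rule convex_onI)
    fix t a b :: real assume t: "0 < t" "t < 1"
    have "x + ((1 - t) *\<^sub>R a + t *\<^sub>R b) *\<^sub>R (y - x) = (1 - t) *\<^sub>R (x + a *\<^sub>R (y - x)) + t *\<^sub>R (x + b *\<^sub>R (y - x))"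
      by (simp add: algebra_simps)
    then show "g (x + ((1 - t) *\<^sub>R a + t *\<^sub>R b) *\<^sub>R (y - x))
      \<le> (1 - t) * g (x + a *\<^sub>R (y - x)) + t * g (x + b *\<^sub>R (y - x))"
      using convex_onD[OF conv, of t] t by simp
  qed simp
  then have "((y - x) \<bullet> D) * (1 - 0) \<le> g (x + 1 *\<^sub>R (y - x)) - g (x + 0 *\<^sub>R (y - x))"
    by (rule convex_on_imp_above_tangent) (use GDERIV_line[OF g] in auto)
  then show ?thesis by simp
qed

lemma closest_point_eqI:
  fixes p :: "'a::euclidean_space"
  assumes "convex S" "closed S" "p \<in> S" and vi: "\<And>z. z \<in> S \<Longrightarrow> (a - p) \<bullet> (z - p) \<le> 0"
  shows "closest_point S a = p"
proof -
  have "dist a p \<le> dist a z" if "z \<in> S" for z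
  proof -
    have "(norm (a - z))\<^sup>2 = (norm (a - p))\<^sup>2 + (norm (z - p))\<^sup>2 - 2 * ((a - p) \<bullet> (z - p))"
      by (simp add: power2_norm_eq_inner inner_diff_left inner_diff_right inner_commute)
    then have "(norm (a - p))\<^sup>2 \<le> (norm (a - z))\<^sup>2" using vi[OF that] by (smt (verit) zero_le_power2)
    then show ?thesis unfolding dist_norm by (rule power2_le_imp_le) simp
  qed
  then show ?thesis using assms closest_point_unique by metis
qed

lemma power2_norm_vec: "(norm x)\<^sup>2 = (\<Sum>i\<in>UNIV. (norm (x $ i))\<^sup>2)"
  by (simp add: norm_vec_def L2_set_def sum_nonneg)

section \<open>Coordinate blocks and profiles assembled from them\<close>

lemma block_nth: "block own i x $ c = (if own c = i then x $ c else 0)"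
  by (simp add: block_def)

lemma upd_block_nth: "upd_block own i v x $ c = (if own c = i then v $ c else x $ c)"
  by (simp add: upd_block_def)

lemma block_block [simp]: "block own i (block own i x) = block own i x"
  by (simp add: vec_eq_iff block_nth)

lemma block_diff: "block own i (x - y) = block own i x - block own i y"
  by (simp add: vec_eq_iff block_nth)

lemma block_scaleR: "block own i (a *\<^sub>R x) = a *\<^sub>R block own i x"
  by (simp add: vec_eq_iff block_nth)

lemma upd_block_cong: "block own i v = block own i v' \<Longrightarrow> upd_block own i v x = upd_block own i v' x"
  by (auto simp: vec_eq_iff block_nth upd_block_nth split: if_splits)

lemma upd_block_self [simp]: "upd_block own i x x = x"
  by (simp add: vec_eq_iff upd_block_nth)

lemma block_upd_block [simp]: "block own i (upd_block own i v x) = block own i v"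
  by (simp add: vec_eq_iff block_nth upd_block_nth)

lemma inner_block: "block own i x \<bullet> y = x \<bullet> block own i y"
  unfolding inner_vec_def by (intro sum.cong) (auto simp: block_nth)

text \<open>Every coordinate is owned by exactly one player, so after exchanging the sums only the
  term of the owner survives.\<close>

lemma sum_block:
  fixes own :: "'d::finite \<Rightarrow> 'p::finite" and x y :: "'p \<Rightarrow> real^'d"
  shows "(\<Sum>i\<in>UNIV. block own i (x i) \<bullet> y i) = (\<Sum>c\<in>UNIV. x (own c) $ c * y (own c) $ c)"
proof -
  have "(\<Sum>i\<in>UNIV. block own i (x i) \<bullet> y i) = (\<Sum>i\<in>UNIV. \<Sum>c\<in>UNIV. if own c = i then x i $ c * y i $ c else 0)"
    unfolding inner_vec_def by (intro sum.cong) (auto simp: block_nth)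
  also have "\<dots> = (\<Sum>c\<in>UNIV. \<Sum>i\<in>UNIV. if own c = i then x i $ c * y i $ c else 0)"
    by (rule sum.swap)
  finally show ?thesis by simp
qed

text \<open>Pseudo-gradients, simultaneous projected steps and the output of the inner routine all
  have this shape, so that one norm formula serves them all.\<close>

definition glue :: "('d::finite \<Rightarrow> 'p) \<Rightarrow> ('p \<Rightarrow> real^'d) \<Rightarrow> real^'d" where
  "glue own p = (\<chi> c. p (own c) $ c)"

lemma glue_nth: "glue own p $ c = p (own c) $ c" by (simp add: glue_def)

lemma block_glue: "block own i (glue own p) = block own i (p i)"
  by (simp add: vec_eq_iff block_nth glue_nth)

lemma norm_glue:
  fixes own :: "'d::finite \<Rightarrow> 'p::finite"
  shows "(norm (glue own p))\<^sup>2 = (\<Sum>i\<in>UNIV. (norm (block own i (p i)))\<^sup>2)"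
proof -
  have "(norm (glue own p))\<^sup>2 = (\<Sum>c\<in>UNIV. p (own c) $ c * p (own c) $ c)"
    unfolding power2_norm_eq_inner inner_vec_def by (simp add: glue_nth)
  also have "\<dots> = (\<Sum>i\<in>UNIV. block own i (p i) \<bullet> block own i (p i))"
    unfolding sum_block[of own p, symmetric] by (simp add: inner_block)
  finally show ?thesis by (simp add: power2_norm_eq_inner)
qed

lemma glue_diff: "glue own p - glue own p' = glue own (\<lambda>i. p i - p' i)"
  by (simp add: vec_eq_iff glue_nth)

lemma glue_const [simp]: "glue own (\<lambda>i. x) = x" by (simp add: vec_eq_iff glue_nth)

lemma glue_block [simp]: "glue own (\<lambda>i. block own i (p i)) = glue own p"
  by (simp add: vec_eq_iff glue_nth block_nth)

lemma norm_glue_le: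
  fixes own :: "'d::finite \<Rightarrow> 'p::finite"
  assumes "\<And>i. norm (block own i (p i)) \<le> norm (block own i (p' i))"
  shows "norm (glue own p) \<le> norm (glue own p')"
proof (rule power2_le_imp_le)
  show "(norm (glue own p))\<^sup>2 \<le> (norm (glue own p'))\<^sup>2"
    unfolding norm_glue using assms by (intro sum_mono power_mono) auto
qed simp

lemma norm_block_le: "norm (block own i x) \<le> norm x"
  by (rule norm_le_componentwise_cart) (simp add: block_nth)

section \<open>Existence, uniqueness and boundedness of equilibria\<close>

locale strongly_monotone_game =
  fixes own :: "'d::finite \<Rightarrow> 'p::finite" and X :: "'p \<Rightarrow> (real^'d) set"
    and f :: "'p \<Rightarrow> real^'d \<Rightarrow> real^'n \<Rightarrow> real" and \<Theta> :: "(real^'n) set" and \<mu> l :: real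
  assumes regular: "regular_game own X f \<Theta>" and monotone: "monotone_game own X f \<mu> l"
begin

lemma X_props: "X i \<noteq> {}" "compact (X i)" "closed (X i)" "convex (X i)"
  using regular compact_imp_closed by (auto simp: regular_game_def)

lemma block_X: "v \<in> X i \<Longrightarrow> block own i v = v"
  using regular by (auto simp: regular_game_def)

lemma pseudo_gradient_props:
  shows "0 < \<mu>" "0 < l"
    "\<mu> * (norm (x - x'))\<^sup>2 \<le> (pseudo_gradient own f x \<theta> - pseudo_gradient own f x' \<theta>) \<bullet> (x - x')"
    "norm (pseudo_gradient own f x \<theta> - pseudo_gradient own f x' \<theta>) \<le> l * norm (x - x')"
  using monotone by (auto simp: monotone_game_def)

lemma GDERIV_pgrad: "GDERIV (\<lambda>v. f i (upd_block own i v x) \<theta>) x :> pgrad own f i x \<theta>"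
  unfolding pgrad_def
  by (rule differentiable_imp_GDERIV) (use regular in \<open>auto simp: regular_game_def\<close>)

text \<open>The differentiated function is constant along the coordinate axes of the other players,
  so these partial derivatives are zero.\<close>

lemma block_pgrad [simp]: "block own i (pgrad own f i x \<theta>) = pgrad own f i x \<theta>"
proof -
  let ?g = "\<lambda>v. f i (upd_block own i v x) \<theta>"
  have "pgrad own f i x \<theta> $ c = 0" if "own c \<noteq> i" for c
  proof -
    have "?g (x + s *\<^sub>R axis c 1) = ?g x" for s
      using that by (intro arg_cong2[where f = "f i"] upd_block_cong) (auto simp: vec_eq_iff block_nth axis_def)
    then have "((\<lambda>s. ?g x) has_real_derivative axis c 1 \<bullet> pgrad own f i x \<theta>) (at (0::real))"
      using GDERIV_line[OF GDERIV_pgrad[of i x \<theta>], of "axis c 1"] by simp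
    then have "axis c 1 \<bullet> pgrad own f i x \<theta> = 0" by (rule DERIV_unique) simp
    then show ?thesis by (simp add: inner_axis')
  qed
  then show ?thesis by (auto simp: vec_eq_iff block_nth)
qed

lemma pseudo_gradient_eq_glue: "pseudo_gradient own f x \<theta> = glue own (\<lambda>i. pgrad own f i x \<theta>)"
  by (simp add: vec_eq_iff pseudo_gradient_def glue_nth)

lemma ext_pseudo_gradient_eq_glue:
  "ext_pseudo_gradient own f \<xx> \<theta> = glue own (\<lambda>i. pgrad own f i (\<xx> $ i) \<theta>)"
  by (simp add: vec_eq_iff ext_pseudo_gradient_def glue_nth)

text \<open>Necessity follows by differentiating along the segment from the own strategy to
  \<open>v\<close>, which stays in the convex set \<open>X i\<close>; sufficiency is the tangent
  inequality for a convex cost.\<close>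

lemma is_nash_iff_variational:
  "is_nash own X f \<theta> x \<longleftrightarrow> x \<in> profiles own X \<and> (\<forall>i. \<forall>v\<in>X i. 0 \<le> (v - block own i x) \<bullet> pgrad own f i x \<theta>)"
proof (cases "x \<in> profiles own X")
  case True
  have "(\<forall>v\<in>X i. f i x \<theta> \<le> f i (upd_block own i v x) \<theta>) \<longleftrightarrow> (\<forall>v\<in>X i. 0 \<le> (v - block own i x) \<bullet> pgrad own f i x \<theta>)" for i
  proof (intro iffI ballI)
    fix v assume v: "v \<in> X i"
    let ?g = "\<lambda>v. f i (upd_block own i v x) \<theta>"
    have xi: "block own i x \<in> X i" using True by (auto simp: profiles_def)
    show "0 \<le> (v - block own i x) \<bullet> pgrad own f i x \<theta>" if "\<forall>v\<in>X i. f i x \<theta> \<le> ?g v"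
    proof (rule GDERIV_inner_nonneg[OF GDERIV_pgrad])
      fix s :: real assume s: "0 < s" "s \<le> 1"
      have "(1 - s) *\<^sub>R block own i x + s *\<^sub>R v \<in> X i"
        using convexD[OF X_props(4) xi v, of "1 - s" s] s by simp
      moreover have "?g ((1 - s) *\<^sub>R block own i x + s *\<^sub>R v) = ?g (x + s *\<^sub>R (v - block own i x))"
        by (intro arg_cong2[where f = "f i"] upd_block_cong) (auto simp: vec_eq_iff block_nth algebra_simps)
      ultimately show "?g x \<le> ?g (x + s *\<^sub>R (v - block own i x))" using that by fastforce
    qed
    show "f i x \<theta> \<le> ?g v" if "\<forall>v\<in>X i. 0 \<le> (v - block own i x) \<bullet> pgrad own f i x \<theta>"
    proof -
      have "?g x + (v - x) \<bullet> pgrad own f i x \<theta> \<le> ?g v"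
        by (rule convex_GDERIV_above_tangent[OF GDERIV_pgrad]) (use regular in \<open>auto simp: regular_game_def\<close>)
      moreover have "(v - x) \<bullet> pgrad own f i x \<theta> = (v - block own i x) \<bullet> pgrad own f i x \<theta>"
        using inner_block[of own i "v - x" "pgrad own f i x \<theta>"] block_X[OF v] by (simp add: block_diff)
      ultimately show ?thesis using that v by fastforce
    qed
  qed
  then show ?thesis using True by (simp add: is_nash_def)
qed (simp add: is_nash_def)

text \<open>Multiplied by \<open>\<gamma>\<close>, the variational inequality is the obtuse angle
  criterion for projections. As the step is arbitrary, existence can be proved with one step size
  and the inner routine analysed with another.\<close>

lemma is_nash_iff_fixed_point:
  assumes "0 < \<gamma>"
  shows "is_nash own X f \<theta> x \<longleftrightarrow>
    (\<forall>i. closest_point (X i) (block own i x - \<gamma> *\<^sub>R pgrad own f i x \<theta>) = block own i x)" (is "_ \<longleftrightarrow> ?R")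
proof -
  have dot: "(block own i x - \<gamma> *\<^sub>R pgrad own f i x \<theta> - block own i x) \<bullet> (v - block own i x)
    = - \<gamma> * ((v - block own i x) \<bullet> pgrad own f i x \<theta>)" for i v
    by (simp add: inner_commute)
  show ?thesis
  proof
    assume "is_nash own X f \<theta> x"
    then have x: "x \<in> profiles own X" and vi: "\<And>i v. v \<in> X i \<Longrightarrow> 0 \<le> (v - block own i x) \<bullet> pgrad own f i x \<theta>"
      by (auto simp: is_nash_iff_variational)
    show ?R
    proof (intro allI closest_point_eqI X_props)
      fix i z assume "z \<in> X i"
      then show "(block own i x - \<gamma> *\<^sub>R pgrad own f i x \<theta> - block own i x) \<bullet> (z - block own i x) \<le> 0"
        unfolding dot using vi[of z i] assms by simp
    qed (use x in \<open>simp add: profiles_def\<close>)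
  next
    assume fp: ?R
    have "0 \<le> (v - block own i x) \<bullet> pgrad own f i x \<theta>" if "v \<in> X i" for i v
      using closest_point_dot[OF X_props(4,3) that, of "block own i x - \<gamma> *\<^sub>R pgrad own f i x \<theta>"]
        fp[rule_format, of i] dot[of i v] assms by (simp add: mult_le_0_iff zero_le_mult_iff)
    moreover have "block own i x \<in> X i" for i
      using closest_point_in_set[OF X_props(3,1), of i] fp by metis
    ultimately show "is_nash own X f \<theta> x" by (simp add: is_nash_iff_variational profiles_def)
  qed
qed

text \<open>Banach's theorem for the projected pseudo-gradient step. Strong monotonicity and the
  Lipschitz bound give the factor \<open>1 - 2 \<gamma> \<mu> + \<gamma>^2 l^2\<close> for squared
  distances, and \<open>\<gamma> = \<mu> / l^2\<close> minimises it.\<close>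

lemma nash_exists_unique: "\<exists>!x. is_nash own X f \<theta> x"
proof -
  define \<gamma> where "\<gamma> = \<mu> / l\<^sup>2"
  define G where "G x = pseudo_gradient own f x \<theta>" for x
  define T where "T x = glue own (\<lambda>i. closest_point (X i) (block own i (x - \<gamma> *\<^sub>R G x)))" for x
  \<comment> \<open>The maximum with 0 keeps \<open>sqrt k\<close> nonnegative, as a contraction
    factor has to be, without a prior comparison of \<open>\<mu>\<close> and
    \<open>l\<close>.\<close>
  define k where "k = max 0 (1 - \<mu>\<^sup>2 / l\<^sup>2)"
  have \<mu>l: "0 < \<mu>" "0 < l" and \<gamma>: "0 < \<gamma>" using pseudo_gradient_props(1,2) by (auto simp: \<gamma>_def)
  have k: "0 \<le> k" "k < 1" using \<mu>l by (auto simp: k_def)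
  have bG: "block own i (x - \<gamma> *\<^sub>R G x) = block own i x - \<gamma> *\<^sub>R pgrad own f i x \<theta>" for i x
    by (simp add: block_diff block_scaleR G_def pseudo_gradient_eq_glue block_glue)
  have "dist (T x) (T x') \<le> sqrt k * dist x x'" for x x'
  proof (rule power2_le_imp_le)
    have "norm (T x - T x') \<le> norm (glue own (\<lambda>i. (x - \<gamma> *\<^sub>R G x) - (x' - \<gamma> *\<^sub>R G x')))"
      unfolding T_def glue_diff
    proof (rule norm_glue_le)
      fix i
      let ?p = "\<lambda>x. closest_point (X i) (block own i (x - \<gamma> *\<^sub>R G x))"
      have "norm (block own i (?p x - ?p x')) \<le> norm (?p x - ?p x')" by (rule norm_block_le)
      also have "\<dots> \<le> norm (block own i (x - \<gamma> *\<^sub>R G x) - block own i (x' - \<gamma> *\<^sub>R G x'))"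
        using closest_point_lipschitz[OF X_props(4,3,1)] by (simp add: dist_norm)
      finally show "norm (block own i (?p x - ?p x')) \<le> norm (block own i ((x - \<gamma> *\<^sub>R G x) - (x' - \<gamma> *\<^sub>R G x')))"
        by (simp add: block_diff)
    qed
    then have "(dist (T x) (T x'))\<^sup>2 \<le> (norm ((x - x') - \<gamma> *\<^sub>R (G x - G x')))\<^sup>2"
      unfolding dist_norm by (intro power_mono) (auto simp: algebra_simps)
    also have "\<dots> = (norm (x - x'))\<^sup>2 - 2 * \<gamma> * ((G x - G x') \<bullet> (x - x')) + \<gamma>\<^sup>2 * (norm (G x - G x'))\<^sup>2"
      by (simp only: power2_norm_eq_inner) (simp add: inner_diff_left inner_diff_right inner_commute power2_eq_square algebra_simps)
    also have "\<dots> \<le> (norm (x - x'))\<^sup>2 - 2 * \<gamma> * (\<mu> * (norm (x - x'))\<^sup>2) + \<gamma>\<^sup>2 * (l * norm (x - x'))\<^sup>2"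
      using pseudo_gradient_props(3)[of x x' \<theta>] pseudo_gradient_props(4)[of x \<theta> x'] \<gamma>
      by (intro add_mono diff_mono mult_left_mono power_mono) (auto simp: G_def)
    also have "\<dots> = (1 - \<mu>\<^sup>2 / l\<^sup>2) * (norm (x - x'))\<^sup>2"
      using \<mu>l by (simp add: \<gamma>_def field_simps power2_eq_square)
    also have "\<dots> \<le> k * (norm (x - x'))\<^sup>2" by (intro mult_right_mono) (auto simp: k_def)
    finally show "(dist (T x) (T x'))\<^sup>2 \<le> (sqrt k * dist x x')\<^sup>2"
      using k by (simp add: dist_norm power_mult_distrib)
  qed (use k in auto)
  then have "\<exists>!x. T x = x"
    using k by (intro banach_fix_type[of "sqrt k"]) auto
  moreover have "is_nash own X f \<theta> x \<longleftrightarrow> T x = x" for x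
  proof -
    have cp: "block own i (closest_point (X i) z) = closest_point (X i) z" for i z
      by (intro block_X closest_point_in_set X_props)
    show ?thesis
      unfolding is_nash_iff_fixed_point[OF \<gamma>] bG[symmetric]
    proof
      assume "\<forall>i. closest_point (X i) (block own i (x - \<gamma> *\<^sub>R G x)) = block own i x"
      then show "T x = x" by (simp add: T_def)
    next
      assume "T x = x"
      then have "block own i (T x) = block own i x" for i by simp
      then show "\<forall>i. closest_point (X i) (block own i (x - \<gamma> *\<^sub>R G x)) = block own i x"
        by (simp add: T_def block_glue cp)
    qed
  qed
  ultimately show ?thesis by simp
qed

lemma is_nash_nash: "is_nash own X f \<theta> (nash own X f \<theta>)"
  unfolding nash_def by (rule theI'[OF nash_exists_unique])

lemma nash_in_profiles: "nash own X f \<theta> \<in> profiles own X"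
  using is_nash_nash by (simp add: is_nash_def)

lemma profiles_bounded: "\<exists>B. \<forall>x\<in>profiles own X. norm x \<le> B"
proof -
  have "\<exists>b. \<forall>v\<in>X i. norm v \<le> b" for i
    using compact_imp_bounded[OF X_props(2)[of i]] by (auto simp: bounded_iff)
  then obtain b where b: "\<And>i v. v \<in> X i \<Longrightarrow> norm v \<le> b i" by metis
  have "norm x \<le> sqrt (\<Sum>i\<in>UNIV. (b i)\<^sup>2)" if "x \<in> profiles own X" for x
  proof (rule real_le_rsqrt)
    have "(norm x)\<^sup>2 = (\<Sum>i\<in>UNIV. (norm (block own i x))\<^sup>2)" using norm_glue[of own "\<lambda>_. x"] by simp
    also have "\<dots> \<le> (\<Sum>i\<in>UNIV. (b i)\<^sup>2)"
      using that by (intro sum_mono power_mono b) (auto simp: profiles_def)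
    finally show "(norm x)\<^sup>2 \<le> (\<Sum>i\<in>UNIV. (b i)\<^sup>2)" .
  qed
  then show ?thesis by blast
qed

end

section \<open>Smoothing and descent\<close>

lemma integrable_uniform_sphere:
  fixes k :: "'a::euclidean_space \<Rightarrow> 'b::{banach, second_countable_topology}"
  assumes "k \<in> borel_measurable borel" "\<And>u. norm u = 1 \<Longrightarrow> norm (k u) \<le> b"
  shows "integrable uniform_sphere k"
proof -
  interpret prob_space "uniform_sphere :: 'a measure" by (rule prob_space_uniform_sphere)
  show ?thesis
    by (rule integrable_const_bound[where B = b]) (use assms in \<open>auto intro!: AE_uniform_sphereI\<close>)
qed

lemma norm_integral_uniform_sphere_le:
  fixes k :: "'a::euclidean_space \<Rightarrow> 'b::{banach, second_countable_topology}"
  assumes [measurable]: "k \<in> borel_measurable borel" and b: "\<And>u. norm u = 1 \<Longrightarrow> norm (k u) \<le> b"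
  shows "norm (\<integral>u. k u \<partial>uniform_sphere) \<le> b"
proof -
  interpret prob_space "uniform_sphere :: 'a measure" by (rule prob_space_uniform_sphere)
  have "norm (\<integral>u. k u \<partial>uniform_sphere) \<le> (\<integral>u. norm (k u) \<partial>uniform_sphere)"
    by (rule integral_norm_bound)
  also have "\<dots> \<le> (\<integral>u. b \<partial>(uniform_sphere :: 'a measure))"
    using integrable_uniform_sphere[OF assms] by (intro integral_mono_AE AE_uniform_sphereI b) simp_all
  finally show ?thesis using prob_space by simp
qed

lemma lipschitz_bounded_on_sphere:
  fixes F :: "'a::euclidean_space \<Rightarrow> real"
  assumes "\<And>x y. \<bar>F x - F y\<bar> \<le> L * norm (x - y)" and "norm u = 1"
  shows "\<bar>F (\<theta> + \<xi> *\<^sub>R u)\<bar> \<le> \<bar>F \<theta>\<bar> + L * \<bar>\<xi>\<bar>"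
  using assms(1)[of "\<theta> + \<xi> *\<^sub>R u" \<theta>] assms(2) by simp

lemma integrable_sphere_lipschitz:
  fixes F :: "'a::euclidean_space \<Rightarrow> real"
  assumes F: "\<And>x y. \<bar>F x - F y\<bar> \<le> L * norm (x - y)"
  shows "integrable uniform_sphere (\<lambda>u. F (\<theta> + \<xi> *\<^sub>R u) *\<^sub>R u)"
proof -
  have [measurable]: "F \<in> borel_measurable borel" by (rule lipschitz_measurable[OF F])
  show ?thesis
    by (rule integrable_uniform_sphere[of _ "\<bar>F \<theta>\<bar> + L * \<bar>\<xi>\<bar>"])
       (auto simp: lipschitz_bounded_on_sphere[OF F])
qed

text \<open>Substituting \<open>\<theta> + \<xi> y\<close> reduces the claim to the unit ball, with
  Lipschitz constant \<open>L * \<xi>\<close>. The displacement becomes \<open>h / \<xi>\<close>,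
  the origin of the factor \<open>1 / \<xi>\<close> in the gradient and of the radius
  \<open>\<xi> / 2\<close>.\<close>

lemma ball_smoothing_GDERIV:
  fixes F :: "'a::euclidean_space \<Rightarrow> real"
  assumes F: "\<And>x y. \<bar>F x - F y\<bar> \<le> L * norm (x - y)" and \<xi>: "0 < \<xi>"
  shows "GDERIV (\<lambda>\<theta>. \<integral>\<nu>. F (\<theta> + \<xi> *\<^sub>R \<nu>) \<partial>uniform_measure lborel (cball 0 1)) \<theta>
    :> (real DIM('a) / \<xi>) *\<^sub>R (\<integral>u. F (\<theta> + \<xi> *\<^sub>R u) *\<^sub>R u \<partial>uniform_sphere)"
proof -
  define F' where "F' y = F (\<theta> + \<xi> *\<^sub>R y)" for y
  have F': "\<bar>F' x - F' y\<bar> \<le> (L * \<xi>) * norm (x - y)" for x y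
    using F[of "\<theta> + \<xi> *\<^sub>R x" "\<theta> + \<xi> *\<^sub>R y"] \<xi> by (simp add: F'_def flip: scaleR_diff_right)
  obtain C where C: "\<And>h. norm h \<le> 1/2 \<Longrightarrow>
    \<bar>(\<integral>\<nu>. F' (h + \<nu>) \<partial>uniform_measure lborel (cball 0 1)) - (\<integral>\<nu>. F' \<nu> \<partial>uniform_measure lborel (cball 0 1))
      - real DIM('a) * (\<integral>u. F' u * (h \<bullet> u) \<partial>uniform_sphere)\<bar> \<le> C * (norm h)\<^sup>2"
    using ball_smoothing_first_order[OF F'] by blast
  have int: "integrable uniform_sphere (\<lambda>u. F' u *\<^sub>R u)"
    unfolding F'_def by (rule integrable_sphere_lipschitz[OF F])
  show ?thesis
  proof (rule GDERIV_quadraticI[of "\<xi> / 2" _ _ _ "C / \<xi>\<^sup>2"])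
    fix h :: 'a assume h: "norm h \<le> \<xi> / 2"
    have "F' (h /\<^sub>R \<xi> + \<nu>) = F (\<theta> + h + \<xi> *\<^sub>R \<nu>)" for \<nu>
      using \<xi> by (simp add: F'_def algebra_simps)
    moreover have "real DIM('a) * (\<integral>u. F' u * ((h /\<^sub>R \<xi>) \<bullet> u) \<partial>uniform_sphere)
      = h \<bullet> ((real DIM('a) / \<xi>) *\<^sub>R (\<integral>u. F' u *\<^sub>R u \<partial>uniform_sphere))"
    proof -
      have "h \<bullet> (\<integral>u. F' u *\<^sub>R u \<partial>uniform_sphere) = (\<integral>u. F' u * (h \<bullet> u) \<partial>uniform_sphere)"
        using integral_inner_left[of h, OF int] by (simp add: inner_commute)
      then show ?thesis by (simp add: mult.left_commute[of _ "inverse \<xi>"] divide_inverse)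
    qed
    ultimately show "\<bar>(\<integral>\<nu>. F (\<theta> + h + \<xi> *\<^sub>R \<nu>) \<partial>uniform_measure lborel (cball 0 1))
      - (\<integral>\<nu>. F (\<theta> + \<xi> *\<^sub>R \<nu>) \<partial>uniform_measure lborel (cball 0 1))
      - h \<bullet> ((real DIM('a) / \<xi>) *\<^sub>R (\<integral>u. F (\<theta> + \<xi> *\<^sub>R u) *\<^sub>R u \<partial>uniform_sphere))\<bar> \<le> C / \<xi>\<^sup>2 * (norm h)\<^sup>2"
      using C[of "h /\<^sub>R \<xi>"] h \<xi> by (simp add: F'_def field_simps power_mult_distrib)
  qed (use \<xi> in simp)
qed

lemma integral_sphere_id: "(\<integral>u. u \<partial>(uniform_sphere :: 'a::euclidean_space measure)) = 0"
proof -
  \<comment> \<open>the smoothing formula for a constant function\<close>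
  interpret prob_space "uniform_measure lborel (cball (0::'a) 1)" by (rule cball_uniform_prob) simp
  have "GDERIV (\<lambda>\<theta>::'a. \<integral>\<nu>. 1 \<partial>uniform_measure lborel (cball (0::'a) 1)) 0
    :> (real DIM('a) / 1) *\<^sub>R (\<integral>u. 1 *\<^sub>R u \<partial>uniform_sphere)"
    using ball_smoothing_GDERIV[of "\<lambda>_. 1" 0 1 "0::'a"] by simp
  moreover have "GDERIV (\<lambda>\<theta>::'a. \<integral>\<nu>. 1 \<partial>uniform_measure lborel (cball (0::'a) 1)) 0 :> 0"
    by (simp add: GDERIV_const)
  ultimately have "(real DIM('a) / 1) *\<^sub>R (\<integral>u. 1 *\<^sub>R u \<partial>(uniform_sphere :: 'a measure)) = 0"
    using gradient_eqI by metis
  then show ?thesis by simp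
qed

lemma gradient_bound_descent:
  fixes \<psi> :: "'a::euclidean_space \<Rightarrow> real"
  assumes D: "\<And>x. GDERIV \<psi> x :> D x" and lip: "\<And>x y. norm (D x - D y) \<le> L * norm (x - y)"
  shows "\<psi> (x + h) \<le> \<psi> x + h \<bullet> D x + L / 2 * (norm h)\<^sup>2"
proof -
  \<comment> \<open>\<open>g\<close> is \<open>\<psi>\<close> on the segment minus the nonconstant
    part of its proposed quadratic majorant. The Lipschitz bound makes its derivative nonpositive,
    and \<open>g 1 \<le> g 0\<close> is the claim.\<close>
  define g where "g s = \<psi> (x + s *\<^sub>R h) - s * (h \<bullet> D x) - L / 2 * (norm h)\<^sup>2 * s\<^sup>2" for s
  have line: "((\<lambda>s. \<psi> (x + s *\<^sub>R h)) has_real_derivative h \<bullet> D (x + s *\<^sub>R h)) (at s)" for s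
  proof -
    have "((\<lambda>r. \<psi> ((x + s *\<^sub>R h) + r *\<^sub>R h)) has_real_derivative h \<bullet> D (x + s *\<^sub>R h)) (at (0::real))"
      by (rule GDERIV_line[OF D])
    then show ?thesis
      using DERIV_at_within_shift[of "\<lambda>s. \<psi> (x + s *\<^sub>R h)" "h \<bullet> D (x + s *\<^sub>R h)" s 0 UNIV]
      by (simp add: algebra_simps)
  qed
  have "g 1 \<le> g 0"
  proof (rule DERIV_nonpos_imp_nonincreasing[of 0 1 g])
    fix s :: real assume s: "0 \<le> s" "s \<le> 1"
    have "(g has_real_derivative h \<bullet> D (x + s *\<^sub>R h) - h \<bullet> D x - L / 2 * (norm h)\<^sup>2 * (2 * s)) (at s)"
      unfolding g_def[abs_def] by (auto intro!: derivative_eq_intros line)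
    moreover have "h \<bullet> D (x + s *\<^sub>R h) - h \<bullet> D x \<le> L * (norm h)\<^sup>2 * s"
    proof -
      have "h \<bullet> D (x + s *\<^sub>R h) - h \<bullet> D x \<le> norm h * norm (D (x + s *\<^sub>R h) - D x)"
        using norm_cauchy_schwarz[of h "D (x + s *\<^sub>R h) - D x"] by (simp add: inner_diff_right)
      also have "\<dots> \<le> norm h * (L * norm (s *\<^sub>R h))"
        using lip[of "x + s *\<^sub>R h" x] by (intro mult_left_mono) auto
      finally show ?thesis using s by (simp add: power2_eq_square algebra_simps)
    qed
    then have "h \<bullet> D (x + s *\<^sub>R h) - h \<bullet> D x - L / 2 * (norm h)\<^sup>2 * (2 * s) \<le> 0" by simp
    ultimately show "\<exists>y. DERIV g s :> y \<and> y \<le> 0" by blast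
  qed simp
  then show ?thesis by (simp add: g_def)
qed

section \<open>The squared distance to a convex set\<close>

lemma infdist_eq_closest_point:
  fixes S :: "'a::euclidean_space set"
  assumes "closed S" "S \<noteq> {}"
  shows "infdist x S = norm (x - closest_point S x)"
  using setdist_closest_point[OF assms, of x] by (simp add: setdist_eq_infdist[symmetric] infdist_eq_setdist dist_norm)

text \<open>The projection of \<open>x\<close> is a competitor for \<open>x + h\<close>, which
  yields the upper estimate. The lower one is the same estimate started at \<open>x + h\<close> with
  displacement \<open>- h\<close>; nonexpansiveness of the projection controls the change of the
  foot point.\<close>

lemma GDERIV_infdist_square:
  fixes S :: "'a::euclidean_space set"
  assumes S: "closed S" "S \<noteq> {}" "convex S"
  shows "GDERIV (\<lambda>x. (infdist x S)\<^sup>2) x :> 2 *\<^sub>R (x - closest_point S x)"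
proof -
  define p where "p = closest_point S"
  have pS: "p x \<in> S" for x unfolding p_def using S closest_point_in_set by blast
  have up: "(infdist (x + h) S)\<^sup>2 \<le> (infdist x S)\<^sup>2 + 2 * (h \<bullet> (x - p x)) + (norm h)\<^sup>2" for x h
  proof -
    have "(infdist (x + h) S)\<^sup>2 \<le> (norm (x + h - p x))\<^sup>2"
      using infdist_le[OF pS[of x], of "x + h"] by (intro power_mono infdist_nonneg) (simp add: dist_norm)
    also have "\<dots> = (norm (x - p x))\<^sup>2 + 2 * (h \<bullet> (x - p x)) + (norm h)\<^sup>2"
      unfolding power2_norm_eq_inner
      by (simp add: inner_diff_left inner_diff_right inner_add_left inner_add_right inner_commute algebra_simps)
    finally show ?thesis by (simp add: infdist_eq_closest_point[OF S(1,2)] p_def)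
  qed
  show ?thesis
  proof (rule GDERIV_quadraticI[of 1 _ _ _ 3])
    fix h :: 'a
    have "(infdist x S)\<^sup>2 \<le> (infdist (x + h) S)\<^sup>2 - 2 * (h \<bullet> (x + h - p (x + h))) + (norm h)\<^sup>2"
      using up[of "x + h" "- h"] by simp
    moreover have "h \<bullet> (x + h - p (x + h)) = h \<bullet> (x - p x) + (norm h)\<^sup>2 - h \<bullet> (p (x + h) - p x)"
      by (simp add: inner_diff_right inner_add_right power2_norm_eq_inner)
    moreover have "\<bar>h \<bullet> (p (x + h) - p x)\<bar> \<le> (norm h)\<^sup>2"
    proof -
      have "norm (p (x + h) - p x) \<le> norm h"
        using closest_point_lipschitz[OF S(3,1,2), of "x + h" x] by (simp add: p_def dist_norm)
      then show ?thesis
        using Cauchy_Schwarz_ineq2[of h "p (x + h) - p x"] mult_left_mono[of _ "norm h" "norm h"]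
        by (fastforce simp: power2_eq_square)
    qed
    ultimately show "\<bar>(infdist (x + h) S)\<^sup>2 - (infdist x S)\<^sup>2 - h \<bullet> (2 *\<^sub>R (x - closest_point S x))\<bar> \<le> 3 * (norm h)\<^sup>2"
      using up[of x h] by (simp add: p_def abs_le_iff)
  qed simp
qed

section \<open>Inexact stochastic gradient descent\<close>

text \<open>Conditioning on the iterate is carried out by Fubini: direction and iterate have a
  product law, and with the iterate frozen the centred estimate integrates to zero over the
  directions.\<close>

lemma expectation_independent_direction:
  fixes \<theta> u :: "'w \<Rightarrow> 'a::euclidean_space" and g :: "'a \<Rightarrow> 'a \<Rightarrow> 'a" and D :: "'a \<Rightarrow> 'a"
  assumes M: "prob_space M" and [measurable]: "\<theta> \<in> borel_measurable M" "u \<in> borel_measurable M"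
    and u: "distr M borel u = uniform_sphere"
    and indep: "prob_space.indep_set M {u -` B \<inter> space M |B. B \<in> sets borel} {\<theta> -` B \<inter> space M |B. B \<in> sets borel}"
    and g [measurable]: "case_prod g \<in> borel_measurable (borel \<Otimes>\<^sub>M borel)" and [measurable]: "D \<in> borel_measurable borel"
    and gb: "\<And>x v. norm v = 1 \<Longrightarrow> norm (g x v) \<le> G"
    and int: "integrable M (\<lambda>\<omega>. D (\<theta> \<omega>) \<bullet> (g (\<theta> \<omega>) (u \<omega>) - (\<integral>v. g (\<theta> \<omega>) v \<partial>uniform_sphere)))"
  shows "(\<integral>\<omega>. D (\<theta> \<omega>) \<bullet> (g (\<theta> \<omega>) (u \<omega>) - (\<integral>v. g (\<theta> \<omega>) v \<partial>uniform_sphere)) \<partial>M) = 0"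
proof -
  interpret prob_space M by fact
  interpret T: prob_space "distr M borel \<theta>" by (rule prob_space_distr) simp
  interpret S: prob_space "uniform_sphere :: 'a measure" by (rule prob_space_uniform_sphere)
  interpret ST: pair_prob_space "uniform_sphere :: 'a measure" "distr M borel \<theta>" ..
  define h where "h x = (\<integral>v. g x v \<partial>uniform_sphere)" for x
  have gx: "g x \<in> borel_measurable borel" for x
    using measurable_compose[OF measurable_Pair1' g, of x] by simp
  have [measurable]: "h \<in> borel_measurable borel"
    unfolding h_def[abs_def] by (rule S.borel_measurable_lebesgue_integral) (use g in \<open>simp cong: measurable_cong_sets sets_pair_measure_cong\<close>)
  let ?\<Phi> = "\<lambda>(v, x). D x \<bullet> (g x v - h x)"
  have \<Phi> [measurable]: "?\<Phi> \<in> borel_measurable (borel \<Otimes>\<^sub>M borel)" by measurable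
  have prod: "distr M (borel \<Otimes>\<^sub>M borel) (\<lambda>\<omega>. (u \<omega>, \<theta> \<omega>)) = uniform_sphere \<Otimes>\<^sub>M distr M borel \<theta>"
    unfolding u[symmetric] by (intro distr_pair_indep prob_space_axioms indep) simp_all
  have intP: "integrable (uniform_sphere \<Otimes>\<^sub>M distr M borel \<theta>) ?\<Phi>"
    unfolding prod[symmetric] using int by (subst integrable_distr_eq) (simp_all add: h_def)
  have "(\<integral>\<omega>. D (\<theta> \<omega>) \<bullet> (g (\<theta> \<omega>) (u \<omega>) - h (\<theta> \<omega>)) \<partial>M) = (\<integral>z. ?\<Phi> z \<partial>distr M (borel \<Otimes>\<^sub>M borel) (\<lambda>\<omega>. (u \<omega>, \<theta> \<omega>)))"
    by (subst integral_distr) auto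
  also have "\<dots> = (\<integral>x. (\<integral>v. ?\<Phi> (v, x) \<partial>uniform_sphere) \<partial>distr M borel \<theta>)"
    unfolding prod using ST.integral_snd[of "\<lambda>v x. ?\<Phi> (v, x)"] intP by simp
  also have "\<dots> = 0"
  proof -
    have "(\<integral>v. ?\<Phi> (v, x) \<partial>uniform_sphere) = 0" for x
    proof -
      have i: "integrable uniform_sphere (g x)" by (rule integrable_uniform_sphere[OF gx gb])
      have "(\<integral>v. D x \<bullet> (g x v - h x) \<partial>uniform_sphere) = D x \<bullet> (\<integral>v. g x v - h x \<partial>uniform_sphere)"
        using i by (intro integral_inner_right) simp
      also have "(\<integral>v. g x v - h x \<partial>uniform_sphere) = 0"
        using i S.prob_space[simplified] by (simp add: h_def)
      finally show ?thesis by simp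
    qed
    then show ?thesis by simp
  qed
  finally show ?thesis by (simp add: h_def)
qed

text \<open>Here \<open>d\<close> is the true gradient, \<open>n\<close> the centred noise and
  \<open>e\<close> the bias. The noise is kept in the product \<open>d \<bullet> n\<close>, whose
  expectation will vanish; the bias is absorbed by
  \<open>- 2 * (e \<bullet> d) \<le> |d|^2 + |e|^2\<close>. Of the remaining decrease
  \<open>\<alpha> / 2\<close> times \<open>|d|^2\<close>, the second-order term consumes
  half.\<close>

lemma descent_step:
  fixes d z :: "'a::real_inner"
  assumes desc: "b \<le> a - \<alpha> * ((d + (n + e)) \<bullet> d) + L / 2 * (\<alpha>\<^sup>2 * (norm (d + (n + e)))\<^sup>2)"
    and \<alpha>: "0 < \<alpha>" "\<alpha> * L \<le> 1 / 4" and L: "0 \<le> L"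
    and n: "norm n \<le> B" and e: "norm e \<le> \<epsilon>"
  shows "b \<le> a - \<alpha> / 4 * (norm d)\<^sup>2 - \<alpha> * (d \<bullet> n) + (\<alpha> / 2 * \<epsilon>\<^sup>2 + L * \<alpha>\<^sup>2 * (2 * B\<^sup>2 + 2 * \<epsilon>\<^sup>2))"
proof -
  have par: "(norm (x + y))\<^sup>2 \<le> 2 * (norm x)\<^sup>2 + 2 * (norm y)\<^sup>2" for x y :: 'a
  proof -
    have "0 \<le> (norm (x - y))\<^sup>2" by simp
    then show ?thesis
      by (simp add: power2_norm_eq_inner inner_add_left inner_add_right inner_diff_left inner_diff_right inner_commute)
  qed
  have e2: "(norm e)\<^sup>2 \<le> \<epsilon>\<^sup>2" and n2: "(norm n)\<^sup>2 \<le> B\<^sup>2" using n e by (auto intro: power_mono)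
  have "(norm (n + e))\<^sup>2 \<le> 2 * B\<^sup>2 + 2 * \<epsilon>\<^sup>2"
    by (rule order_trans[OF par]) (intro add_mono mult_left_mono e2 n2, auto)
  then have "(norm (d + (n + e)))\<^sup>2 \<le> 2 * (norm d)\<^sup>2 + 2 * (2 * B\<^sup>2 + 2 * \<epsilon>\<^sup>2)"
    by (intro order_trans[OF par[of d "n + e"]] add_mono order_refl mult_left_mono) simp_all
  then have "L / 2 * (\<alpha>\<^sup>2 * (norm (d + (n + e)))\<^sup>2) \<le> L / 2 * (\<alpha>\<^sup>2 * (2 * (norm d)\<^sup>2 + 2 * (2 * B\<^sup>2 + 2 * \<epsilon>\<^sup>2)))"
    using L by (intro mult_left_mono) auto
  also have "\<dots> = (\<alpha> * L) * (\<alpha> * (norm d)\<^sup>2) + L * \<alpha>\<^sup>2 * (2 * B\<^sup>2 + 2 * \<epsilon>\<^sup>2)"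
    by (simp add: power2_eq_square algebra_simps)
  also have "(\<alpha> * L) * (\<alpha> * (norm d)\<^sup>2) \<le> 1 / 4 * (\<alpha> * (norm d)\<^sup>2)"
    using \<alpha> by (intro mult_right_mono) auto
  finally have q: "L / 2 * (\<alpha>\<^sup>2 * (norm (d + (n + e)))\<^sup>2) \<le> \<alpha> / 4 * (norm d)\<^sup>2 + L * \<alpha>\<^sup>2 * (2 * B\<^sup>2 + 2 * \<epsilon>\<^sup>2)"
    by simp
  have "- 2 * (e \<bullet> d) \<le> (norm d)\<^sup>2 + (norm e)\<^sup>2"
    using zero_le_power2[of "norm (d + e)"]
    by (simp add: power2_norm_eq_inner inner_add_left inner_add_right inner_commute)
  then have "(norm d)\<^sup>2 / 2 - \<epsilon>\<^sup>2 / 2 + d \<bullet> n \<le> (d + (n + e)) \<bullet> d"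
    using e2 by (simp add: inner_add_left inner_add_right power2_norm_eq_inner inner_commute)
  then have "\<alpha> * ((norm d)\<^sup>2 / 2 - \<epsilon>\<^sup>2 / 2 + d \<bullet> n) \<le> \<alpha> * ((d + (n + e)) \<bullet> d)"
    using \<alpha> by (intro mult_left_mono) auto
  then show ?thesis using desc q by (simp add: algebra_simps)
qed

text \<open>The estimate \<open>e k\<close> actually used is compared with \<open>g\<close>
  pointwise, where the sampled vector has unit length, which is almost sure. The deviation of
  \<open>g\<close> from its sphere average is the centred noise; its norm is at most
  \<open>2 * G\<close>, and \<open>8 * G\<^sup>2\<close> is twice the square of this.\<close>

lemma inexact_stochastic_gradient_descent:
  fixes \<psi> :: "'a::euclidean_space \<Rightarrow> real" and D w :: "'a \<Rightarrow> 'a" and g :: "'a \<Rightarrow> 'a \<Rightarrow> 'a"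
    and \<theta> u e :: "nat \<Rightarrow> 'w \<Rightarrow> 'a"
  assumes M: "prob_space M"
    and \<theta>m: "\<And>k. k \<le> K \<Longrightarrow> \<theta> k \<in> borel_measurable M"
    and um: "\<And>k. k < K \<Longrightarrow> u k \<in> borel_measurable M"
    and ud: "\<And>k. k < K \<Longrightarrow> distr M borel (u k) = uniform_sphere"
    and indep: "\<And>k. k < K \<Longrightarrow> prob_space.indep_set M
      {u k -` B \<inter> space M |B. B \<in> sets borel} {\<theta> k -` B \<inter> space M |B. B \<in> sets borel}"
    and init: "\<And>\<omega>. \<omega> \<in> space M \<Longrightarrow> \<theta> 0 \<omega> = \<theta>\<^sub>0"
    and step: "\<And>k \<omega>. k < K \<Longrightarrow> \<omega> \<in> space M \<Longrightarrow> \<theta> (Suc k) \<omega> = \<theta> k \<omega> - \<alpha> *\<^sub>R (e k \<omega> + w (\<theta> k \<omega>))"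
    and D: "\<And>x. GDERIV \<psi> x :> D x" and lip: "\<And>x y. norm (D x - D y) \<le> L * norm (x - y)"
    and L: "0 \<le> L" and low: "\<And>x. m \<le> \<psi> x"
    and Dw: "\<And>x. D x = (\<integral>v. g x v \<partial>uniform_sphere) + w x"
    and gm: "case_prod g \<in> borel_measurable (borel \<Otimes>\<^sub>M borel)"
    and gb: "\<And>x v. norm v = 1 \<Longrightarrow> norm (g x v) \<le> G"
    and err: "\<And>k \<omega>. k < K \<Longrightarrow> norm (u k \<omega>) = 1 \<Longrightarrow> norm (e k \<omega> - g (\<theta> k \<omega>) (u k \<omega>)) \<le> \<epsilon> k"
    and \<alpha>: "0 < \<alpha>" "\<alpha> * L \<le> 1 / 4"
  shows "k < K \<Longrightarrow> integrable M (\<lambda>\<omega>. (norm (D (\<theta> k \<omega>)))\<^sup>2)"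
    and "\<alpha> / 4 * (\<Sum>k<K. \<integral>\<omega>. (norm (D (\<theta> k \<omega>)))\<^sup>2 \<partial>M)
      \<le> \<psi> \<theta>\<^sub>0 - m + (\<Sum>k<K. \<alpha> / 2 * (\<epsilon> k)\<^sup>2 + L * \<alpha>\<^sup>2 * (8 * G\<^sup>2 + 2 * (\<epsilon> k)\<^sup>2))"
proof -
  interpret prob_space M by fact
  define h where "h x = (\<integral>v. g x v \<partial>uniform_sphere)" for x
  have gx: "g x \<in> borel_measurable borel" for x
    using measurable_compose[OF measurable_Pair1' gm, of x] by simp
  have hb: "norm (h x) \<le> G" for x
    unfolding h_def by (rule norm_integral_uniform_sphere_le[OF gx gb])
  have G: "0 \<le> G" using norm_ge_zero[of "h 0"] hb[of 0] by linarith
  have contD: "continuous_on UNIV D"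
    using lip L by (intro lipschitz_on_continuous_on[of L] lipschitz_onI) (auto simp: dist_norm)
  then have Dm: "D \<in> borel_measurable borel" by (rule borel_measurable_continuous_onI)
  have cont\<psi>: "continuous_on UNIV \<psi>"
    using has_derivative_continuous[OF D[unfolded gderiv_def]] by (simp add: continuous_on_eq_continuous_within)
  then have \<psi>m: "\<psi> \<in> borel_measurable borel" by (rule borel_measurable_continuous_onI)
  have Db: "norm (D x) \<le> norm (D 0) + L * norm x" for x
    using lip[of x 0] norm_triangle_sub[of "D x" "D 0"] by simp
  have wb: "norm (w x) \<le> norm (D 0) + L * norm x + G" for x
    using Db[of x] hb[of x] norm_triangle_ineq4[of "D x" "h x"] Dw[of x] by (simp add: h_def)
  have u1: "AE \<omega> in M. norm (u k \<omega>) = 1" if "k < K" for k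
    by (rule AE_distrD[OF um[OF that]]) (unfold ud[OF that], rule AE_uniform_sphere)
  \<comment> \<open>The bound may grow with \<open>k\<close>. For integrability it is enough that
    each step adds a bounded displacement to an almost surely bounded iterate.\<close>
  have bounded: "\<exists>b. AE \<omega> in M. norm (\<theta> k \<omega>) \<le> b" if "k \<le> K" for k
    using that
  proof (induction k)
    case 0
    then show ?case using init by (intro exI[of _ "norm \<theta>\<^sub>0"]) auto
  next
    case (Suc k)
    then obtain b where b: "AE \<omega> in M. norm (\<theta> k \<omega>) \<le> b" by auto
    have k: "k < K" using Suc by simp
    have "AE \<omega> in M. norm (\<theta> (Suc k) \<omega>) \<le> b + \<alpha> * ((\<epsilon> k + G) + (norm (D 0) + L * b + G))"
      using b u1[OF k] AE_space
    proof eventually_elim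
      case (elim \<omega>)
      have "norm (e k \<omega>) \<le> \<epsilon> k + G"
        using err[OF k, of \<omega>] gb[of "u k \<omega>" "\<theta> k \<omega>"] elim
          norm_triangle_sub[of "e k \<omega>" "g (\<theta> k \<omega>) (u k \<omega>)"] by simp
      moreover have "norm (w (\<theta> k \<omega>)) \<le> norm (D 0) + L * b + G"
        using wb[of "\<theta> k \<omega>"] mult_left_mono[OF elim(1) L] by linarith
      ultimately have "norm (e k \<omega> + w (\<theta> k \<omega>)) \<le> (\<epsilon> k + G) + (norm (D 0) + L * b + G)"
        by (rule norm_triangle_mono)
      then have "norm (\<alpha> *\<^sub>R (e k \<omega> + w (\<theta> k \<omega>))) \<le> \<alpha> * ((\<epsilon> k + G) + (norm (D 0) + L * b + G))"
        using \<alpha> by simp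
      then show ?case
        using step[OF k, of \<omega>] elim norm_triangle_ineq4[of "\<theta> k \<omega>" "\<alpha> *\<^sub>R (e k \<omega> + w (\<theta> k \<omega>))"] by simp
    qed
    then show ?case by blast
  qed
  \<comment> \<open>A continuous function is bounded on the compact ball that almost surely contains
    the iterate.\<close>
  have int_cont: "integrable M (\<lambda>\<omega>. F (\<theta> k \<omega>))" if k: "k \<le> K" and F: "continuous_on UNIV F" for F :: "'a \<Rightarrow> real" and k
  proof -
    obtain b where b: "AE \<omega> in M. norm (\<theta> k \<omega>) \<le> b" using bounded[OF k] by blast
    have "compact (F ` cball 0 b)"
      using F by (intro compact_continuous_image) (auto intro: continuous_on_subset)
    then have "\<exists>c. \<forall>x\<in>cball 0 b. norm (F x) \<le> c"
      using compact_imp_bounded[of "F ` cball 0 b"] by (auto simp: bounded_iff)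
    then obtain c where "\<forall>x\<in>cball 0 b. norm (F x) \<le> c" ..
    then have c: "norm (F x) \<le> c" if "norm x \<le> b" for x using that by simp
    have Fm: "F \<in> borel_measurable borel" by (rule borel_measurable_continuous_onI[OF F])
    show ?thesis
    proof (rule integrable_const_bound[where B = c])
      show "AE \<omega> in M. norm (F (\<theta> k \<omega>)) \<le> c" using b by eventually_elim (rule c)
      show "(\<lambda>\<omega>. F (\<theta> k \<omega>)) \<in> borel_measurable M" by (rule measurable_compose[OF \<theta>m[OF k] Fm])
    qed
  qed
  have intD: "integrable M (\<lambda>\<omega>. (norm (D (\<theta> k \<omega>)))\<^sup>2)" if "k \<le> K" for k
    by (rule int_cont[OF that]) (intro continuous_intros contD)
  show "k < K \<Longrightarrow> integrable M (\<lambda>\<omega>. (norm (D (\<theta> k \<omega>)))\<^sup>2)" by (rule intD) simp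
  have int\<psi>: "integrable M (\<lambda>\<omega>. \<psi> (\<theta> k \<omega>))" if "k \<le> K" for k by (rule int_cont[OF that cont\<psi>])
  define c where "c k = \<alpha> / 2 * (\<epsilon> k)\<^sup>2 + L * \<alpha>\<^sup>2 * (8 * G\<^sup>2 + 2 * (\<epsilon> k)\<^sup>2)" for k
  have dec: "\<alpha> / 4 * (\<integral>\<omega>. (norm (D (\<theta> k \<omega>)))\<^sup>2 \<partial>M) \<le> (\<integral>\<omega>. \<psi> (\<theta> k \<omega>) \<partial>M) - (\<integral>\<omega>. \<psi> (\<theta> (Suc k) \<omega>) \<partial>M) + c k"
    if k: "k < K" for k
  proof -
    define n where "n \<omega> = g (\<theta> k \<omega>) (u k \<omega>) - h (\<theta> k \<omega>)" for \<omega>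
    have [measurable]: "\<theta> k \<in> borel_measurable M" "u k \<in> borel_measurable M" "D \<in> borel_measurable borel"
      using \<theta>m um k Dm by auto
    interpret S: prob_space "uniform_sphere :: 'a measure" by (rule prob_space_uniform_sphere)
    have hm [measurable]: "h \<in> borel_measurable borel"
      unfolding h_def[abs_def] by (rule S.borel_measurable_lebesgue_integral) (use gm in \<open>simp cong: measurable_cong_sets sets_pair_measure_cong\<close>)
    have [measurable]: "(\<lambda>\<omega>. g (\<theta> k \<omega>) (u k \<omega>)) \<in> borel_measurable M"
      using measurable_compose[OF _ gm, of "\<lambda>\<omega>. (\<theta> k \<omega>, u k \<omega>)" M] by simp
    have nm [measurable]: "n \<in> borel_measurable M" unfolding n_def[abs_def] by measurable
    have nb: "norm (n \<omega>) \<le> 2 * G" if "norm (u k \<omega>) = 1" for \<omega>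
      unfolding n_def using gb[OF that, of "\<theta> k \<omega>"] hb[of "\<theta> k \<omega>"]
        norm_triangle_ineq4[of "g (\<theta> k \<omega>) (u k \<omega>)" "h (\<theta> k \<omega>)"] by linarith
    obtain b where b: "AE \<omega> in M. norm (\<theta> k \<omega>) \<le> b" using bounded[of k] k by auto
    have intn: "integrable M (\<lambda>\<omega>. D (\<theta> k \<omega>) \<bullet> n \<omega>)"
    proof (rule integrable_const_bound[where B = "(norm (D 0) + L * b) * (2 * G)"])
      show "AE \<omega> in M. norm (D (\<theta> k \<omega>) \<bullet> n \<omega>) \<le> (norm (D 0) + L * b) * (2 * G)"
        using b u1[OF k]
      proof eventually_elim
        case (elim \<omega>)
        have "norm (D (\<theta> k \<omega>)) \<le> norm (D 0) + L * b"
          using Db[of "\<theta> k \<omega>"] mult_left_mono[OF elim(1) L] by linarith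
        then have "norm (D (\<theta> k \<omega>)) * norm (n \<omega>) \<le> (norm (D 0) + L * b) * (2 * G)"
          using nb[OF elim(2)] by (intro mult_mono) (auto intro: order_trans[OF norm_ge_zero])
        then show ?case using Cauchy_Schwarz_ineq2[of "D (\<theta> k \<omega>)" "n \<omega>"] by simp
      qed
    qed simp
    have zero: "(\<integral>\<omega>. D (\<theta> k \<omega>) \<bullet> n \<omega> \<partial>M) = 0"
      unfolding n_def h_def using k intn
      by (intro expectation_independent_direction[OF M _ _ ud indep gm Dm gb])
        (auto simp: n_def[abs_def] h_def)
    have "AE \<omega> in M. \<psi> (\<theta> (Suc k) \<omega>) \<le> \<psi> (\<theta> k \<omega>) - \<alpha> / 4 * (norm (D (\<theta> k \<omega>)))\<^sup>2 - \<alpha> * (D (\<theta> k \<omega>) \<bullet> n \<omega>) + c k"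
      using u1[OF k] AE_space
    proof eventually_elim
      case (elim \<omega>)
      define r where "r = e k \<omega> - g (\<theta> k \<omega>) (u k \<omega>)"
      have ew: "e k \<omega> + w (\<theta> k \<omega>) = D (\<theta> k \<omega>) + (n \<omega> + r)"
        using Dw[of "\<theta> k \<omega>"] by (simp add: n_def r_def h_def)
      have "\<psi> (\<theta> (Suc k) \<omega>) \<le> \<psi> (\<theta> k \<omega>) - \<alpha> * ((D (\<theta> k \<omega>) + (n \<omega> + r)) \<bullet> D (\<theta> k \<omega>))
        + L / 2 * (\<alpha>\<^sup>2 * (norm (D (\<theta> k \<omega>) + (n \<omega> + r)))\<^sup>2)"
        using gradient_bound_descent[OF D lip, of "\<theta> k \<omega>" "- (\<alpha> *\<^sub>R (D (\<theta> k \<omega>) + (n \<omega> + r)))"]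
          step[OF k elim(2)] ew by (simp add: power_mult_distrib)
      then have "\<psi> (\<theta> (Suc k) \<omega>) \<le> \<psi> (\<theta> k \<omega>) - \<alpha> / 4 * (norm (D (\<theta> k \<omega>)))\<^sup>2 - \<alpha> * (D (\<theta> k \<omega>) \<bullet> n \<omega>)
        + (\<alpha> / 2 * (\<epsilon> k)\<^sup>2 + L * \<alpha>\<^sup>2 * (2 * (2 * G)\<^sup>2 + 2 * (\<epsilon> k)\<^sup>2))"
        using err[OF k elim(1)] nb[OF elim(1)] by (intro descent_step \<alpha> L) (auto simp: r_def)
      then show ?case by (simp add: c_def power_mult_distrib)
    qed
    then have "(\<integral>\<omega>. \<psi> (\<theta> (Suc k) \<omega>) \<partial>M)
      \<le> (\<integral>\<omega>. \<psi> (\<theta> k \<omega>) - \<alpha> / 4 * (norm (D (\<theta> k \<omega>)))\<^sup>2 - \<alpha> * (D (\<theta> k \<omega>) \<bullet> n \<omega>) + c k \<partial>M)"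
      using k by (intro integral_mono_AE int\<psi> Bochner_Integration.integrable_add Bochner_Integration.integrable_diff
          integrable_mult_right intD intn) auto
    also have "\<dots> = (\<integral>\<omega>. \<psi> (\<theta> k \<omega>) \<partial>M) - \<alpha> / 4 * (\<integral>\<omega>. (norm (D (\<theta> k \<omega>)))\<^sup>2 \<partial>M) + c k"
      using k int\<psi>[of k] intD[of k] intn zero prob_space by simp
    finally show ?thesis by simp
  qed
  have "\<alpha> / 4 * (\<Sum>k<K. \<integral>\<omega>. (norm (D (\<theta> k \<omega>)))\<^sup>2 \<partial>M)
    \<le> (\<Sum>k<K. ((\<integral>\<omega>. \<psi> (\<theta> k \<omega>) \<partial>M) - (\<integral>\<omega>. \<psi> (\<theta> (Suc k) \<omega>) \<partial>M)) + c k)"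
    unfolding sum_distrib_left using dec by (intro sum_mono) auto
  also have "\<dots> = (\<integral>\<omega>. \<psi> (\<theta> 0 \<omega>) \<partial>M) - (\<integral>\<omega>. \<psi> (\<theta> K \<omega>) \<partial>M) + (\<Sum>k<K. c k)"
    using sum_lessThan_telescope'[of "\<lambda>k. \<integral>\<omega>. \<psi> (\<theta> k \<omega>) \<partial>M" K] by (simp add: sum.distrib)
  also have "(\<integral>\<omega>. \<psi> (\<theta> 0 \<omega>) \<partial>M) = \<psi> \<theta>\<^sub>0"
    using init prob_space by (simp cong: Bochner_Integration.integral_cong)
  finally have "\<alpha> / 4 * (\<Sum>k<K. \<integral>\<omega>. (norm (D (\<theta> k \<omega>)))\<^sup>2 \<partial>M) \<le> \<psi> \<theta>\<^sub>0 - (\<integral>\<omega>. \<psi> (\<theta> K \<omega>) \<partial>M) + (\<Sum>k<K. c k)" .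
  moreover have "m \<le> (\<integral>\<omega>. \<psi> (\<theta> K \<omega>) \<partial>M)"
    using integral_mono[OF _ int\<psi>[of K], of "\<lambda>_. m"] low prob_space by simp
  ultimately show "\<alpha> / 4 * (\<Sum>k<K. \<integral>\<omega>. (norm (D (\<theta> k \<omega>)))\<^sup>2 \<partial>M)
      \<le> \<psi> \<theta>\<^sub>0 - m + (\<Sum>k<K. \<alpha> / 2 * (\<epsilon> k)\<^sup>2 + L * \<alpha>\<^sup>2 * (8 * G\<^sup>2 + 2 * (\<epsilon> k)\<^sup>2))"
    by (simp add: c_def)
qed

text \<open>A comparison with the integral of \<open>x powr - s\<close>, in the form of the mean
  value theorem for its primitive, up to a factor, \<open>x powr (1 - s)\<close>.\<close>

lemma sum_inverse_powr_le:
  fixes s :: real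
  assumes s: "0 \<le> s" "s < 1"
  shows "(\<Sum>k<K. (real k + 1) powr - s) \<le> real K powr (1 - s) / (1 - s)"
proof (induction K)
  case (Suc K)
  have "(real K + 1) powr - s \<le> ((real K + 1) powr (1 - s) - real K powr (1 - s)) / (1 - s)"
  \<comment> \<open>At 0 the primitive need not be differentiable; the first summand is compared
    directly, as \<open>1 \<le> 1 / (1 - s)\<close>.\<close>
  proof (cases "K = 0")
    case True
    then show ?thesis using s by (simp add: field_simps)
  next
    case False
    have "\<exists>z>real K. z < real K + 1 \<and> (real K + 1) powr (1 - s) - real K powr (1 - s)
        = (real K + 1 - real K) * ((1 - s) * z powr (1 - s - 1))"
      using False by (intro MVT2) (auto intro!: derivative_eq_intros)
    then obtain z where z: "real K < z" "z < real K + 1"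
      and eq: "(real K + 1) powr (1 - s) - real K powr (1 - s) = (1 - s) * z powr - s" by auto
    have "(real K + 1) powr - s \<le> z powr - s"
      using z False s by (intro powr_mono2') auto
    then show ?thesis using s unfolding eq by simp
  qed
  then show ?case using Suc by (simp add: diff_divide_distrib add_ac)
qed simp

section \<open>The second singular value of a doubly stochastic matrix\<close>

text \<open>Near 0 the linear term would dominate. With \<open>d\<close> positive and larger than
  \<open>c\<close>, the choice \<open>s = - b / d\<close> gives the value
  \<open>b^2 (c - d) / d^2\<close>, negative unless \<open>b = 0\<close>.\<close>

lemma linear_coeff_zero:
  fixes b c :: real
  assumes "\<And>s. 0 \<le> s * b + s\<^sup>2 * c"
  shows "b = 0"
proof (rule ccontr)
  assume b: "b \<noteq> 0"
  define d where "d = \<bar>c\<bar> + 1"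
  have d: "0 < d" "c < d" by (auto simp: d_def)
  have "0 \<le> (- b / d) * b + (- b / d)\<^sup>2 * c" by (rule assms)
  also have "\<dots> = b\<^sup>2 * (c - d) / d\<^sup>2" using d by (simp add: field_simps power2_eq_square)
  also have "\<dots> < 0" using b d by (simp add: divide_neg_pos mult_pos_neg)
  finally show False by simp
qed

text \<open>If the second largest entry were below \<open>a\<close>, only the largest could reach
  \<open>a\<close>, but two entries do. Multiplicities count, hence the multiset inclusion.\<close>

lemma second_of_sorted_ge:
  fixes xs :: "'a::linorder list"
  assumes "sorted xs" and sub: "{#a, b#} \<subseteq># mset xs" and ab: "a \<le> b"
  shows "a \<le> rev xs ! 1"
proof -
  have "2 \<le> length xs" using size_mset_mono[OF sub] by simp
  then obtain y0 y1 ys where r: "rev xs = y0 # y1 # ys"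
    by (metis (no_types, lifting) Suc_le_length_iff length_rev numeral_2_eq_2)
  have "sorted_wrt (\<lambda>x y. y \<le> x) (rev xs)" using \<open>sorted xs\<close> by (simp add: sorted_wrt_rev)
  then have le: "\<forall>y\<in>set ys. y \<le> y1" by (simp add: r)
  show ?thesis
  proof (rule ccontr)
    assume "\<not> a \<le> rev xs ! 1"
    then have y1: "y1 < a" by (simp add: r)
    have "filter_mset ((\<le>) a) {#a, b#} \<subseteq># filter_mset ((\<le>) a) (mset (rev xs))"
      using sub by (intro multiset_filter_mono) simp
    then have "size {#a, b#} \<le> size (filter_mset ((\<le>) a) (mset (rev xs)))"
      using ab by (intro size_mset_mono) simp
    moreover have ys: "filter_mset ((\<le>) a) (mset ys) = {#}"
      using le y1 by (auto simp: filter_mset_eq_conv)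
    have "filter_mset ((\<le>) a) (mset (rev xs)) = (if a \<le> y0 then {#y0#} else {#})"
      unfolding r using y1 by (simp add: ys)
    ultimately show False by (simp split: if_splits)
  qed
qed

lemma inner_gram: "(A *v x) \<bullet> (A *v y) = ((transpose A ** A) *v x) \<bullet> y"
  for A :: "real^'n^'m"
  by (metis dot_lmul_matrix matrix_vector_mul_assoc transpose_matrix_vector)

lemma gram_self_adjoint: "((transpose A ** A) *v x) \<bullet> y = x \<bullet> ((transpose A ** A) *v y)"
  for A :: "real^'n^'m"
  by (metis inner_commute inner_gram)

lemma subspace_sv_space: "subspace (sv_space A \<sigma>)"
  by (auto simp: subspace_def sv_space_def matrix_vector_right_distrib algebra_simps matrix_vector_mult_scaleR)

lemma sv_space_orthogonal:
  assumes "x \<in> sv_space A \<sigma>" "y \<in> sv_space A \<tau>" "0 \<le> \<sigma>" "0 \<le> \<tau>" "\<sigma> \<noteq> \<tau>"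
  shows "orthogonal x y"
proof -
  have "\<sigma>\<^sup>2 * (x \<bullet> y) = \<tau>\<^sup>2 * (x \<bullet> y)"
    using gram_self_adjoint[of A x y] assms by (simp add: sv_space_def)
  moreover have "\<sigma>\<^sup>2 \<noteq> \<tau>\<^sup>2" using assms by simp
  ultimately show ?thesis by (simp add: orthogonal_def)
qed

text \<open>Eigenvectors for distinct singular values are orthogonal, hence independent. Finiteness
  gives the sum in \<open>singular_values\<close> its intended meaning, a sum over an infinite index
  set being 0 by convention.\<close>

lemma finite_singular_values:
  fixes A :: "real^'p^'p"
  shows "finite {\<sigma>. 0 \<le> \<sigma> \<and> sv_space A \<sigma> \<noteq> {0}}" (is "finite ?T")
proof -
  have "\<exists>x. x \<in> sv_space A \<sigma> \<and> x \<noteq> 0" if "\<sigma> \<in> ?T" for \<sigma>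
    using that subspace_0[OF subspace_sv_space[of A \<sigma>]] by blast
  then obtain e where e: "\<And>\<sigma>. \<sigma> \<in> ?T \<Longrightarrow> e \<sigma> \<in> sv_space A \<sigma> \<and> e \<sigma> \<noteq> 0"
    by metis
  have orth: "orthogonal (e \<sigma>) (e \<tau>)" if "\<sigma> \<in> ?T" "\<tau> \<in> ?T" "\<sigma> \<noteq> \<tau>" for \<sigma> \<tau>
    using e[OF that(1)] e[OF that(2)] that by (auto intro!: sv_space_orthogonal)
  have "inj_on e ?T"
  proof (rule inj_onI, rule ccontr)
    fix \<sigma> \<tau> assume st: "\<sigma> \<in> ?T" "\<tau> \<in> ?T" "e \<sigma> = e \<tau>" "\<sigma> \<noteq> \<tau>"
    then show False using orth[of \<sigma> \<tau>] e[of \<tau>] by (simp add: orthogonal_def)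
  qed
  moreover have "pairwise orthogonal (e ` ?T)"
    using orth unfolding pairwise_def by blast
  then have "independent (e ` ?T)"
    by (rule pairwise_orthogonal_independent) (use e in force)
  then have "finite (e ` ?T)" by (rule independent_imp_finite)
  ultimately show ?thesis by (rule finite_imageD[rotated])
qed

lemma count_singular_values:
  assumes "0 \<le> \<sigma>"
  shows "count (singular_values A) \<sigma> = dim (sv_space A \<sigma>)"
proof -
  let ?T = "{\<sigma>. 0 \<le> \<sigma> \<and> sv_space A \<sigma> \<noteq> {0}}"
  have "count (singular_values A) \<sigma> = (\<Sum>\<tau>\<in>?T. if \<sigma> = \<tau> then dim (sv_space A \<tau>) else 0)"
    unfolding singular_values_def by (simp add: count_sum)
  also have "\<dots> = (if \<sigma> \<in> ?T then dim (sv_space A \<sigma>) else 0)"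
    using finite_singular_values[of A] by (simp add: sum.delta)
  also have "\<dots> = dim (sv_space A \<sigma>)" using assms by auto
  finally show ?thesis .
qed

text \<open>Jensen's inequality for each row, whose entries are weights, followed by summation over
  the rows with unit column sums. It will show that the maximum over vectors orthogonal to the
  all-ones vector is at most 1.\<close>

lemma norm_stochastic_mult_le:
  fixes A :: "real^'p^'p"
  assumes nn: "\<And>i j. 0 \<le> A $ i $ j" and row: "\<And>i. (\<Sum>j\<in>UNIV. A $ i $ j) = 1"
    and col: "\<And>j. (\<Sum>i\<in>UNIV. A $ i $ j) = 1"
  shows "norm (A *v w) \<le> norm w"
proof -
  have jensen: "((A *v w) $ i)\<^sup>2 \<le> (\<Sum>j\<in>UNIV. A $ i $ j * (w $ j)\<^sup>2)" for i
  proof -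
    define m where "m = (A *v w) $ i"
    have m: "m = (\<Sum>j\<in>UNIV. A $ i $ j * w $ j)" by (simp add: m_def matrix_vector_mult_def)
    have "0 \<le> (\<Sum>j\<in>UNIV. A $ i $ j * (w $ j - m)\<^sup>2)"
      by (intro sum_nonneg mult_nonneg_nonneg nn) auto
    also have "\<dots> = (\<Sum>j\<in>UNIV. A $ i $ j * (w $ j)\<^sup>2 - 2 * m * (A $ i $ j * w $ j) + m\<^sup>2 * A $ i $ j)"
      by (intro sum.cong) (auto simp: power2_eq_square algebra_simps)
    also have "\<dots> = (\<Sum>j\<in>UNIV. A $ i $ j * (w $ j)\<^sup>2) - 2 * m * m + m\<^sup>2"
      by (simp add: sum.distrib sum_subtractf sum_distrib_left[symmetric] m[symmetric] row)
    finally show ?thesis by (simp add: m_def[symmetric] power2_eq_square)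
  qed
  have "(norm (A *v w))\<^sup>2 = (\<Sum>i\<in>UNIV. ((A *v w) $ i)\<^sup>2)"
    unfolding power2_norm_eq_inner inner_vec_def by (simp add: power2_eq_square)
  also have "\<dots> \<le> (\<Sum>i\<in>UNIV. \<Sum>j\<in>UNIV. A $ i $ j * (w $ j)\<^sup>2)"
    by (intro sum_mono jensen)
  also have "\<dots> = (\<Sum>j\<in>UNIV. (\<Sum>i\<in>UNIV. A $ i $ j) * (w $ j)\<^sup>2)"
    by (subst sum.swap) (simp add: sum_distrib_right)
  also have "\<dots> = (norm w)\<^sup>2"
    unfolding power2_norm_eq_inner inner_vec_def by (simp add: col power2_eq_square)
  finally show ?thesis by (rule power2_le_imp_le) simp
qed

text \<open>
  A maximiser of \<open>norm (A *v v)\<close> over the unit vectors orthogonal to the all-ones vector is an eigenvector of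
  \<open>A\<^sup>T A\<close>.  Together with the all-ones vector, whose singular value is 1, it shows that two singular values are at
  least the maximum.
\<close>

lemma second_singular_value_bound:
  fixes A :: "real^'p^'p" and w :: "real^'p"
  assumes nn: "\<And>i j. 0 \<le> A $ i $ j" and row: "\<And>i. (\<Sum>j\<in>UNIV. A $ i $ j) = 1"
    and col: "\<And>j. (\<Sum>i\<in>UNIV. A $ i $ j) = 1"
    and w: "(\<Sum>i\<in>UNIV. w $ i) = 0" "w \<noteq> 0"
  shows "norm (A *v w) \<le> second_singular_value A * norm w"
proof -
  define one :: "real^'p" where "one = (\<chi> i. 1)"
  define V where "V = {w. w \<bullet> one = 0}"
  define M where "M = transpose A ** A"
  have A1: "A *v one = one" by (simp add: one_def matrix_vector_mult_def row)
  have T1: "transpose A *v one = one" by (simp add: one_def matrix_vector_mult_def transpose_def col del: transpose_matrix_vector)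
  have M1: "M *v one = one" by (simp add: M_def A1 T1 del: transpose_matrix_vector flip: matrix_vector_mul_assoc)
  have one0: "one \<noteq> 0" by (simp add: one_def vec_eq_iff)
  have wV: "w \<in> V" using w by (simp add: V_def one_def inner_vec_def)
  have V: "subspace V" by (auto simp: V_def subspace_def inner_add_left)
  have "compact (V \<inter> sphere 0 1)"
    using closed_subspace[OF V] by (intro closed_Int_compact) auto
  moreover have "w /\<^sub>R norm w \<in> V \<inter> sphere 0 1"
    using wV w V by (auto simp: subspace_scale)
  moreover have "continuous_on (V \<inter> sphere 0 1) (\<lambda>y. norm (A *v y))"
    by (intro continuous_on_norm linear_continuous_on matrix_vector_mul_bounded_linear)
  ultimately obtain v where "v \<in> V \<inter> sphere 0 1" "\<forall>y\<in>V \<inter> sphere 0 1. norm (A *v y) \<le> norm (A *v v)"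
    using continuous_attains_sup[of "V \<inter> sphere 0 1" "\<lambda>y. norm (A *v y)"] by blast
  then have v: "v \<in> V" "norm v = 1"
    and vmax: "\<And>y. y \<in> V \<Longrightarrow> norm y = 1 \<Longrightarrow> norm (A *v y) \<le> norm (A *v v)"
    by auto
  define \<tau> where "\<tau> = norm (A *v v)"
  have \<tau>: "0 \<le> \<tau>" "\<tau> \<le> 1"
    using norm_stochastic_mult_le[OF nn row col, of v] v by (auto simp: \<tau>_def)
  have bound: "norm (A *v y) \<le> \<tau> * norm y" if "y \<in> V" for y
  proof (cases "y = 0")
    case False
    have "norm (A *v (y /\<^sub>R norm y)) \<le> \<tau>"
      unfolding \<tau>_def using that V False by (intro vmax) (auto simp: subspace_scale)
    then show ?thesis using False by (simp add: matrix_vector_mult_scaleR field_simps)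
  qed simp
  \<comment> \<open>The estimate \<open>bound\<close> is an equality at \<open>v\<close>. Squared
    along \<open>v + s y\<close> it says that a quadratic in \<open>s\<close> without constant term
    is nonnegative, so its linear coefficient vanishes.\<close>
  have crit: "(M *v v - \<tau>\<^sup>2 *\<^sub>R v) \<bullet> y = 0" if y: "y \<in> V" for y
  proof -
    have "0 \<le> s * (2 * (\<tau>\<^sup>2 * (v \<bullet> y) - (A *v v) \<bullet> (A *v y))) + s\<^sup>2 * (\<tau>\<^sup>2 * (y \<bullet> y) - (A *v y) \<bullet> (A *v y))" for s
    proof -
      have "norm (A *v (v + s *\<^sub>R y)) \<le> \<tau> * norm (v + s *\<^sub>R y)"
        using y v V by (intro bound) (auto simp: subspace_add subspace_scale)
      then have "(norm (A *v (v + s *\<^sub>R y)))\<^sup>2 \<le> (\<tau> * norm (v + s *\<^sub>R y))\<^sup>2"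
        by (intro power_mono) auto
      then have "(A *v v + s *\<^sub>R (A *v y)) \<bullet> (A *v v + s *\<^sub>R (A *v y)) \<le> \<tau>\<^sup>2 * ((v + s *\<^sub>R y) \<bullet> (v + s *\<^sub>R y))"
        by (simp add: power_mult_distrib power2_norm_eq_inner matrix_vector_right_distrib matrix_vector_mult_scaleR)
      also have "\<tau>\<^sup>2 * ((v + s *\<^sub>R y) \<bullet> (v + s *\<^sub>R y)) = \<tau>\<^sup>2 + s * (2 * \<tau>\<^sup>2 * (v \<bullet> y)) + s\<^sup>2 * (\<tau>\<^sup>2 * (y \<bullet> y))"
        using v by (simp add: inner_add_left inner_add_right inner_commute algebra_simps power2_eq_square norm_eq_1)
      finally show ?thesis
        using power2_norm_eq_inner[of "A *v v", folded \<tau>_def, symmetric]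
        by (simp add: inner_add_left inner_add_right inner_commute algebra_simps power2_eq_square)
    qed
    then have "2 * (\<tau>\<^sup>2 * (v \<bullet> y) - (A *v v) \<bullet> (A *v y)) = 0" by (rule linear_coeff_zero)
    then show ?thesis by (simp add: inner_gram M_def inner_diff_left)
  qed
  \<comment> \<open>The residual is orthogonal to \<open>V\<close>. As \<open>M\<close> is
    self-adjoint and fixes \<open>one\<close>, the residual also lies in \<open>V\<close>, so it is
    orthogonal to itself.\<close>
  have "M *v v - \<tau>\<^sup>2 *\<^sub>R v \<in> V"
  proof -
    have "(M *v v) \<bullet> one = v \<bullet> (M *v one)" unfolding M_def by (rule gram_self_adjoint)
    then show ?thesis using v by (simp add: V_def M1 inner_diff_left)
  qed
  then have "M *v v = \<tau>\<^sup>2 *\<^sub>R v" using crit[of "M *v v - \<tau>\<^sup>2 *\<^sub>R v"] by simp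
  then have v\<tau>: "v \<in> sv_space A \<tau>" by (simp add: sv_space_def M_def)
  have o1: "one \<in> sv_space A 1" using M1 by (simp add: sv_space_def M_def)
  have v0: "v \<noteq> 0" using v by auto
  have d1: "1 \<le> dim (sv_space A \<sigma>)" if "x \<in> sv_space A \<sigma>" "x \<noteq> 0" for x \<sigma>
    using that by (metis dim_eq_0 le_0_eq less_one not_le singletonD subsetD)
  have "{#\<tau>, 1#} \<subseteq># singular_values A"
  \<comment> \<open>If the two singular values coincide, 1 must be counted twice, which requires the
    two eigenvectors to be independent.\<close>
  proof (cases "\<tau> = 1")
    case True
    have "independent {v, one}"
      using v v0 one0 by (intro pairwise_orthogonal_independent)
        (auto simp: pairwise_def orthogonal_def V_def inner_commute)
    then have "card {v, one} \<le> dim (sv_space A 1)"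
      using v\<tau> o1 True by (intro independent_card_le_dim) auto
    moreover have "v \<noteq> one" using v one0 by (auto simp: V_def)
    ultimately have "2 \<le> count (singular_values A) 1" by (simp add: count_singular_values)
    then show ?thesis using True by (auto simp: subseteq_mset_def)
  next
    case False
    then show ?thesis
      using d1[OF v\<tau> v0] d1[OF o1 one0] \<tau>
      by (auto simp: subseteq_mset_def count_singular_values)
  qed
  then have "\<tau> \<le> second_singular_value A"
    unfolding second_singular_value_def using \<tau> by (intro second_of_sorted_ge[where b = 1]) auto
  then show ?thesis
    using bound[OF wV] mult_right_mono[of \<tau> "second_singular_value A" "norm w"] by simp
qed

text \<open>Vectors with coordinate sum zero describe disagreement among the players. For a single
  player such a vector is 0; otherwise the bound on the second singular value applies.\<close>

lemma comm_graph_contraction: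
  fixes A :: "real^'p^'p" and w :: "real^'p"
  assumes g: "comm_graph E A \<sigma>'" and w: "(\<Sum>i\<in>UNIV. w $ i) = 0"
  shows "norm (A *v w) \<le> \<sigma>' * norm w"
proof (cases "w = 0")
  case False
  have "CARD('p) \<noteq> 1"
  proof
    assume "CARD('p) = 1"
    then obtain a where "(UNIV :: 'p set) = {a}" by (auto simp: card_1_singleton_iff)
    then have "sum (($) w) {a} = 0" using w by metis
    then have "w $ a = 0" by simp
    moreover have "i = a" for i using \<open>UNIV = {a}\<close> by auto
    ultimately have "w = 0" by (metis vec_eq_iff zero_index)
    then show False using False by simp
  qed
  then have "2 \<le> CARD('p)" using zero_less_card_finite[where 'a='p] by linarith
  then have le: "second_singular_value A \<le> \<sigma>'" using g by (simp add: comm_graph_def)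
  have "0 \<le> A $ i $ j" for i j
    using g by (cases "(j, i) \<in> E \<or> i = j") (auto simp: comm_graph_def dest: spec[of _ i] intro: less_imp_le)
  then have "norm (A *v w) \<le> second_singular_value A * norm w"
    using g w False by (intro second_singular_value_bound) (auto simp: comm_graph_def)
  also have "\<dots> \<le> \<sigma>' * norm w" using le by (intro mult_right_mono) auto
  finally show ?thesis .
qed simp

section \<open>The inner routine\<close>

lemma quadratic_form_le_onorm:
  fixes Q :: "real^'n^'n"
  shows "v \<bullet> (Q *v v) \<le> onorm ((*v) Q) * (norm v)\<^sup>2"
proof -
  have "v \<bullet> (Q *v v) \<le> norm v * norm (Q *v v)" by (rule norm_cauchy_schwarz)
  also have "\<dots> \<le> norm v * (onorm ((*v) Q) * norm v)"
    by (intro mult_left_mono onorm matrix_vector_mul_bounded_linear) auto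
  finally show ?thesis by (simp add: power2_eq_square mult_ac)
qed

lemma Q_matrix_quadratic_form:
  assumes N: "0 < N"
  shows "(1 - 2 * \<gamma> * \<mu> / N + \<gamma>\<^sup>2 * l\<^sup>2 / N) * p\<^sup>2
      + 2 * ((\<gamma> * (l + l') + \<gamma>\<^sup>2 * l * l') / sqrt N * \<sigma>') * p * r
      + (1 + 2 * \<gamma> * l + \<gamma>\<^sup>2 * l\<^sup>2) * \<sigma>'\<^sup>2 * r\<^sup>2
    \<le> onorm ((*v) (Q_matrix N \<mu> l l' \<sigma>' \<gamma>)) * (p\<^sup>2 + r\<^sup>2)"
proof -
  define v :: "real^2" where "v = vector [p, r]"
  have "v \<bullet> (Q_matrix N \<mu> l l' \<sigma>' \<gamma> *v v) \<le> onorm ((*v) (Q_matrix N \<mu> l l' \<sigma>' \<gamma>)) * (norm v)\<^sup>2"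
    by (rule quadratic_form_le_onorm)
  moreover have "(norm v)\<^sup>2 = p\<^sup>2 + r\<^sup>2"
    unfolding power2_norm_eq_inner by (simp add: v_def inner_vec_def sum_2 vector_2 power2_eq_square)
  moreover have "v \<bullet> (Q_matrix N \<mu> l l' \<sigma>' \<gamma> *v v) = (1 - 2 * \<gamma> * \<mu> / N + \<gamma>\<^sup>2 * l\<^sup>2 / N) * p\<^sup>2
      + 2 * ((\<gamma> * (l + l') + \<gamma>\<^sup>2 * l * l') / sqrt N * \<sigma>') * p * r
      + (1 + 2 * \<gamma> * l + \<gamma>\<^sup>2 * l\<^sup>2) * \<sigma>'\<^sup>2 * r\<^sup>2"
  proof -
    have gen: "v \<bullet> ((vector [vector [a, b], vector [b, d]] :: real^2^2) *v v) = a * p\<^sup>2 + 2 * b * p * r + d * r\<^sup>2" for a b d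
      by (simp add: v_def inner_vec_def matrix_vector_mult_def sum_2 vector_2 power2_eq_square algebra_simps)
    show ?thesis unfolding Q_matrix_def Let_def gen by simp
  qed
  ultimately show ?thesis by simp
qed

text \<open>
  \<open>P\<close> is the distance of the mean estimate to the equilibrium, \<open>r\<close> and \<open>R\<close> are the deviations from the mean
  before and after mixing; \<open>Q_matrix\<close> acts on the pair \<open>(sqrt N * P, r)\<close>.
\<close>

lemma step_bound_quadratic_form:
  fixes N \<mu> l l' \<sigma>' \<gamma> P R r :: real
  assumes N: "1 \<le> N" and \<gamma>: "0 < \<gamma>" and l': "0 \<le> l'" "l' \<le> l" and \<sigma>': "0 \<le> \<sigma>'"
    and P: "0 \<le> P" and R: "0 \<le> R" "R \<le> \<sigma>' * r"
  shows "N * P\<^sup>2 + R\<^sup>2 - 2 * \<gamma> * (\<mu> * P\<^sup>2 - (l + l') * P * R - l' * R\<^sup>2) + \<gamma>\<^sup>2 * (l * P + l' * R)\<^sup>2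
    \<le> onorm ((*v) (Q_matrix N \<mu> l l' \<sigma>' \<gamma>)) * (N * P\<^sup>2 + r\<^sup>2)"
proof -
  define p where "p = sqrt N * P"
  have p2: "p\<^sup>2 = N * P\<^sup>2" using N by (simp add: p_def power_mult_distrib)
  have "N * P\<^sup>2 + R\<^sup>2 - 2 * \<gamma> * (\<mu> * P\<^sup>2 - (l + l') * P * R - l' * R\<^sup>2) + \<gamma>\<^sup>2 * (l * P + l' * R)\<^sup>2
    = (N - 2 * \<gamma> * \<mu> + \<gamma>\<^sup>2 * l\<^sup>2) * P\<^sup>2 + 2 * (\<gamma> * (l + l') + \<gamma>\<^sup>2 * l * l') * P * R
      + (1 + 2 * \<gamma> * l' + \<gamma>\<^sup>2 * l'\<^sup>2) * R\<^sup>2"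
    by (simp add: power2_eq_square algebra_simps)
  \<comment> \<open>Only terms with nonnegative coefficients are enlarged: \<open>R\<close> becomes
    \<open>\<sigma>' * r\<close>, and \<open>l'\<close> becomes \<open>l\<close> in the last
    coefficient. The coefficient of \<open>P\<^sup>2\<close>, whose sign is not known here, stays as
    it is.\<close>
  also have "\<dots> \<le> (N - 2 * \<gamma> * \<mu> + \<gamma>\<^sup>2 * l\<^sup>2) * P\<^sup>2 + 2 * (\<gamma> * (l + l') + \<gamma>\<^sup>2 * l * l') * P * (\<sigma>' * r)
      + (1 + 2 * \<gamma> * l + \<gamma>\<^sup>2 * l\<^sup>2) * (\<sigma>' * r)\<^sup>2"
    using assms by (intro add_mono order_refl mult_mono mult_left_mono power_mono add_nonneg_nonneg mult_nonneg_nonneg) auto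
  also have "\<dots> = (1 - 2 * \<gamma> * \<mu> / N + \<gamma>\<^sup>2 * l\<^sup>2 / N) * p\<^sup>2
      + 2 * ((\<gamma> * (l + l') + \<gamma>\<^sup>2 * l * l') / sqrt N * \<sigma>') * p * r
      + (1 + 2 * \<gamma> * l + \<gamma>\<^sup>2 * l\<^sup>2) * \<sigma>'\<^sup>2 * r\<^sup>2"
  proof -
    have "(1 - 2 * \<gamma> * \<mu> / N + \<gamma>\<^sup>2 * l\<^sup>2 / N) * p\<^sup>2 = (N - 2 * \<gamma> * \<mu> + \<gamma>\<^sup>2 * l\<^sup>2) * P\<^sup>2"
      unfolding p2 using N by (simp add: field_simps)
    moreover have "2 * ((\<gamma> * (l + l') + \<gamma>\<^sup>2 * l * l') / sqrt N * \<sigma>') * p * r = 2 * (\<gamma> * (l + l') + \<gamma>\<^sup>2 * l * l') * P * (\<sigma>' * r)"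
      unfolding p_def using N by simp
    ultimately show ?thesis by (simp add: power_mult_distrib)
  qed
  also have "\<dots> \<le> onorm ((*v) (Q_matrix N \<mu> l l' \<sigma>' \<gamma>)) * (p\<^sup>2 + r\<^sup>2)"
    using N by (intro Q_matrix_quadratic_form) auto
  finally show ?thesis unfolding p2 .
qed

section \<open>Mean and deviation of the players' estimates\<close>

definition mix :: "real^'p^'p \<Rightarrow> real^'d^'p \<Rightarrow> real^'d^'p" where
  "mix A \<xx> = (\<chi> i. \<Sum>j\<in>UNIV. A $ i $ j *\<^sub>R \<xx> $ j)"

definition avg :: "real^'d^'p \<Rightarrow> real^'d" where
  "avg \<xx> = (\<Sum>i\<in>UNIV. \<xx> $ i) /\<^sub>R real CARD('p)"

definition const_vec :: "'a \<Rightarrow> 'a^'p" where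
  "const_vec x = (\<chi> i. x)"

lemma const_vec_nth [simp]: "const_vec x $ i = x"
  by (simp add: const_vec_def)

lemma sum_minus_avg:
  fixes \<xx> :: "real^'d^'p"
  shows "(\<Sum>i\<in>UNIV. \<xx> $ i - avg \<xx>) = 0"
  by (simp add: sum_subtractf avg_def sum_constant_scaleR del: sum_constant)

text \<open>Pythagoras: the deviations from the mean sum to zero, so the cross term
  disappears.\<close>

lemma norm_avg_decomposition:
  fixes \<xx> :: "real^'d^'p"
  shows "(norm (\<xx> - const_vec z))\<^sup>2 = real CARD('p) * (norm (avg \<xx> - z))\<^sup>2 + (norm (\<xx> - const_vec (avg \<xx>)))\<^sup>2"
proof -
  have "(norm (\<xx> - const_vec z))\<^sup>2
    = (\<Sum>i\<in>UNIV. (norm (avg \<xx> - z))\<^sup>2 + (norm (\<xx> $ i - avg \<xx>))\<^sup>2 + 2 * ((\<xx> $ i - avg \<xx>) \<bullet> (avg \<xx> - z)))"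
    unfolding power2_norm_vec[of "\<xx> - const_vec z"]
    by (intro sum.cong refl, simp only: power2_norm_eq_inner)
      (simp add: inner_diff_left inner_diff_right inner_commute algebra_simps)
  also have "\<dots> = real CARD('p) * (norm (avg \<xx> - z))\<^sup>2 + (norm (\<xx> - const_vec (avg \<xx>)))\<^sup>2
     + 2 * ((\<Sum>i\<in>UNIV. \<xx> $ i - avg \<xx>) \<bullet> (avg \<xx> - z))"
    unfolding power2_norm_vec[of "\<xx> - const_vec (avg \<xx>)"]
    by (simp add: sum.distrib inner_sum_left flip: sum_distrib_left)
  finally show ?thesis by (simp add: sum_minus_avg)
qed

lemma avg_mix:
  fixes \<xx> :: "real^'d^'p"
  assumes "\<And>j. (\<Sum>i\<in>UNIV. A $ i $ j) = 1"
  shows "avg (mix A \<xx>) = avg \<xx>"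
proof -
  have "(\<Sum>i\<in>UNIV. mix A \<xx> $ i) = (\<Sum>j\<in>UNIV. \<Sum>i\<in>UNIV. A $ i $ j *\<^sub>R \<xx> $ j)"
    unfolding mix_def by (simp, subst sum.swap, simp)
  also have "\<dots> = (\<Sum>j\<in>UNIV. \<xx> $ j)"
    by (simp add: scaleR_sum_left[symmetric] assms)
  finally show ?thesis by (simp add: avg_def)
qed

text \<open>For each strategy coordinate the estimates of all players form one vector. Subtracting
  the mean makes its sum zero, so the scalar contraction applies, and squared norms add up over the
  coordinates. Unit row sums let mixing commute with subtracting the mean.\<close>

lemma mix_contraction:
  fixes \<xx> :: "real^'d^'p"
  assumes g: "comm_graph E A \<sigma>'"
  shows "norm (mix A \<xx> - const_vec (avg \<xx>)) \<le> \<sigma>' * norm (\<xx> - const_vec (avg \<xx>))"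
proof (rule power2_le_imp_le)
  define y where "y c = (\<chi> i. \<xx> $ i $ c - avg \<xx> $ c)" for c
  have row: "(\<Sum>j\<in>UNIV. A $ i $ j) = 1" for i using g by (simp add: comm_graph_def)
  have \<sigma>': "0 < \<sigma>'" using g by (simp add: comm_graph_def)
  have nrm: "(norm (\<yy> :: real^'d^'p))\<^sup>2 = (\<Sum>c\<in>UNIV. (norm (\<chi> i. \<yy> $ i $ c))\<^sup>2)" for \<yy>
    unfolding power2_norm_eq_inner inner_vec_def by (simp add: sum.swap[of _ "UNIV :: 'd set"])
  have Ay: "(\<chi> i. (mix A \<xx> - const_vec (avg \<xx>)) $ i $ c) = A *v y c" for c
    by (simp add: vec_eq_iff mix_def y_def matrix_vector_mult_def right_diff_distrib sum_subtractf
        sum_distrib_right[symmetric] row)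
  have "(norm (mix A \<xx> - const_vec (avg \<xx>)))\<^sup>2 = (\<Sum>c\<in>UNIV. (norm (A *v y c))\<^sup>2)"
    unfolding nrm Ay ..
  also have "\<dots> \<le> (\<Sum>c\<in>UNIV. (\<sigma>' * norm (y c))\<^sup>2)"
  proof (intro sum_mono power_mono comm_graph_contraction[OF g])
    fix c
    show "(\<Sum>i\<in>UNIV. y c $ i) = 0"
      using arg_cong[OF sum_minus_avg[of \<xx>], of "\<lambda>v. v $ c"] by (simp add: y_def)
  qed simp
  also have "\<dots> = (\<sigma>' * norm (\<xx> - const_vec (avg \<xx>)))\<^sup>2"
    by (simp add: power_mult_distrib nrm[of "\<xx> - const_vec (avg \<xx>)"] sum_distrib_left y_def)
  finally show "(norm (mix A \<xx> - const_vec (avg \<xx>)))\<^sup>2 \<le> (\<sigma>' * norm (\<xx> - const_vec (avg \<xx>)))\<^sup>2" .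
  show "0 \<le> \<sigma>' * norm (\<xx> - const_vec (avg \<xx>))" using \<sigma>' by simp
qed

context strongly_monotone_game
begin

lemma inner_state_Suc_nth:
  "inner_state own X f A \<gamma> \<xx>\<^sub>0 \<theta> (Suc t) $ i
    = (let y = mix A (inner_state own X f A \<gamma> \<xx>\<^sub>0 \<theta> t) $ i
       in upd_block own i (closest_point (X i) (block own i y - \<gamma> *\<^sub>R pgrad own f i y \<theta>)) y)"
  by (simp add: mix_def)

text \<open>The equilibrium is fixed by the same projected step, so nonexpansiveness applies on
  block \<open>i\<close>. Outside this block both sides agree exactly, since \<open>pgrad\<close>
  vanishes there. The projection is thereby replaced by a plain gradient step.\<close>

lemma projected_step_contraction:
  assumes \<gamma>: "0 < \<gamma>" and z: "is_nash own X f \<theta> z"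
  shows "(norm (upd_block own i (closest_point (X i) (block own i y - \<gamma> *\<^sub>R pgrad own f i y \<theta>)) y - z))\<^sup>2
    \<le> (norm (y - z - \<gamma> *\<^sub>R (pgrad own f i y \<theta> - pgrad own f i z \<theta>)))\<^sup>2"
proof -
  define cp where "cp y = closest_point (X i) (block own i y - \<gamma> *\<^sub>R pgrad own f i y \<theta>)" for y
  define w where "w = y - z - \<gamma> *\<^sub>R (pgrad own f i y \<theta> - pgrad own f i z \<theta>)"
  have cpz: "cp z = block own i z"
    using z unfolding cp_def is_nash_iff_fixed_point[OF \<gamma>] by simp
  have bcp: "block own i (cp y) = cp y" for y
    unfolding cp_def by (intro block_X closest_point_in_set X_props)
  have split: "(norm v)\<^sup>2 = (norm (block own i v))\<^sup>2 + (norm (v - block own i v))\<^sup>2" for v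
  proof -
    have "block own i v \<bullet> (v - block own i v) = 0"
      by (simp add: inner_block block_diff)
    then show ?thesis
      using norm_add_Pythagorean[of "block own i v" "v - block own i v"] by (simp add: orthogonal_def)
  qed
  have "norm (block own i (upd_block own i (cp y) y - z)) = norm (cp y - cp z)"
    by (simp add: block_diff bcp cpz)
  also have "\<dots> \<le> norm ((block own i y - \<gamma> *\<^sub>R pgrad own f i y \<theta>) - (block own i z - \<gamma> *\<^sub>R pgrad own f i z \<theta>))"
    unfolding cp_def using closest_point_lipschitz[OF X_props(4,3,1)] by (simp add: dist_norm)
  also have "(block own i y - \<gamma> *\<^sub>R pgrad own f i y \<theta>) - (block own i z - \<gamma> *\<^sub>R pgrad own f i z \<theta>) = block own i w"
    unfolding w_def block_diff block_scaleR block_pgrad by (simp add: algebra_simps)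
  finally have a: "norm (block own i (upd_block own i (cp y) y - z)) \<le> norm (block own i w)" .
  have p0: "pgrad own f i x \<theta> $ c = 0" if "own c \<noteq> i" for x c
    using block_pgrad[of i x \<theta>] that by (metis block_nth)
  have b: "upd_block own i (cp y) y - z - block own i (upd_block own i (cp y) y - z) = w - block own i w"
    by (auto simp: vec_eq_iff block_nth upd_block_nth w_def p0)
  show ?thesis
    unfolding cp_def[symmetric] w_def[symmetric]
      split[of w] split[of "upd_block own i (cp y) y - z"] b
    using a by (intro add_mono power_mono) auto
qed

text \<open>The glued gradient difference splits into \<open>g1\<close>, between mean estimate and
  equilibrium, and \<open>g2\<close>, between the stacked estimates and their mean. Strong
  monotonicity concerns single profiles and is applied to \<open>g1\<close> against
  \<open>m - z\<close>; the other three products are bounded by Cauchy-Schwarz.\<close>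

lemma mixed_step_bound:
  fixes \<yy> :: "real^'d^'p"
  assumes \<gamma>: "0 < \<gamma>" and z: "is_nash own X f \<theta> z" and l': "0 \<le> l'"
    and lip: "\<And>\<theta> \<xx> \<xx>'. norm (ext_pseudo_gradient own f \<xx> \<theta> - ext_pseudo_gradient own f \<xx>' \<theta>)
                          \<le> l' * norm (\<xx> - \<xx>')"
  defines "P \<equiv> norm (avg \<yy> - z)" and "R \<equiv> norm (\<yy> - const_vec (avg \<yy>))"
  shows "(\<Sum>i\<in>UNIV. (norm (\<yy> $ i - z - \<gamma> *\<^sub>R (pgrad own f i (\<yy> $ i) \<theta> - pgrad own f i z \<theta>)))\<^sup>2)
    \<le> real CARD('p) * P\<^sup>2 + R\<^sup>2 - 2 * \<gamma> * (\<mu> * P\<^sup>2 - (l + l') * P * R - l' * R\<^sup>2) + \<gamma>\<^sup>2 * (l * P + l' * R)\<^sup>2"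
proof -
  define m where "m = avg \<yy>"
  define g where "g i = pgrad own f i (\<yy> $ i) \<theta> - pgrad own f i z \<theta>" for i
  define g1 where "g1 = pseudo_gradient own f m \<theta> - pseudo_gradient own f z \<theta>"
  define g2 where "g2 = ext_pseudo_gradient own f \<yy> \<theta> - ext_pseudo_gradient own f (const_vec m) \<theta>"
  define w where "w = glue own (\<lambda>i. \<yy> $ i - m)"
  have ext_const: "ext_pseudo_gradient own f (const_vec x) \<theta> = pseudo_gradient own f x \<theta>" for x
    by (simp add: ext_pseudo_gradient_eq_glue pseudo_gradient_eq_glue)
  have P: "P = norm (m - z)" and R: "R = norm (\<yy> - const_vec m)" by (simp_all add: P_def R_def m_def)
  have G: "glue own g = g1 + g2"
    by (simp add: g1_def g2_def ext_const) (simp add: g_def[abs_def] ext_pseudo_gradient_eq_glue pseudo_gradient_eq_glue glue_diff)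
  have bg: "block own i (g i) = g i" for i by (simp add: g_def block_diff)
  have g1: "norm g1 \<le> l * P" unfolding g1_def P by (rule pseudo_gradient_props)
  have g1': "\<mu> * P\<^sup>2 \<le> g1 \<bullet> (m - z)" unfolding g1_def P by (rule pseudo_gradient_props)
  have g2: "norm g2 \<le> l' * R" unfolding g2_def R by (rule lip)
  have w: "norm w \<le> R"
  proof (rule power2_le_imp_le)
    show "(norm w)\<^sup>2 \<le> R\<^sup>2"
      unfolding w_def norm_glue R power2_norm_vec[of "\<yy> - const_vec m"]
      by (intro sum_mono power_mono) (auto intro: norm_block_le)
  qed (simp add: R)
  \<comment> \<open>Each \<open>g i\<close> is supported on block \<open>i\<close>, so only the
    players' own blocks enter and the sum is an inner product of two glued profiles.\<close>
  have S: "(\<Sum>i\<in>UNIV. g i \<bullet> (\<yy> $ i - z)) = (g1 + g2) \<bullet> ((m - z) + w)"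
  proof -
    have "(\<Sum>i\<in>UNIV. g i \<bullet> (\<yy> $ i - z)) = (\<Sum>i\<in>UNIV. block own i (g i) \<bullet> (\<yy> $ i - z))" by (simp add: bg)
    also have "\<dots> = glue own g \<bullet> glue own (\<lambda>i. \<yy> $ i - z)"
      unfolding sum_block by (simp add: inner_vec_def glue_nth)
    also have "glue own (\<lambda>i. \<yy> $ i - z) = (m - z) + w" by (simp add: w_def vec_eq_iff glue_nth)
    finally show ?thesis by (simp add: G)
  qed
  have P0: "0 \<le> P" "0 \<le> R" by (simp_all add: P R)
  have l: "0 < l" by (rule pseudo_gradient_props)
  have "\<bar>g1 \<bullet> w\<bar> \<le> (l * P) * R"
    by (rule order_trans[OF Cauchy_Schwarz_ineq2]) (use g1 w P0 l in \<open>intro mult_mono, auto\<close>)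
  moreover have "\<bar>g2 \<bullet> (m - z)\<bar> \<le> (l' * R) * P"
    by (rule order_trans[OF Cauchy_Schwarz_ineq2]) (use g2 P0 l' in \<open>intro mult_mono, auto simp: P\<close>)
  moreover have "\<bar>g2 \<bullet> w\<bar> \<le> (l' * R) * R"
    by (rule order_trans[OF Cauchy_Schwarz_ineq2]) (use g2 w P0 l' in \<open>intro mult_mono, auto\<close>)
  ultimately have S': "\<mu> * P\<^sup>2 - (l + l') * P * R - l' * R\<^sup>2 \<le> (\<Sum>i\<in>UNIV. g i \<bullet> (\<yy> $ i - z))"
    unfolding S inner_add_left inner_add_right using g1' by (simp add: algebra_simps power2_eq_square)
  have "norm (glue own g) \<le> l * P + l' * R"
    unfolding G by (rule order_trans[OF norm_triangle_ineq add_mono[OF g1 g2]])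
  then have "(norm (glue own g))\<^sup>2 \<le> (l * P + l' * R)\<^sup>2" by (intro power_mono) auto
  then have g_sq: "(\<Sum>i\<in>UNIV. (norm (g i))\<^sup>2) \<le> (l * P + l' * R)\<^sup>2" by (simp add: norm_glue bg)
  have "(\<Sum>i\<in>UNIV. (norm (\<yy> $ i - z - \<gamma> *\<^sub>R g i))\<^sup>2)
    = (\<Sum>i\<in>UNIV. (norm (\<yy> $ i - z))\<^sup>2 - 2 * \<gamma> * (g i \<bullet> (\<yy> $ i - z)) + \<gamma>\<^sup>2 * (norm (g i))\<^sup>2)"
    by (intro sum.cong refl, simp only: power2_norm_eq_inner)
      (simp add: inner_diff_left inner_diff_right inner_commute algebra_simps power2_eq_square)
  also have "\<dots> = (norm (\<yy> - const_vec z))\<^sup>2 - 2 * \<gamma> * (\<Sum>i\<in>UNIV. g i \<bullet> (\<yy> $ i - z)) + \<gamma>\<^sup>2 * (\<Sum>i\<in>UNIV. (norm (g i))\<^sup>2)"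
    by (simp add: sum.distrib sum_subtractf power2_norm_vec[of "\<yy> - const_vec z"] flip: sum_distrib_left)
  also have "\<dots> \<le> (norm (\<yy> - const_vec z))\<^sup>2 - 2 * \<gamma> * (\<mu> * P\<^sup>2 - (l + l') * P * R - l' * R\<^sup>2) + \<gamma>\<^sup>2 * (l * P + l' * R)\<^sup>2"
    using S' g_sq \<gamma> by (intro add_mono diff_mono mult_left_mono) auto
  finally show ?thesis
    unfolding norm_avg_decomposition[of \<yy> z] g_def P_def R_def .
qed

text \<open>Mixing keeps the mean and shrinks the deviation by \<open>\<sigma>'\<close>, so the
  estimate for the mixed state can be expressed by the mean and deviation of the state before
  mixing, which together give back its full distance.\<close>

lemma inner_state_contraction:
  assumes graph: "comm_graph E A \<sigma>'" and l': "0 \<le> l'" "l' \<le> l" and \<gamma>: "0 < \<gamma>"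
    and lip: "\<And>\<theta> \<xx> \<xx>'. norm (ext_pseudo_gradient own f \<xx> \<theta> - ext_pseudo_gradient own f \<xx>' \<theta>)
                          \<le> l' * norm (\<xx> - \<xx>')"
    and z: "is_nash own X f \<theta> z"
  defines "q \<equiv> onorm ((*v) (Q_matrix (real CARD('p)) \<mu> l l' \<sigma>' \<gamma>))"
  shows "(norm (inner_state own X f A \<gamma> \<xx>\<^sub>0 \<theta> (Suc t) - const_vec z))\<^sup>2
    \<le> q * (norm (inner_state own X f A \<gamma> \<xx>\<^sub>0 \<theta> t - const_vec z))\<^sup>2"
proof -
  define \<xx> where "\<xx> = inner_state own X f A \<gamma> \<xx>\<^sub>0 \<theta> t"
  define \<yy> where "\<yy> = mix A \<xx>"
  have avg: "avg \<yy> = avg \<xx>" unfolding \<yy>_def using graph by (intro avg_mix) (simp add: comm_graph_def)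
  have \<sigma>': "0 < \<sigma>'" using graph by (simp add: comm_graph_def)
  have "(norm (inner_state own X f A \<gamma> \<xx>\<^sub>0 \<theta> (Suc t) - const_vec z))\<^sup>2
    \<le> (\<Sum>i\<in>UNIV. (norm (\<yy> $ i - z - \<gamma> *\<^sub>R (pgrad own f i (\<yy> $ i) \<theta> - pgrad own f i z \<theta>)))\<^sup>2)"
    unfolding power2_norm_vec[of "_ - const_vec z"] vector_minus_component inner_state_Suc_nth Let_def
      \<xx>_def[symmetric] \<yy>_def[symmetric] const_vec_nth
    by (intro sum_mono projected_step_contraction \<gamma> z)
  also have "\<dots> \<le> real CARD('p) * (norm (avg \<yy> - z))\<^sup>2 + (norm (\<yy> - const_vec (avg \<yy>)))\<^sup>2
    - 2 * \<gamma> * (\<mu> * (norm (avg \<yy> - z))\<^sup>2 - (l + l') * norm (avg \<yy> - z) * norm (\<yy> - const_vec (avg \<yy>)) - l' * (norm (\<yy> - const_vec (avg \<yy>)))\<^sup>2)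
    + \<gamma>\<^sup>2 * (l * norm (avg \<yy> - z) + l' * norm (\<yy> - const_vec (avg \<yy>)))\<^sup>2"
    by (rule mixed_step_bound[OF \<gamma> z l'(1) lip])
  also have "\<dots> \<le> q * (real CARD('p) * (norm (avg \<yy> - z))\<^sup>2 + (norm (\<xx> - const_vec (avg \<xx>)))\<^sup>2)"
    unfolding q_def avg using mix_contraction[OF graph, of \<xx>] \<gamma> l' \<sigma>'
    by (intro step_bound_quadratic_form) (auto simp: \<yy>_def Suc_le_eq)
  also have "\<dots> = q * (norm (\<xx> - const_vec z))\<^sup>2"
    unfolding norm_avg_decomposition[of \<xx> z] avg ..
  finally show ?thesis unfolding \<xx>_def .
qed

lemma approx_nash_eq_glue: "approx_nash own X f A \<gamma> \<xx>\<^sub>0 t \<theta> = glue own (\<lambda>i. inner_state own X f A \<gamma> \<xx>\<^sub>0 \<theta> t $ i)"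
  by (simp add: approx_nash_def glue_def)

text \<open>After at least one iteration the own strategies are projections; before that they are
  the feasible initial ones.\<close>

lemma approx_nash_in_profiles:
  assumes "\<And>i. block own i (\<xx>\<^sub>0 $ i) \<in> X i"
  shows "approx_nash own X f A \<gamma> \<xx>\<^sub>0 t \<theta> \<in> profiles own X"
proof -
  have "block own i (inner_state own X f A \<gamma> \<xx>\<^sub>0 \<theta> t $ i) \<in> X i" for i
  proof (cases t)
    case (Suc t)
    have "block own i (closest_point (X i) v) \<in> X i" for v
      using closest_point_in_set[OF X_props(3,1), of i v] by (simp add: block_X)
    then show ?thesis unfolding Suc inner_state_Suc_nth Let_def block_upd_block .
  qed (use assms in simp)
  then show ?thesis by (simp add: profiles_def approx_nash_eq_glue block_glue)
qed

text \<open>Iterating the contraction leaves the squared initial distance as a factor. It is bounded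
  uniformly in \<open>\<theta>\<close> because all equilibria lie in the bounded set of profiles;
  copying a vector to every player multiplies its norm by
  \<open>sqrt (real CARD('p))\<close>.\<close>

lemma approx_nash_error:
  assumes graph: "comm_graph E A \<sigma>'" and l': "0 \<le> l'" "l' \<le> l" and \<gamma>: "0 < \<gamma>"
    and lip: "\<And>\<theta> \<xx> \<xx>'. norm (ext_pseudo_gradient own f \<xx> \<theta> - ext_pseudo_gradient own f \<xx>' \<theta>)
                          \<le> l' * norm (\<xx> - \<xx>')"
  defines "q \<equiv> onorm ((*v) (Q_matrix (real CARD('p)) \<mu> l l' \<sigma>' \<gamma>))"
  shows "\<exists>D. \<forall>\<theta> t. (norm (approx_nash own X f A \<gamma> \<xx>\<^sub>0 t \<theta> - nash own X f \<theta>))\<^sup>2 \<le> D * q ^ t"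
proof -
  obtain B where B: "\<And>x. x \<in> profiles own X \<Longrightarrow> norm x \<le> B" using profiles_bounded by blast
  define D where "D = (norm \<xx>\<^sub>0 + sqrt (real CARD('p)) * B)\<^sup>2"
  have q: "0 \<le> q" unfolding q_def by (rule onorm_pos_le[OF matrix_vector_mul_bounded_linear])
  have "(norm (approx_nash own X f A \<gamma> \<xx>\<^sub>0 t \<theta> - nash own X f \<theta>))\<^sup>2 \<le> D * q ^ t" for \<theta> t
  proof -
    define z where "z = nash own X f \<theta>"
    have z: "is_nash own X f \<theta> z" unfolding z_def by (rule is_nash_nash)
    have "(norm (approx_nash own X f A \<gamma> \<xx>\<^sub>0 t \<theta> - z))\<^sup>2
       = (norm (glue own (\<lambda>i. (inner_state own X f A \<gamma> \<xx>\<^sub>0 \<theta> t - const_vec z) $ i)))\<^sup>2"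
      using glue_diff[of own _ "\<lambda>i. z"] by (simp add: approx_nash_eq_glue)
    also have "\<dots> \<le> (norm (inner_state own X f A \<gamma> \<xx>\<^sub>0 \<theta> t - const_vec z))\<^sup>2"
      unfolding norm_glue power2_norm_vec[of "inner_state own X f A \<gamma> \<xx>\<^sub>0 \<theta> t - const_vec z"]
      by (intro sum_mono power_mono norm_block_le) simp
    also have "\<dots> \<le> D * q ^ t"
    proof (induction t)
      case 0
      have "(norm (const_vec z :: real^'d^'p))\<^sup>2 = real CARD('p) * (norm z)\<^sup>2" by (simp add: power2_norm_vec)
      then have "norm (const_vec z :: real^'d^'p) = sqrt (real CARD('p)) * norm z"
        by (metis norm_ge_zero real_sqrt_mult real_sqrt_pow2_iff real_sqrt_power real_sqrt_unique)
      also have "\<dots> \<le> sqrt (real CARD('p)) * B"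
        using B[OF nash_in_profiles[of \<theta>]] by (intro mult_left_mono) (auto simp: z_def)
      finally have "norm (\<xx>\<^sub>0 - const_vec z) \<le> norm \<xx>\<^sub>0 + sqrt (real CARD('p)) * B"
        using norm_triangle_ineq4[of \<xx>\<^sub>0 "const_vec z"] by linarith
      then show ?case by (simp add: D_def power_mono)
    next
      case (Suc t)
      have "(norm (inner_state own X f A \<gamma> \<xx>\<^sub>0 \<theta> (Suc t) - const_vec z))\<^sup>2
        \<le> q * (norm (inner_state own X f A \<gamma> \<xx>\<^sub>0 \<theta> t - const_vec z))\<^sup>2"
        unfolding q_def by (rule inner_state_contraction[OF graph l' \<gamma> lip z])
      also have "\<dots> \<le> q * (D * q ^ t)" using Suc q by (intro mult_left_mono) auto
      finally show ?case by (simp add: mult_ac)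
    qed
    finally show ?thesis unfolding z_def .
  qed
  then show ?thesis by blast
qed

end

section \<open>The smoothed objective and the two-point estimate\<close>

text \<open>Write \<open>x - y\<close> as the difference of the residuals plus the difference of the
  projections. By the obtuse angle criterion at both points these summands have nonnegative inner
  product, so neither is longer than the sum.\<close>

lemma norm_residual_closest_point_le:
  fixes S :: "'a::euclidean_space set"
  assumes S: "closed S" "S \<noteq> {}" "convex S"
  shows "norm ((x - closest_point S x) - (y - closest_point S y)) \<le> norm (x - y)"
proof (rule power2_le_imp_le)
  define a where "a = (x - closest_point S x) - (y - closest_point S y)"
  define b where "b = closest_point S x - closest_point S y"
  have S': "closest_point S z \<in> S" for z using S closest_point_in_set by blast
  have "(x - closest_point S x) \<bullet> (closest_point S y - closest_point S x) \<le> 0"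
    "(y - closest_point S y) \<bullet> (closest_point S x - closest_point S y) \<le> 0"
    using S S' by (auto intro: closest_point_dot)
  then have "0 \<le> a \<bullet> b" by (simp add: a_def b_def inner_diff_left inner_diff_right inner_commute)
  moreover have "x - y = a + b" by (simp add: a_def b_def)
  ultimately show "(norm ((x - closest_point S x) - (y - closest_point S y)))\<^sup>2 \<le> (norm (x - y))\<^sup>2"
    unfolding a_def[symmetric] by (simp add: power2_norm_eq_inner inner_add_left inner_add_right inner_commute)
qed simp

lemma GDERIV_sum:
  assumes "\<And>i. i \<in> I \<Longrightarrow> GDERIV (f i) x :> D i"
  shows "GDERIV (\<lambda>x. \<Sum>i\<in>I. f i x) x :> (\<Sum>i\<in>I. D i)"
  using has_derivative_sum[of I f "\<lambda>i h. h \<bullet> D i" "at x"] assms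
  by (simp add: gderiv_def inner_sum_right)

text \<open>The two-point estimate that exact equilibria would give; \<open>F\<close> will be
  \<open>reg_cost own X f\<close>.\<close>

definition exact_estimate :: "('p::finite \<Rightarrow> real^'n \<Rightarrow> real) \<Rightarrow> real \<Rightarrow> real^'n \<Rightarrow> real^'n \<Rightarrow> real^'n" where
  "exact_estimate F \<xi> \<theta> u = (\<Sum>i\<in>UNIV. (real CARD('n) / \<xi> * (F i (\<theta> + \<xi> *\<^sub>R u) - F i \<theta>)) *\<^sub>R u)"

context
  fixes F :: "'p::finite \<Rightarrow> real^'n \<Rightarrow> real" and L \<xi> :: real
  assumes F: "\<And>i \<theta> \<theta>'. \<bar>F i \<theta> - F i \<theta>'\<bar> \<le> L * norm (\<theta> - \<theta>')" and \<xi>: "0 < \<xi>"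
begin

lemma exact_estimate_measurable: "case_prod (exact_estimate F \<xi>) \<in> borel_measurable (borel \<Otimes>\<^sub>M borel)"
proof -
  have [measurable]: "F i \<in> borel_measurable borel" for i by (rule lipschitz_measurable[OF F])
  show ?thesis unfolding exact_estimate_def[abs_def] by measurable
qed

text \<open>Two values at points of distance \<open>\<xi>\<close> are subtracted, so the Lipschitz
  bound cancels the factor \<open>1 / \<xi>\<close>.\<close>

lemma norm_exact_estimate:
  assumes "norm u = 1"
  shows "norm (exact_estimate F \<xi> \<theta> u) \<le> real CARD('n) * real CARD('p) * L"
proof -
  have "norm (exact_estimate F \<xi> \<theta> u) \<le> (\<Sum>i\<in>(UNIV::'p set). real CARD('n) * L)"
    unfolding exact_estimate_def
  proof (rule sum_norm_le)
    fix i
    have "\<bar>F i (\<theta> + \<xi> *\<^sub>R u) - F i \<theta>\<bar> \<le> L * \<xi>" using F[of i "\<theta> + \<xi> *\<^sub>R u" \<theta>] assms \<xi> by simp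
    then have "real CARD('n) / \<xi> * \<bar>F i (\<theta> + \<xi> *\<^sub>R u) - F i \<theta>\<bar> \<le> real CARD('n) / \<xi> * (L * \<xi>)"
      using \<xi> by (intro mult_left_mono) auto
    then show "norm ((real CARD('n) / \<xi> * (F i (\<theta> + \<xi> *\<^sub>R u) - F i \<theta>)) *\<^sub>R u) \<le> real CARD('n) * L"
      using assms \<xi> by (simp add: abs_mult)
  qed
  then show ?thesis by (simp add: mult_ac)
qed

text \<open>The subtracted value does not depend on \<open>u\<close>, and the mean direction is 0,
  so it leaves no bias.\<close>

lemma integral_exact_estimate:
  "(\<integral>u. exact_estimate F \<xi> \<theta> u \<partial>uniform_sphere)
    = (\<Sum>i\<in>UNIV. (real CARD('n) / \<xi>) *\<^sub>R (\<integral>u. F i (\<theta> + \<xi> *\<^sub>R u) *\<^sub>R u \<partial>uniform_sphere))"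
proof -
  have i1: "integrable uniform_sphere (\<lambda>u. F i (\<theta> + \<xi> *\<^sub>R u) *\<^sub>R u)" for i by (rule integrable_sphere_lipschitz[OF F])
  have i2: "integrable uniform_sphere (\<lambda>u :: real^'n. u)" by (rule integrable_uniform_sphere[of _ 1]) auto
  have "(\<integral>u. exact_estimate F \<xi> \<theta> u \<partial>uniform_sphere)
    = (\<integral>u. (\<Sum>i\<in>UNIV. (real CARD('n) / \<xi>) *\<^sub>R (F i (\<theta> + \<xi> *\<^sub>R u) *\<^sub>R u) - (real CARD('n) / \<xi> * F i \<theta>) *\<^sub>R u) \<partial>uniform_sphere)"
    unfolding exact_estimate_def by (simp add: algebra_simps)
  also have "\<dots> = (\<Sum>i\<in>UNIV. (\<integral>u. (real CARD('n) / \<xi>) *\<^sub>R (F i (\<theta> + \<xi> *\<^sub>R u) *\<^sub>R u) - (real CARD('n) / \<xi> * F i \<theta>) *\<^sub>R u \<partial>uniform_sphere))"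
    using i1 i2 by (intro Bochner_Integration.integral_sum Bochner_Integration.integrable_diff integrable_scaleR_right)
  also have "\<dots> = (\<Sum>i\<in>UNIV. (real CARD('n) / \<xi>) *\<^sub>R (\<integral>u. F i (\<theta> + \<xi> *\<^sub>R u) *\<^sub>R u \<partial>uniform_sphere))"
  proof (intro sum.cong refl)
    fix i
    show "(\<integral>u. (real CARD('n) / \<xi>) *\<^sub>R (F i (\<theta> + \<xi> *\<^sub>R u) *\<^sub>R u) - (real CARD('n) / \<xi> * F i \<theta>) *\<^sub>R u \<partial>uniform_sphere)
      = (real CARD('n) / \<xi>) *\<^sub>R (\<integral>u. F i (\<theta> + \<xi> *\<^sub>R u) *\<^sub>R u \<partial>uniform_sphere)"
      by (subst Bochner_Integration.integral_diff)
        (auto simp: i1 i2 integral_sphere_id integral_scaleR_right simp del: scaleR_scaleR intro!: integrable_scaleR_right)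
  qed
  finally show ?thesis .
qed

lemma ball_smoothing_sum_GDERIV:
  "GDERIV (\<lambda>\<theta>. \<Sum>i\<in>UNIV. \<integral>\<nu>. F i (\<theta> + \<xi> *\<^sub>R \<nu>) \<partial>uniform_measure lborel (cball 0 1)) \<theta>
    :> (\<integral>u. exact_estimate F \<xi> \<theta> u \<partial>uniform_sphere)"
  unfolding integral_exact_estimate
  using ball_smoothing_GDERIV[OF F \<xi>] by (intro GDERIV_sum) simp

text \<open>In the sphere formula a shift of the centre changes every value by at most
  \<open>L * norm (x - y)\<close>; the factor \<open>n / \<xi>\<close> stays in front.\<close>

lemma lipschitz_integral_exact_estimate:
  "norm ((\<integral>u. exact_estimate F \<xi> x u \<partial>uniform_sphere) - (\<integral>u. exact_estimate F \<xi> y u \<partial>uniform_sphere))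
    \<le> real CARD('n) * real CARD('p) * L / \<xi> * norm (x - y)"
proof -
  have i1: "integrable uniform_sphere (\<lambda>u. F i (\<theta> + \<xi> *\<^sub>R u) *\<^sub>R u)" for i \<theta> by (rule integrable_sphere_lipschitz[OF F])
  have [measurable]: "F i \<in> borel_measurable borel" for i by (rule lipschitz_measurable[OF F])
  have "norm ((\<integral>u. exact_estimate F \<xi> x u \<partial>uniform_sphere) - (\<integral>u. exact_estimate F \<xi> y u \<partial>uniform_sphere))
    \<le> (\<Sum>i\<in>(UNIV::'p set). real CARD('n) / \<xi> * (L * norm (x - y)))"
    unfolding integral_exact_estimate sum_subtractf[symmetric]
  proof (rule sum_norm_le)
    fix i
    have "norm ((\<integral>u. F i (x + \<xi> *\<^sub>R u) *\<^sub>R u \<partial>uniform_sphere) - (\<integral>u. F i (y + \<xi> *\<^sub>R u) *\<^sub>R u \<partial>uniform_sphere))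
      = norm (\<integral>u. (F i (x + \<xi> *\<^sub>R u) - F i (y + \<xi> *\<^sub>R u)) *\<^sub>R u \<partial>uniform_sphere)"
      using i1 by (simp add: scaleR_diff_left)
    also have "\<dots> \<le> L * norm (x - y)"
    proof (rule norm_integral_uniform_sphere_le)
      fix u :: "real^'n" assume "norm u = 1"
      then show "norm ((F i (x + \<xi> *\<^sub>R u) - F i (y + \<xi> *\<^sub>R u)) *\<^sub>R u) \<le> L * norm (x - y)"
        using F[of i "x + \<xi> *\<^sub>R u" "y + \<xi> *\<^sub>R u"] by simp
    qed simp
    finally show "norm ((real CARD('n) / \<xi>) *\<^sub>R (\<integral>u. F i (x + \<xi> *\<^sub>R u) *\<^sub>R u \<partial>uniform_sphere)
      - (real CARD('n) / \<xi>) *\<^sub>R (\<integral>u. F i (y + \<xi> *\<^sub>R u) *\<^sub>R u \<partial>uniform_sphere)) \<le> real CARD('n) / \<xi> * (L * norm (x - y))"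
      using \<xi> by (simp add: divide_right_mono mult_left_mono flip: scaleR_diff_right)
  qed
  then show ?thesis by (simp add: mult_ac)
qed

end

text \<open>Both sides are exponentials, and multiplying by \<open>ln q\<close>, which is negative,
  turns the lower bound on \<open>t\<close> into an upper bound on the exponent.\<close>

lemma power_le_powr_of_ceiling:
  fixes q x s :: real
  assumes q: "0 < q" "q < 1" and x: "0 < x" and t: "int t \<ge> \<lceil>- s * ln x / ln q\<rceil>"
  shows "q ^ t \<le> x powr - s"
proof -
  have lnq: "ln q < 0" using q by simp
  have "- s * ln x / ln q \<le> real t" using t by (simp add: ceiling_le_iff)
  then have "real t * ln q \<le> - s * ln x / ln q * ln q" using lnq by (intro mult_right_mono_neg) auto
  then have "real t * ln q \<le> - s * ln x" using lnq by simp
  then have "exp (real t * ln q) \<le> exp (- s * ln x)" by simp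
  then show ?thesis using q x by (simp add: exp_of_nat_mult powr_def)
qed

context strongly_monotone_game
begin

text \<open>Two cost evaluations for each player, each off by at most \<open>Lx * \<delta>\<close>,
  account for the factor 2.\<close>

lemma zo_gradient_error:
  fixes A :: "real^'p^'p"
  assumes init: "\<And>i. block own i (\<xx>\<^sub>0 $ i) \<in> X i" and \<xi>: "0 < \<xi>" and u: "norm u = 1" and Lx: "0 \<le> Lx"
    and fx: "\<And>i x x' \<theta>. x \<in> profiles own X \<Longrightarrow> x' \<in> profiles own X \<Longrightarrow> \<bar>f i x \<theta> - f i x' \<theta>\<bar> \<le> Lx * norm (x - x')"
    and err: "\<And>\<theta>. norm (approx_nash own X f A \<gamma> \<xx>\<^sub>0 t \<theta> - nash own X f \<theta>) \<le> \<delta>"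
  shows "norm (zo_gradient own X f A \<gamma> \<xx>\<^sub>0 \<xi> t \<theta> u - exact_estimate (reg_cost own X f) \<xi> \<theta> u)
    \<le> 2 * real CARD('n) * real CARD('p) * Lx / \<xi> * \<delta>"
proof -
  define a where "a = approx_nash own X f A \<gamma> \<xx>\<^sub>0 t"
  have err1: "\<bar>f i (a \<eta>) \<eta> - reg_cost own X f i \<eta>\<bar> \<le> Lx * \<delta>" for i \<eta>
  proof -
    have "\<bar>f i (a \<eta>) \<eta> - reg_cost own X f i \<eta>\<bar> \<le> Lx * norm (a \<eta> - nash own X f \<eta>)"
      unfolding reg_cost_def a_def by (intro fx approx_nash_in_profiles init nash_in_profiles)
    also have "\<dots> \<le> Lx * \<delta>" using err Lx unfolding a_def by (intro mult_left_mono)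
    finally show ?thesis .
  qed
  have "norm (zo_gradient own X f A \<gamma> \<xx>\<^sub>0 \<xi> t \<theta> u - exact_estimate (reg_cost own X f) \<xi> \<theta> u)
    \<le> (\<Sum>i\<in>(UNIV::'p set). real CARD('n) / \<xi> * (2 * (Lx * \<delta>)))"
    unfolding zo_gradient_def exact_estimate_def sum_subtractf[symmetric] a_def[symmetric]
      scaleR_diff_left[symmetric] right_diff_distrib[symmetric]
  proof (rule sum_norm_le)
    fix i
    have "\<bar>f i (a (\<theta> + \<xi> *\<^sub>R u)) (\<theta> + \<xi> *\<^sub>R u) - f i (a \<theta>) \<theta>
      - (reg_cost own X f i (\<theta> + \<xi> *\<^sub>R u) - reg_cost own X f i \<theta>)\<bar> \<le> 2 * (Lx * \<delta>)"
      using err1[of i "\<theta> + \<xi> *\<^sub>R u"] err1[of i \<theta>] by linarith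
    then show "norm ((real CARD('n) / \<xi> * (f i (a (\<theta> + \<xi> *\<^sub>R u)) (\<theta> + \<xi> *\<^sub>R u) - f i (a \<theta>) \<theta>
      - (reg_cost own X f i (\<theta> + \<xi> *\<^sub>R u) - reg_cost own X f i \<theta>))) *\<^sub>R u) \<le> real CARD('n) / \<xi> * (2 * (Lx * \<delta>))"
      using u \<xi> by (simp add: abs_mult divide_right_mono mult_left_mono)
  qed
  then show ?thesis by (simp add: field_simps)
qed

lemma smooth_objective_GDERIV:
  assumes F: "\<And>i \<theta> \<theta>'. \<bar>reg_cost own X f i \<theta> - reg_cost own X f i \<theta>'\<bar> \<le> L\<^sub>F * norm (\<theta> - \<theta>')" and \<xi>: "0 < \<xi>"
  shows "GDERIV (smooth_objective own X f \<Theta> \<xi>) \<theta>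
    :> (\<integral>u. exact_estimate (reg_cost own X f) \<xi> \<theta> u \<partial>uniform_sphere) + (1 / \<xi>) *\<^sub>R (\<theta> - closest_point \<Theta> \<theta>)"
proof -
  have \<Theta>: "closed \<Theta>" "\<Theta> \<noteq> {}" "convex \<Theta>" using regular by (auto simp: regular_game_def)
  have D: "((\<lambda>\<theta>. 1 / (2 * \<xi>) * (infdist \<theta> \<Theta>)\<^sup>2) has_derivative (\<lambda>h. 1 / (2 * \<xi>) * (h \<bullet> (2 *\<^sub>R (\<theta> - closest_point \<Theta> \<theta>))))) (at \<theta>)"
    by (rule has_derivative_mult_right[OF GDERIV_infdist_square[OF \<Theta>, unfolded gderiv_def]])
  have "GDERIV (\<lambda>\<theta>. (infdist \<theta> \<Theta>)\<^sup>2 / (2 * \<xi>)) \<theta> :> (1 / \<xi>) *\<^sub>R (\<theta> - closest_point \<Theta> \<theta>)"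
  proof -
    have "(\<lambda>\<theta>. 1 / (2 * \<xi>) * (infdist \<theta> \<Theta>)\<^sup>2) = (\<lambda>\<theta>. (infdist \<theta> \<Theta>)\<^sup>2 / (2 * \<xi>))" by auto
    moreover have "1 / (2 * \<xi>) * (h \<bullet> (2 *\<^sub>R d)) = h \<bullet> ((1 / \<xi>) *\<^sub>R d)" for h d :: "real^'n"
      using \<xi> by simp
    ultimately show ?thesis using D by (simp only: gderiv_def)
  qed
  then show ?thesis
    unfolding smooth_objective_def[abs_def] by (intro GDERIV_add ball_smoothing_sum_GDERIV[OF F \<xi>])
qed

lemma smooth_objective_gradient_lipschitz:
  assumes F: "\<And>i \<theta> \<theta>'. \<bar>reg_cost own X f i \<theta> - reg_cost own X f i \<theta>'\<bar> \<le> L\<^sub>F * norm (\<theta> - \<theta>')" and \<xi>: "0 < \<xi>"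
  shows "norm (gradient (smooth_objective own X f \<Theta> \<xi>) x - gradient (smooth_objective own X f \<Theta> \<xi>) y)
    \<le> (real CARD('n) * real CARD('p) * L\<^sub>F + 1) / \<xi> * norm (x - y)"
proof -
  have \<Theta>: "closed \<Theta>" "\<Theta> \<noteq> {}" "convex \<Theta>" using regular by (auto simp: regular_game_def)
  let ?h = "\<lambda>\<theta>. \<integral>u. exact_estimate (reg_cost own X f) \<xi> \<theta> u \<partial>uniform_sphere"
  let ?r = "\<lambda>\<theta>. \<theta> - closest_point \<Theta> \<theta>"
  have "norm ((?h x + (1 / \<xi>) *\<^sub>R ?r x) - (?h y + (1 / \<xi>) *\<^sub>R ?r y)) = norm ((?h x - ?h y) + (1 / \<xi>) *\<^sub>R (?r x - ?r y))"
    by (simp add: algebra_simps)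
  also have "\<dots> \<le> real CARD('n) * real CARD('p) * L\<^sub>F / \<xi> * norm (x - y) + 1 / \<xi> * norm (x - y)"
  proof (rule norm_triangle_mono[OF lipschitz_integral_exact_estimate[OF F \<xi>]])
    show "norm ((1 / \<xi>) *\<^sub>R (?r x - ?r y)) \<le> 1 / \<xi> * norm (x - y)"
      using norm_residual_closest_point_le[OF \<Theta>, of x y] \<xi> by (simp add: divide_right_mono)
  qed
  finally show ?thesis
    unfolding gradient_eqI[OF smooth_objective_GDERIV[OF F \<xi>]] by (simp add: algebra_simps add_divide_distrib)
qed

end

section \<open>Choice of constants and assembly of the rate\<close>

theorem corollary1:
  fixes own :: "'d::finite \<Rightarrow> 'p::finite"
    and X :: "'p \<Rightarrow> (real^'d) set"
    and f :: "'p \<Rightarrow> real^'d \<Rightarrow> real^'n \<Rightarrow> real"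
    and \<Theta> :: "(real^'n) set"
    and E :: "('p \<times> 'p) set" and A :: "real^'p^'p"
    and \<mu> l l' \<sigma>' \<gamma> q L\<^sub>F \<xi> s \<alpha>\<^sub>0 :: real
    and \<xx>\<^sub>0 :: "real^'d^'p" and \<theta>\<^sub>0 :: "real^'n"
    and M :: "nat \<Rightarrow> 'w measure"
    and u \<theta> :: "nat \<Rightarrow> nat \<Rightarrow> 'w \<Rightarrow> real^'n"
    and t :: "nat \<Rightarrow> nat \<Rightarrow> nat"
  assumes game: "regular_game own X f \<Theta>"
    and mono: "monotone_game own X f \<mu> l"
    and graph: "comm_graph E A \<sigma>'"
    and l'_bounds: "\<mu> \<le> l'" "l' \<le> l"
    and l'_lipschitz: "\<And>\<theta> \<xx> \<xx>'. norm (ext_pseudo_gradient own f \<xx> \<theta> - ext_pseudo_gradient own f \<xx>' \<theta>)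
                          \<le> l' * norm (\<xx> - \<xx>')"
    and \<gamma>_pos: "0 < \<gamma>"
    and \<gamma>_less: "\<gamma> < Min {1, \<sigma>' / (3 * l), 2 * \<mu> / l\<^sup>2, 2 * \<mu> * (1 - \<sigma>'\<^sup>2) / step_const \<mu> l l' \<sigma>'}"
    and q_def: "q = onorm ((*v) (Q_matrix (real CARD('p)) \<mu> l l' \<sigma>' \<gamma>))"
    and q_bounds: "0 < q" "q < 1"
    and L\<^sub>F_pos: "0 < L\<^sub>F"
    and L\<^sub>F: "\<And>i \<theta> \<theta>'. \<bar>reg_cost own X f i \<theta> - reg_cost own X f i \<theta>'\<bar> \<le> L\<^sub>F * norm (\<theta> - \<theta>')"
    and \<xi>_pos: "0 < \<xi>"
    and min_exists: "\<exists>\<theta>\<^sub>m. \<forall>\<theta>. smooth_objective own X f \<Theta> \<xi> \<theta>\<^sub>m \<le> smooth_objective own X f \<Theta> \<xi> \<theta>"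
    and inner_init: "\<And>i. block own i (\<xx>\<^sub>0 $ i) \<in> X i"
    and outer_init: "\<theta>\<^sub>0 \<in> \<Theta>"
    and s_bounds: "0 \<le> s" "s < 1"
    and \<alpha>\<^sub>0_pos: "0 < \<alpha>\<^sub>0"
    and run: "\<And>K. 1 \<le> K \<Longrightarrow>
      zo_run own X f \<Theta> A \<gamma> \<xx>\<^sub>0 \<xi> \<theta>\<^sub>0 (\<alpha>\<^sub>0 / sqrt (real K)) K (t K) (M K) (u K) (\<theta> K)"
    and inner_iterations: "\<And>K k. k < K \<Longrightarrow> int (t K k) \<ge> \<lceil>- s * ln (real k + 1) / ln q\<rceil>"
  shows "\<exists>C>0. \<forall>K\<ge>1. \<alpha>\<^sub>0 / sqrt (real K) \<le> \<xi> / (4 * (real CARD('n) * real CARD('p) * L\<^sub>F + 1)) \<longrightarrow>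
    (\<forall>k<K. integrable (M K) (\<lambda>\<omega>. (norm (gradient (smooth_objective own X f \<Theta> \<xi>) (\<theta> K k \<omega>)))\<^sup>2)) \<and>
    1 / real K * (\<Sum>k<K. \<integral>\<omega>. (norm (gradient (smooth_objective own X f \<Theta> \<xi>) (\<theta> K k \<omega>)))\<^sup>2 \<partial>M K)
      \<le> C * (1 / sqrt (real K) + 1 / real K powr s)"
proof -
  interpret strongly_monotone_game own X f \<Theta> \<mu> l by unfold_locales (fact game mono)+
  have l'0: "0 \<le> l'" using l'_bounds pseudo_gradient_props(1) by linarith
  define \<psi> where "\<psi> = smooth_objective own X f \<Theta> \<xi>"
  define g where "g = exact_estimate (reg_cost own X f) \<xi>"
  define w where "w \<theta> = (1 / \<xi>) *\<^sub>R (\<theta> - closest_point \<Theta> \<theta>)" for \<theta>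
  define L where "L = (real CARD('n) * real CARD('p) * L\<^sub>F + 1) / \<xi>"
  define G where "G = real CARD('n) * real CARD('p) * L\<^sub>F"
  obtain Dq where Dq: "\<And>\<theta> t. (norm (approx_nash own X f A \<gamma> \<xx>\<^sub>0 t \<theta> - nash own X f \<theta>))\<^sup>2 \<le> Dq * q ^ t"
    using approx_nash_error[OF graph l'0 l'_bounds(2) \<gamma>_pos l'_lipschitz, folded q_def] by blast
  have "0 \<le> Dq" using Dq[of 0] order_trans[OF zero_le_power2] by fastforce
  obtain Lx where Lx: "0 < Lx"
    "\<And>i x x' \<theta>. x \<in> profiles own X \<Longrightarrow> x' \<in> profiles own X \<Longrightarrow> \<bar>f i x \<theta> - f i x' \<theta>\<bar> \<le> Lx * norm (x - x')"
    using game unfolding regular_game_def by blast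
  obtain \<theta>\<^sub>m where \<theta>\<^sub>m: "\<And>\<theta>. \<psi> \<theta>\<^sub>m \<le> \<psi> \<theta>" using min_exists unfolding \<psi>_def by blast
  \<comment> \<open>\<open>c1\<close> converts an equilibrium error into an error of the estimate;
    its square times \<open>Dq\<close> is the factor of \<open>q ^ t\<close> in the squared
    bias.\<close>
  define c1 where "c1 = 2 * real CARD('n) * real CARD('p) * Lx / \<xi>"
  define c2 where "c2 = c1\<^sup>2 * Dq"
  define \<Delta> where "\<Delta> = \<psi> \<theta>\<^sub>0 - \<psi> \<theta>\<^sub>m"
  \<comment> \<open>The main terms come from the initial optimality gap, the noise and the inexact
    equilibria, after division by \<open>\<alpha> / 4\<close> and by \<open>K\<close>. The summand 1
    makes \<open>C\<close> positive.\<close>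
  define C where "C = 4 * \<Delta> / \<alpha>\<^sub>0 + 32 * L * G\<^sup>2 * \<alpha>\<^sub>0 + 4 * c2 / (1 - s) + 1"
  have L: "0 < L" unfolding L_def using \<xi>_pos L\<^sub>F_pos by (intro divide_pos_pos add_nonneg_pos mult_nonneg_nonneg) auto
  have c2: "0 \<le> c2" using \<open>0 \<le> Dq\<close> by (simp add: c2_def)
  have nonneg: "0 \<le> 4 * \<Delta> / \<alpha>\<^sub>0" "0 \<le> 32 * L * G\<^sup>2 * \<alpha>\<^sub>0" "0 \<le> 4 * c2 / (1 - s)"
    using \<theta>\<^sub>m[of \<theta>\<^sub>0] \<alpha>\<^sub>0_pos L c2 s_bounds by (auto simp: \<Delta>_def)
  have grad: "gradient \<psi> \<eta> = (\<integral>v. g \<eta> v \<partial>uniform_sphere) + w \<eta>" for \<eta>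
    unfolding \<psi>_def g_def w_def by (rule gradient_eqI[OF smooth_objective_GDERIV[OF L\<^sub>F \<xi>_pos]])
  have GD: "GDERIV \<psi> \<eta> :> gradient \<psi> \<eta>" for \<eta>
    unfolding grad unfolding \<psi>_def g_def w_def by (rule smooth_objective_GDERIV[OF L\<^sub>F \<xi>_pos])
  have "(\<forall>k<K. integrable (M K) (\<lambda>\<omega>. (norm (gradient \<psi> (\<theta> K k \<omega>)))\<^sup>2)) \<and>
    1 / real K * (\<Sum>k<K. \<integral>\<omega>. (norm (gradient \<psi> (\<theta> K k \<omega>)))\<^sup>2 \<partial>M K) \<le> C * (1 / sqrt (real K) + 1 / real K powr s)"
    if K: "1 \<le> K" and small: "\<alpha>\<^sub>0 / sqrt (real K) \<le> \<xi> / (4 * (real CARD('n) * real CARD('p) * L\<^sub>F + 1))" for K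
  proof -
    define \<alpha> where "\<alpha> = \<alpha>\<^sub>0 / sqrt (real K)"
    have \<alpha>: "0 < \<alpha>" using K \<alpha>\<^sub>0_pos by (simp add: \<alpha>_def)
    have \<alpha>L: "\<alpha> * L \<le> 1 / 4"
    proof -
      \<comment> \<open>By the definition of \<open>L\<close>, the product \<open>\<xi> * L\<close>
        is the expression multiplied by 4 in the denominator of the step size condition.\<close>
      have "\<alpha> * L \<le> \<xi> / (4 * (\<xi> * L)) * L"
        using small L \<xi>_pos by (intro mult_right_mono) (auto simp: \<alpha>_def L_def)
      then show ?thesis using L \<xi>_pos by simp
    qed
    define e where "e k \<omega> = zo_gradient own X f A \<gamma> \<xx>\<^sub>0 \<xi> (t K k) (\<theta> K k \<omega>) (u K k \<omega>)" for k \<omega>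
    define \<epsilon> where "\<epsilon> k = c1 * sqrt (Dq * q ^ t K k)" for k
    note r = run[OF K, unfolded zo_run_def, folded \<alpha>_def]
    have M: "prob_space (M K)" using r by blast
    have indep: "prob_space.indep_set (M K) {u K k -` B \<inter> space (M K) |B. B \<in> sets borel}
      {\<theta> K k -` B \<inter> space (M K) |B. B \<in> sets borel}" if "k < K" for k
    proof -
      interpret prob_space "M K" by (rule M)
      have ip: "indep_set {u K k -` B \<inter> space (M K) |B. B \<in> sets borel} (past_events (M K) (u K) (\<theta> K) k)"
        using r that by blast
      \<comment> \<open>The current iterate counts as past: \<open>past_events\<close> contains the
        iterates up to and including index \<open>k\<close>, but only the earlier
        directions.\<close>
      have sub: "{\<theta> K k -` B \<inter> space (M K) |B. B \<in> sets borel} \<subseteq> past_events (M K) (u K) (\<theta> K) k"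
        unfolding past_events_def by (auto intro!: sigma_sets.Basic)
      show ?thesis
      proof (rule indep_setI)
        show "{u K k -` B \<inter> space (M K) |B. B \<in> sets borel} \<subseteq> events"
          "{\<theta> K k -` B \<inter> space (M K) |B. B \<in> sets borel} \<subseteq> events"
          using r that by (auto intro!: measurable_sets)
      qed (use indep_setD[OF ip] sub in blast)
    qed
    have err: "norm (e k \<omega> - g (\<theta> K k \<omega>) (u K k \<omega>)) \<le> \<epsilon> k" if "norm (u K k \<omega>) = 1" for k \<omega>
      unfolding e_def g_def \<epsilon>_def c1_def
      using inner_init \<xi>_pos that Lx Dq by (intro zo_gradient_error real_le_rsqrt) auto
    have step: "\<theta> K (Suc k) \<omega> = \<theta> K k \<omega> - \<alpha> *\<^sub>R (e k \<omega> + w (\<theta> K k \<omega>))" if "k < K" "\<omega> \<in> space (M K)" for k \<omega>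
      using r that unfolding e_def w_def by blast
    have lip: "norm (gradient \<psi> x - gradient \<psi> y) \<le> L * norm (x - y)" for x y
      unfolding \<psi>_def L_def by (rule smooth_objective_gradient_lipschitz[OF L\<^sub>F \<xi>_pos])
    have gm: "case_prod g \<in> borel_measurable (borel \<Otimes>\<^sub>M borel)"
      unfolding g_def by (rule exact_estimate_measurable[OF L\<^sub>F \<xi>_pos])
    have gb: "norm (g x v) \<le> G" if "norm v = 1" for x v
      unfolding g_def G_def by (rule norm_exact_estimate[OF L\<^sub>F \<xi>_pos that])
    have m: "\<And>k. k \<le> K \<Longrightarrow> \<theta> K k \<in> borel_measurable (M K)" "\<And>k. k < K \<Longrightarrow> u K k \<in> borel_measurable (M K)"
      "\<And>k. k < K \<Longrightarrow> distr (M K) borel (u K k) = uniform_sphere"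
      "\<And>\<omega>. \<omega> \<in> space (M K) \<Longrightarrow> \<theta> K 0 \<omega> = \<theta>\<^sub>0"
      using r by blast+
    note sgd = inexact_stochastic_gradient_descent[OF M m(1-3) indep m(4) step GD lip less_imp_le[OF L] \<theta>\<^sub>m grad gm gb err \<alpha> \<alpha>L]
    define S where "S = (\<Sum>k<K. \<integral>\<omega>. (norm (gradient \<psi> (\<theta> K k \<omega>)))\<^sup>2 \<partial>M K)"
    have "\<alpha> / 4 * S \<le> \<Delta> + (\<Sum>k<K. \<alpha> / 2 * (\<epsilon> k)\<^sup>2 + L * \<alpha>\<^sup>2 * (8 * G\<^sup>2 + 2 * (\<epsilon> k)\<^sup>2))"
      unfolding S_def \<Delta>_def by (rule sgd(2))
    also have "(\<Sum>k<K. \<alpha> / 2 * (\<epsilon> k)\<^sup>2 + L * \<alpha>\<^sup>2 * (8 * G\<^sup>2 + 2 * (\<epsilon> k)\<^sup>2))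
      \<le> (\<Sum>k<K. \<alpha> * c2 * (real k + 1) powr - s + 8 * L * G\<^sup>2 * \<alpha>\<^sup>2)"
    proof (rule sum_mono)
      fix k assume "k \<in> {..<K}"
      then have "q ^ t K k \<le> (real k + 1) powr - s"
        by (intro power_le_powr_of_ceiling q_bounds inner_iterations) auto
      then have "c2 * q ^ t K k \<le> c2 * (real k + 1) powr - s" using c2 by (rule mult_left_mono)
      moreover have "(\<epsilon> k)\<^sup>2 = c2 * q ^ t K k"
        using \<open>0 \<le> Dq\<close> q_bounds by (simp add: \<epsilon>_def c2_def power_mult_distrib)
      ultimately have e: "\<alpha> * (\<epsilon> k)\<^sup>2 \<le> \<alpha> * (c2 * (real k + 1) powr - s)" using \<alpha> by simp
      \<comment> \<open>The second-order bias term is at most \<open>\<alpha> / 2\<close> times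
        \<open>(\<epsilon> k)\<^sup>2\<close>, so the two bias terms add up to at most
        \<open>\<alpha> * (\<epsilon> k)\<^sup>2\<close>.\<close>
      have "(\<alpha> * L) * (\<alpha> * (2 * (\<epsilon> k)\<^sup>2)) \<le> 1 / 4 * (\<alpha> * (2 * (\<epsilon> k)\<^sup>2))"
        using \<alpha>L \<alpha> by (intro mult_right_mono) auto
      then show "\<alpha> / 2 * (\<epsilon> k)\<^sup>2 + L * \<alpha>\<^sup>2 * (8 * G\<^sup>2 + 2 * (\<epsilon> k)\<^sup>2) \<le> \<alpha> * c2 * (real k + 1) powr - s + 8 * L * G\<^sup>2 * \<alpha>\<^sup>2"
        using e by (simp add: power2_eq_square algebra_simps)
    qed
    also have "\<dots> = \<alpha> * c2 * (\<Sum>k<K. (real k + 1) powr - s) + real K * (8 * L * G\<^sup>2 * \<alpha>\<^sup>2)"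
      by (simp add: sum.distrib sum_distrib_left)
    also have "\<dots> \<le> \<alpha> * c2 * (real K powr (1 - s) / (1 - s)) + real K * (8 * L * G\<^sup>2 * \<alpha>\<^sup>2)"
      using \<alpha> c2 by (intro add_right_mono mult_left_mono sum_inverse_powr_le s_bounds) auto
    \<comment> \<open>This factor isolates the average. The gap is then divided by
      \<open>\<alpha> * real K = \<alpha>\<^sub>0 * sqrt (real K)\<close> and the noise keeps one
      factor \<open>\<alpha>\<close>, so both are of order \<open>1 / sqrt (real K)\<close>.\<close>
    finally have "4 / (\<alpha> * real K) * (\<alpha> / 4 * S)
      \<le> 4 / (\<alpha> * real K) * (\<Delta> + (\<alpha> * c2 * (real K powr (1 - s) / (1 - s)) + real K * (8 * L * G\<^sup>2 * \<alpha>\<^sup>2)))"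
      using \<alpha> K by (intro mult_left_mono) auto
    also have "4 / (\<alpha> * real K) * (\<alpha> / 4 * S) = 1 / real K * S" using \<alpha> by simp
    also have "4 / (\<alpha> * real K) * (\<Delta> + (\<alpha> * c2 * (real K powr (1 - s) / (1 - s)) + real K * (8 * L * G\<^sup>2 * \<alpha>\<^sup>2)))
      = 4 * \<Delta> / (\<alpha> * real K) + 4 * c2 / (1 - s) * (real K powr (1 - s) / real K) + 32 * L * G\<^sup>2 * \<alpha>"
    proof -
      have "4 / (\<alpha> * real K) * (\<Delta> + (\<alpha> * c2 * (y / d) + real K * (8 * L * G\<^sup>2 * \<alpha>\<^sup>2)))
        = 4 * \<Delta> / (\<alpha> * real K) + 4 * c2 / d * (y / real K) + 32 * L * G\<^sup>2 * \<alpha>" if "d \<noteq> 0" for y d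
        using \<alpha> K that by (simp add: field_simps power2_eq_square)
      then show ?thesis using s_bounds by simp
    qed
    also have "real K powr (1 - s) / real K = 1 / real K powr s"
      using K by (simp add: powr_diff)
    also have "4 * \<Delta> / (\<alpha> * real K) = 4 * \<Delta> / \<alpha>\<^sub>0 * (1 / sqrt (real K))"
    proof -
      have "\<alpha> * real K = \<alpha>\<^sub>0 * (real K / sqrt (real K))" by (simp add: \<alpha>_def)
      also have "\<dots> = \<alpha>\<^sub>0 * sqrt (real K)" by (simp only: real_div_sqrt of_nat_0_le_iff)
      finally show ?thesis by simp
    qed
    also have "32 * L * G\<^sup>2 * \<alpha> = 32 * L * G\<^sup>2 * \<alpha>\<^sub>0 * (1 / sqrt (real K))" by (simp add: \<alpha>_def)
    also have "4 * \<Delta> / \<alpha>\<^sub>0 * (1 / sqrt (real K)) + 4 * c2 / (1 - s) * (1 / real K powr s) + 32 * L * G\<^sup>2 * \<alpha>\<^sub>0 * (1 / sqrt (real K))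
      \<le> C * (1 / sqrt (real K) + 1 / real K powr s)"
    proof -
      have "4 * \<Delta> / \<alpha>\<^sub>0 + 32 * L * G\<^sup>2 * \<alpha>\<^sub>0 \<le> C" "4 * c2 / (1 - s) \<le> C"
        using nonneg by (auto simp: C_def)
      then have "(4 * \<Delta> / \<alpha>\<^sub>0 + 32 * L * G\<^sup>2 * \<alpha>\<^sub>0) * (1 / sqrt (real K)) + 4 * c2 / (1 - s) * (1 / real K powr s)
        \<le> C * (1 / sqrt (real K)) + C * (1 / real K powr s)"
        by (intro add_mono mult_right_mono) auto
      then show ?thesis by (simp only: distrib_left distrib_right add_ac)
    qed
    finally have "1 / real K * S \<le> C * (1 / sqrt (real K) + 1 / real K powr s)" .
    then show ?thesis using sgd(1) unfolding S_def by blast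
  qed
  moreover have "0 < C" using nonneg unfolding C_def by linarith
  ultimately show ?thesis unfolding \<psi>_def by blast
qed

end
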